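(* Consider the East model on $\mathbb{Z}$ with parameter $p\in[0,1)$ and reversible Bernoulli($p$) product measure $\mu$. Fix $p'\in(0,1)$ and let $\nu$ be the Bernoulli($p'$) product measure on $\Omega=\{0,1\}^{\mathbb{Z}}$. There exists $m>0$ and, for any local function $f$, there exists $C_f<\infty$ such that: (a) for any $t>0$ $$\int d\nu(\eta)\,\bigl|\mathbb{E}\bigl(f(\eta_t)\bigr)-\mu(f)\bigr|\le C_f\,e^{-mt};$$ (b) for $\nu$-almost all configurations $\eta$ there exists $t_0(\eta,f)$ such that for any $t>t_0(\eta,f)$ $$\bigl|\mathbb{E}\bigl(f(\eta_t)\bigr)-\mu(f)\bigr|\le C_f\,e^{-mt}.$$
   Context: Let $\Omega=\{0,1\}^{\mathbb{Z}}$ and let $\mu=\bigotimes_{x\in\mathbb{Z}}\mu_x$ be the product measure with each $\mu_x$ Bernoulli($p$) on $\{0,1\}$ (value $1$ with probability $p$). A function $f:\Omega\to\mathbb{R}$ is local if it depends on finitely many variables. The East model is the Markov process on $\Omega$ whose generator acts on local functions by $$\mathcal{L}f(\omega)=\sum_{x\in\mathbb{Z}}(1-\omega_{x+1})\,[\mu_x(f)-f(\omega)],$$ where $\mu_x(f)=\int d\mu_x(\omega_x)f(\omega)$ averages over $\omega_x$ only, all other variables being held fixed. That is, each site $x$ has an independent rate-one Poisson clock; when it rings, if the spin at $x+1$ is $0$ the spin at $x$ is replaced by an independent Bernoulli($p$) variable, and otherwise nothing happens. $\mathbb{E}(f(\eta_t))$ denotes the expectation of $f$ at time $t$ over the process started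 from the configuration $\eta$. *)

theory Defs
  imports "HOL-Probability.Probability"
begin

section \<open>Feller processes\<close>

text \<open>Here \<open>S\<close> is a measurable structure on the state space and \<open>K t x\<close> is the law at time \<open>t\<close> of the
  process started from \<open>x\<close>. Time is \<open>real\<close>, and nothing is assumed about negative times.\<close>

definition transition_op :: "(real \<Rightarrow> 'a \<Rightarrow> 'a measure) \<Rightarrow> real \<Rightarrow> ('a \<Rightarrow> real) \<Rightarrow> 'a \<Rightarrow> real" where
  "transition_op K t f x = (\<integral>y. f y \<partial>K t x)"

definition transition_function :: "'a measure \<Rightarrow> (real \<Rightarrow> 'a \<Rightarrow> 'a measure) \<Rightarrow> bool" where
  "transition_function S K \<longleftrightarrow>
     (\<forall>t\<ge>0. K t \<in> S \<rightarrow>\<^sub>M prob_algebra S) \<and>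
     (\<forall>x\<in>space S. K 0 x = return S x) \<and>
     (\<forall>s\<ge>0. \<forall>t\<ge>0. \<forall>x\<in>space S. K (s + t) x = K s x \<bind> K t)"

text \<open>The Feller property on \<open>C(\<Omega>)\<close>, for a compact state space \<open>\<Omega>\<close> (so that continuous functions are
  bounded and uniform convergence is convergence in the norm of \<open>C(\<Omega>)\<close>).\<close>

definition feller :: "'a::topological_space measure \<Rightarrow> (real \<Rightarrow> 'a \<Rightarrow> 'a measure) \<Rightarrow> bool" where
  "feller S K \<longleftrightarrow> transition_function S K \<and>
     (\<forall>f. continuous_on UNIV f \<longrightarrow>
        (\<forall>t\<ge>0. continuous_on UNIV (transition_op K t f)) \<and>
        uniform_limit UNIV (\<lambda>t. transition_op K t f) f (at_right 0))"

text \<open>\<open>has_generator_value K f g\<close>: \<open>f\<close> lies in the domain of the infinitesimal generator of the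
  semigroup on \<open>C(\<Omega>)\<close> given by \<open>K\<close>, and the generator maps \<open>f\<close> to \<open>g\<close>.\<close>

definition has_generator_value ::
    "(real \<Rightarrow> 'a::topological_space \<Rightarrow> 'a measure) \<Rightarrow> ('a \<Rightarrow> real) \<Rightarrow> ('a \<Rightarrow> real) \<Rightarrow> bool" where
  "has_generator_value K f g \<longleftrightarrow>
     continuous_on UNIV f \<and> continuous_on UNIV g \<and>
     uniform_limit UNIV (\<lambda>t x. (transition_op K t f x - f x) / t) g (at_right 0)"

definition natural_filtration ::
    "'s measure \<Rightarrow> 'a measure \<Rightarrow> (real \<Rightarrow> 's \<Rightarrow> 'a) \<Rightarrow> real \<Rightarrow> 's measure" where
  "natural_filtration M S X s =
     sigma (space M) {X u -` B \<inter> space M | u B. 0 \<le> u \<and> u \<le> s \<and> B \<in> sets S}"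

text \<open>\<open>P x\<close> is the probability measure on the sample space under which the process \<open>X\<close> starts
  from \<open>x\<close>.\<close>

definition markov_process ::
    "'a measure \<Rightarrow> (real \<Rightarrow> 'a \<Rightarrow> 'a measure) \<Rightarrow> ('a \<Rightarrow> 's measure) \<Rightarrow> (real \<Rightarrow> 's \<Rightarrow> 'a) \<Rightarrow> bool" where
  "markov_process S K P X \<longleftrightarrow> transition_function S K \<and>
     (\<forall>x\<in>space S.
        prob_space (P x) \<and>
        (\<forall>t\<ge>0. X t \<in> P x \<rightarrow>\<^sub>M S) \<and>
        (AE w in P x. X 0 w = x) \<and>
        (\<forall>s\<ge>0. \<forall>t\<ge>0. \<forall>B\<in>sets S. AE w in P x.
           real_cond_exp (P x) (natural_filtration (P x) S X s) (\<lambda>w. indicator B (X (s + t) w)) w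
             = measure (K t (X s w)) B))"

section \<open>The East model on the integers\<close>

text \<open>The spin values 1 and 0 are \<open>True\<close> and \<open>False\<close>. The topology on \<open>config\<close> is the product
  of the discrete topologies.\<close>

type_synonym config = "int \<Rightarrow> bool"

definition config_space :: "config measure" where
  "config_space = PiM UNIV (\<lambda>_. count_space UNIV)"

definition bernoulli_product :: "real \<Rightarrow> config measure" where
  "bernoulli_product p = PiM UNIV (\<lambda>_. measure_pmf (bernoulli_pmf p))"

definition local_fun :: "(config \<Rightarrow> real) \<Rightarrow> bool" where
  "local_fun f \<longleftrightarrow> (\<exists>A. finite A \<and> (\<forall>\<omega> \<omega>'. (\<forall>x\<in>A. \<omega> x = \<omega>' x) \<longrightarrow> f \<omega> = f \<omega>'))"

definition site_average :: "real \<Rightarrow> int \<Rightarrow> (config \<Rightarrow> real) \<Rightarrow> config \<Rightarrow> real" where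
  "site_average p x f \<omega> = (\<integral>v. f (fun_upd \<omega> x v) \<partial>measure_pmf (bernoulli_pmf p))"

text \<open>For local \<open>f\<close> only finitely many terms of the sum are nonzero, see
  \<open>east_generator_eq_sum\<close> below.\<close>

definition east_generator :: "real \<Rightarrow> (config \<Rightarrow> real) \<Rightarrow> config \<Rightarrow> real" where
  "east_generator p f \<omega> =
     (\<Sum>\<^sub>\<infinity>x\<in>UNIV. (1 - of_bool (\<omega> (x + 1))) * (site_average p x f \<omega> - f \<omega>))"

lemma east_generator_eq_sum:
  assumes "finite A" and loc: "\<And>\<omega> \<omega>'. (\<forall>x\<in>A. \<omega> x = \<omega>' x) \<Longrightarrow> f \<omega> = f \<omega>'"
  shows "east_generator p f \<omega> =
    (\<Sum>x\<in>A. (1 - of_bool (\<omega> (x + 1))) * (site_average p x f \<omega> - f \<omega>))"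
proof -
  have zero: "site_average p x f \<omega> - f \<omega> = 0" if "x \<notin> A" for x
  proof -
    have "f (fun_upd \<omega> x v) = f \<omega>" for v
      using that by (intro loc) auto
    then show ?thesis
      by (simp add: site_average_def)
  qed
  have "east_generator p f \<omega> =
      (\<Sum>\<^sub>\<infinity>x\<in>A. (1 - of_bool (\<omega> (x + 1))) * (site_average p x f \<omega> - f \<omega>))"
    unfolding east_generator_def by (rule infsum_cong_neutral) (auto simp: zero)
  then show ?thesis
    using assms(1) by simp
qed

text \<open>The local functions are a core for the generator, so this condition determines \<open>K\<close>, and
  hence the law of the process, uniquely.\<close>

definition east_process ::
    "real \<Rightarrow> (config \<Rightarrow> 's measure) \<Rightarrow> (real \<Rightarrow> 's \<Rightarrow> config) \<Rightarrow> bool" where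
  "east_process p P X \<longleftrightarrow>
     (\<exists>K. feller config_space K \<and>
          (\<forall>f. local_fun f \<longrightarrow> has_generator_value K f (east_generator p f)) \<and>
          markov_process config_space K P X)"

end

theory Submission
  imports Defs
begin

text \<open>Let \<open>\<eta>\<close> have a zero at \<open>z\<close> to the right of the support of \<open>f\<close>, and let \<open>P t\<close> be the semigroup. Averaging
  \<open>P t f\<close> over equilibrium spins in \<open>[a, z)\<close> gives exactly \<open>\<mu>(f)\<close>, and the variance of \<open>P t f\<close> under it
  contracts at the rate of the spectral gap: updates to the left of \<open>z\<close> are a reversible East
  dynamics with a zero boundary condition, updates to the right do not touch the zero, and an update
  at \<open>z\<close> itself is possible only if there is a zero at \<open>z + 1\<close>, which then takes over the role of the
  distinguished zero. The spectral gap is bounded away from 0 uniformly in \<open>z\<close>. Hence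
  \<open>\<bar>P t f \<eta> - \<mu>(f)\<bar> \<le> C R\<^sup>z exp (- g t)\<close>, the factor \<open>R\<^sup>z\<close> being the price for passing from the
  equilibrium average to the single configuration \<open>\<eta>\<close>. Under \<open>\<nu>\<close> the distance to the first zero has an
  exponential tail, which gives (a) by considering the zeros within distance \<open>\<delta> t\<close>, and (b) directly.

  The variance argument is carried out for local functions only: for short times \<open>P t f\<close> is the
  uniform limit of the Taylor polynomials in the generator, which are local, and the class of
  functions with the required mean and variance bounds is closed under uniform limits.\<close>

text \<open>For one fixed position of the zero and one fixed exterior the second moment obeys no
  closed differential inequality: after a move of the zero it is taken over a longer block and with
  other exterior spins. Hence means and moments are controlled for all positions at or beyond the
  support and all exteriors at once. Exterior updates then contribute at most a multiple of the gap
  between the common bound and the value at hand, and this cancels for small time steps. A common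
  bound of this kind need not be differentiable in time, so the decay is derived from an Euler
  scheme whose step tends to 0.

  Each application of the generator widens the support by one site and costs a factor of twice the
  width. The \<open>n\<close>-th iterate is thus of size \<open>2 ^ n\<close> times a rising
  factorial, that is \<open>fact n\<close> up to a polynomial. This bound makes the exponential
  series converge for short times only; 1/8 is a safe choice, and longer times are reached by
  iteration.

  The uniform gap rests on splitting the variance into orthogonal increments, one per site.\<close>

section \<open>Functions of finitely many spins\<close>

definition determined_on :: "int set \<Rightarrow> (config \<Rightarrow> real) \<Rightarrow> bool" where
  "determined_on A u \<longleftrightarrow> (\<forall>\<eta> \<eta>'. (\<forall>x\<in>A. \<eta> x = \<eta>' x) \<longrightarrow> u \<eta> = u \<eta>')"

lemma determined_onD: "determined_on A u \<Longrightarrow> (\<And>x. x \<in> A \<Longrightarrow> \<eta> x = \<eta>' x) \<Longrightarrow> u \<eta> = u \<eta>'"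
  unfolding determined_on_def by blast

lemma determined_on_mono: "determined_on A u \<Longrightarrow> A \<subseteq> B \<Longrightarrow> determined_on B u"
  unfolding determined_on_def by blast

lemma determined_on_const: "determined_on A (\<lambda>\<eta>. c)"
  by (simp add: determined_on_def)

lemma determined_on_map2:
  "determined_on A u \<Longrightarrow> determined_on A v \<Longrightarrow> determined_on A (\<lambda>\<eta>. F (u \<eta>) (v \<eta>))"
  unfolding determined_on_def by metis

lemma determined_on_sum:
  "(\<And>i. i \<in> I \<Longrightarrow> determined_on A (u i)) \<Longrightarrow> determined_on A (\<lambda>\<eta>. \<Sum>i\<in>I. u i \<eta>)"
  unfolding determined_on_def by (intro allI impI sum.cong refl) blast

lemma determined_on_finite_bounded:
  assumes "finite A" "determined_on A u"
  shows "\<exists>B\<ge>0. \<forall>\<eta>. \<bar>u \<eta>\<bar> \<le> B"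
  using assms
proof (induction A arbitrary: u rule: finite_induct)
  case empty
  then have "u \<eta> = u (\<lambda>_. False)" for \<eta>
    by (auto simp: determined_on_def)
  then show ?case
    by (intro exI[of _ "\<bar>u (\<lambda>_. False)\<bar>"]) (metis abs_ge_zero order_refl)
next
  case (insert x A)
  have det: "determined_on A (\<lambda>\<eta>. u (\<eta>(x := v)))" for v
    using insert.prems by (auto simp: determined_on_def)
  obtain B where B: "B \<ge> 0" "\<And>\<eta>. \<bar>u (\<eta>(x := True))\<bar> \<le> B"
    using insert.IH[OF det[of True]] by blast
  obtain B' where B': "B' \<ge> 0" "\<And>\<eta>. \<bar>u (\<eta>(x := False))\<bar> \<le> B'"
    using insert.IH[OF det[of False]] by blast
  have "\<bar>u \<eta>\<bar> \<le> B + B'" for \<eta>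
    using B(2)[of \<eta>] B'(2)[of \<eta>] B(1) B'(1) by (cases "\<eta> x") (auto simp: fun_upd_idem)
  then show ?case
    using B(1) B'(1) by (intro exI[of _ "B + B'"]) auto
qed

lemma determined_on_finite_measurable:
  assumes "finite A" "determined_on A u"
  shows "u \<in> borel_measurable config_space"
  using assms
proof (induction A arbitrary: u rule: finite_induct)
  case empty
  then have "u = (\<lambda>\<eta>. u (\<lambda>_. False))"
    by (auto simp: determined_on_def)
  then show ?case
    by (rule ssubst) simp
next
  case (insert x A)
  have det: "determined_on A (\<lambda>\<eta>. u (\<eta>(x := v)))" for v
    using insert.prems by (auto simp: determined_on_def)
  have *: "(\<lambda>\<eta>. u (\<eta>(x := v))) \<in> borel_measurable config_space" for v
    by (rule insert.IH[OF det])
  have c: "(\<lambda>\<eta>. \<eta> x) \<in> config_space \<rightarrow>\<^sub>M count_space UNIV"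
    unfolding config_space_def by (rule measurable_component_singleton) simp
  have "u = (\<lambda>\<eta>. if \<eta> x then u (\<eta>(x := True)) else u (\<eta>(x := False)))"
    by (rule ext) (auto simp: fun_upd_idem)
  also have "\<dots> \<in> borel_measurable config_space"
    by (rule measurable_If[OF * *]) (use c in \<open>simp add: pred_def\<close>)
  finally show ?case .
qed

subsection \<open>Averages over finitely many sites\<close>

lemma site_average_eq:
  assumes "0 \<le> p" "p \<le> 1"
  shows "site_average p x f \<eta> = p * f (\<eta>(x := True)) + (1 - p) * f (\<eta>(x := False))"
  using assms by (simp add: site_average_def)

text \<open>This is the conditional expectation under the Bernoulli product measure given the spins
  outside \<open>S\<close>. Building it from two-point averages keeps the gap and moment estimates
  purely algebraic; the infinite product measure enters only later.\<close>

definition avg :: "real \<Rightarrow> int set \<Rightarrow> (config \<Rightarrow> real) \<Rightarrow> config \<Rightarrow> real" where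
  "avg p S u = Finite_Set.fold (site_average p) u S"

text \<open>For fixed \<open>j\<close> the map from \<open>i\<close> to \<open>i + s + j\<close> is
  injective, so each \<open>\<beta> m\<close> occurs at most once per \<open>j\<close>. This
  controls the overlap of sliding windows of length \<open>l\<close>.\<close>

lemma sum_shifted_le:
  fixes \<beta> :: "nat \<Rightarrow> real"
  assumes "\<And>m. m < n \<Longrightarrow> 0 \<le> \<beta> m"
  shows "(\<Sum>i<n. \<Sum>j<l. if i + s + j < n then \<beta> (i + s + j) else 0) \<le> real l * (\<Sum>m<n. \<beta> m)"
proof -
  have "(\<Sum>i<n. if i + s + j < n then \<beta> (i + s + j) else 0) \<le> (\<Sum>m<n. \<beta> m)" for j
  proof -
    have "(\<Sum>i<n. if i + s + j < n then \<beta> (i + s + j) else 0) = (\<Sum>i\<in>{i\<in>{..<n}. i + s + j < n}. \<beta> (i + s + j))"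
      by (rule sum.inter_filter[symmetric]) simp
    also have "\<dots> = sum \<beta> ((\<lambda>i. i + s + j) ` {i\<in>{..<n}. i + s + j < n})"
      by (subst sum.reindex) (auto simp: inj_on_def)
    also have "\<dots> \<le> (\<Sum>m<n. \<beta> m)"
      by (rule sum_mono2) (use assms in auto)
    finally show ?thesis .
  qed
  then have "(\<Sum>j<l. \<Sum>i<n. if i + s + j < n then \<beta> (i + s + j) else 0) \<le> (\<Sum>j<l. \<Sum>m<n. \<beta> m)"
    by (rule sum_mono)
  then show ?thesis
    by (subst sum.swap) simp
qed

locale spin_density =
  fixes p :: real
  assumes p0: "0 \<le> p" and p_less_1: "p < 1"
begin

lemma p1: "p \<le> 1"
  using p_less_1 by simp

lemmas site_avg = site_average_eq[OF p0 p1]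

text \<open>Commutation makes the fold independent of the order of the sites. Idempotence moreover
  admits overlapping sets in \<open>avg_Un\<close>, which yields the tower property
  \<open>avg_absorb\<close>.\<close>

lemma comp_fun_idem_site_average: "comp_fun_idem (site_average p)"
proof
  fix x y :: int
  show "site_average p y \<circ> site_average p x = site_average p x \<circ> site_average p y"
    by (cases "x = y") (auto simp: site_avg fun_eq_iff fun_upd_twist algebra_simps)
  show "site_average p x \<circ> site_average p x = site_average p x"
    by (auto simp: site_avg fun_eq_iff algebra_simps)
qed

interpretation comp_fun_idem "site_average p"
  by (rule comp_fun_idem_site_average)

lemma avg_empty [simp]: "avg p {} u = u"
  by (simp add: avg_def)

lemma avg_insert: "finite S \<Longrightarrow> avg p (insert x S) u = site_average p x (avg p S u)"
  by (simp add: avg_def)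

lemma avg_singleton: "avg p {x} u = site_average p x u"
  by (simp add: avg_insert)

lemma avg_Un:
  assumes "finite S" "finite T"
  shows "avg p (S \<union> T) u = avg p S (avg p T u)"
  using assms(1) by induction (use assms(2) in \<open>auto simp: avg_insert\<close>)

lemma avg_absorb:
  assumes "finite S" "T \<subseteq> S"
  shows "avg p S (avg p T u) = avg p S u"
  using avg_Un[of S T u] assms by (simp add: Un_absorb2 finite_subset)

lemma avg_absorb_site: "finite S \<Longrightarrow> x \<in> S \<Longrightarrow> avg p S (site_average p x u) = avg p S u"
  using avg_absorb[of S "{x}"] by (simp add: avg_singleton)

lemma avg_add: "finite S \<Longrightarrow> avg p S (\<lambda>\<eta>. u \<eta> + v \<eta>) \<eta> = avg p S u \<eta> + avg p S v \<eta>"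
  by (induction S arbitrary: \<eta> rule: finite_induct) (auto simp: avg_insert site_avg algebra_simps)

lemma avg_cmult: "finite S \<Longrightarrow> avg p S (\<lambda>\<eta>. c * u \<eta>) \<eta> = c * avg p S u \<eta>"
  by (induction S arbitrary: \<eta> rule: finite_induct) (auto simp: avg_insert site_avg algebra_simps)

lemma avg_diff: "finite S \<Longrightarrow> avg p S (\<lambda>\<eta>. u \<eta> - v \<eta>) \<eta> = avg p S u \<eta> - avg p S v \<eta>"
  using avg_add[of S u "\<lambda>\<eta>. (-1) * v \<eta>" \<eta>] avg_cmult[of S "-1" v \<eta>] by simp

lemma avg_const: "finite S \<Longrightarrow> avg p S (\<lambda>\<eta>. c) \<eta> = c"
  by (induction S arbitrary: \<eta> rule: finite_induct) (auto simp: avg_insert site_avg algebra_simps)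

lemma avg_sum: "finite S \<Longrightarrow> avg p S (\<lambda>\<eta>. \<Sum>i\<in>I. u i \<eta>) \<eta> = (\<Sum>i\<in>I. avg p S (u i) \<eta>)"
  by (induction I rule: infinite_finite_induct) (auto simp: avg_const avg_add)

lemma avg_mono:
  fixes \<eta> :: config
  assumes "finite S" "\<And>\<eta>'. (\<And>x. x \<notin> S \<Longrightarrow> \<eta>' x = \<eta> x) \<Longrightarrow> u \<eta>' \<le> v \<eta>'"
  shows "avg p S u \<eta> \<le> avg p S v \<eta>"
  using assms
proof (induction S arbitrary: \<eta> rule: finite_induct)
  case (insert x S)
  have "avg p S u (\<eta>(x := b)) \<le> avg p S v (\<eta>(x := b))" for b
    by (rule insert.IH) (use insert in auto)
  then show ?case
    using insert p0 p1 by (auto simp: avg_insert site_avg intro!: add_mono mult_left_mono)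
qed auto

lemma avg_cong:
  fixes \<eta> :: config
  assumes "finite S" "\<And>\<eta>'. (\<And>x. x \<notin> S \<Longrightarrow> \<eta>' x = \<eta> x) \<Longrightarrow> u \<eta>' = v \<eta>'"
  shows "avg p S u \<eta> = avg p S v \<eta>"
  using avg_mono[of S \<eta> u v] avg_mono[of S \<eta> v u] assms by (auto intro!: antisym)

lemma avg_nonneg: "finite S \<Longrightarrow> (\<And>\<eta>. 0 \<le> u \<eta>) \<Longrightarrow> 0 \<le> avg p S u \<eta>"
  using avg_mono[of S \<eta> "\<lambda>_. 0" u] by (simp add: avg_const)

lemma avg_le_const: "finite S \<Longrightarrow> (\<And>\<eta>. u \<eta> \<le> c) \<Longrightarrow> avg p S u \<eta> \<le> c"
  using avg_mono[of S \<eta> u "\<lambda>_. c"] by (simp add: avg_const)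

lemma avg_determined:
  fixes u :: "config \<Rightarrow> real"
  assumes "finite S" "determined_on A u"
  shows "determined_on (A - S) (avg p S u)"
  using assms
proof (induction S rule: finite_induct)
  case (insert x S)
  show ?case
    unfolding determined_on_def
  proof (intro allI impI)
    fix \<eta> \<eta>' :: config assume *: "\<forall>y\<in>A - insert x S. \<eta> y = \<eta>' y"
    have "avg p S u (\<eta>(x := b)) = avg p S u (\<eta>'(x := b))" for b
      by (rule determined_onD[OF insert.IH[OF insert.prems]]) (use * in auto)
    then show "avg p (insert x S) u \<eta> = avg p (insert x S) u \<eta>'"
      using insert by (simp add: avg_insert site_avg)
  qed
qed auto

lemma avg_determined_Compl: "finite S \<Longrightarrow> determined_on (- S) (avg p S u)"
proof -
  have "determined_on UNIV u"
    unfolding determined_on_def by (intro allI impI arg_cong[of _ _ u] ext) simp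
  moreover assume "finite S"
  ultimately show ?thesis
    using avg_determined[of S UNIV u] by (simp add: Compl_eq_Diff_UNIV)
qed

text \<open>Taking out what is known: \<open>determined_on (- S) g\<close> expresses that
  \<open>g\<close> ignores the spins in \<open>S\<close>, which is why \<open>determined_on\<close>
  admits infinite sets.\<close>

lemma avg_pull:
  assumes "finite S" "determined_on (- S) g"
  shows "avg p S (\<lambda>\<eta>. g \<eta> * u \<eta>) \<eta> = g \<eta> * avg p S u \<eta>"
proof -
  have "avg p S (\<lambda>\<eta>. g \<eta> * u \<eta>) \<eta> = avg p S (\<lambda>\<eta>'. g \<eta> * u \<eta>') \<eta>"
    by (rule avg_cong) (use assms in \<open>auto simp: determined_on_def\<close>)
  then show ?thesis
    using assms by (simp add: avg_cmult)
qed

lemma site_average_pull: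
  "determined_on (- {x}) g \<Longrightarrow> site_average p x (\<lambda>\<eta>. g \<eta> * u \<eta>) \<eta> = g \<eta> * site_average p x u \<eta>"
  using avg_pull[of "{x}"] by (simp add: avg_singleton)

lemma avg_Cauchy_Schwarz:
  assumes S: "finite S"
  shows "(avg p S (\<lambda>\<eta>. u \<eta> * v \<eta>) \<eta>)\<^sup>2 \<le> avg p S (\<lambda>\<eta>. (u \<eta>)\<^sup>2) \<eta> * avg p S (\<lambda>\<eta>. (v \<eta>)\<^sup>2) \<eta>"
proof -
  define \<alpha> \<beta> \<gamma> where "\<alpha> = avg p S (\<lambda>\<eta>. (u \<eta>)\<^sup>2) \<eta>" and "\<beta> = avg p S (\<lambda>\<eta>. u \<eta> * v \<eta>) \<eta>"
    and "\<gamma> = avg p S (\<lambda>\<eta>. (v \<eta>)\<^sup>2) \<eta>"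
  have q: "0 \<le> s\<^sup>2 * \<alpha> + 2 * s * r * \<beta> + r\<^sup>2 * \<gamma>" for s r
  proof -
    have "0 \<le> avg p S (\<lambda>\<eta>. (s * u \<eta> + r * v \<eta>)\<^sup>2) \<eta>"
      by (rule avg_nonneg[OF S]) simp
    also have "(\<lambda>\<eta>. (s * u \<eta> + r * v \<eta>)\<^sup>2)
        = (\<lambda>\<eta>. (s\<^sup>2 * (u \<eta>)\<^sup>2 + (2 * s * r) * (u \<eta> * v \<eta>)) + r\<^sup>2 * (v \<eta>)\<^sup>2)"
      by (auto simp: power2_eq_square algebra_simps)
    finally show ?thesis
      by (simp add: avg_add[OF S] avg_cmult[OF S] \<alpha>_def \<beta>_def \<gamma>_def)
  qed
  have "0 \<le> \<alpha>" "0 \<le> \<gamma>"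
    unfolding \<alpha>_def \<gamma>_def by (rule avg_nonneg[OF S]; simp)+
  have "\<beta>\<^sup>2 \<le> \<alpha> * \<gamma>"
  proof (cases "\<alpha> = 0")
    case False
    have "0 \<le> \<alpha> * (\<alpha> * \<gamma> - \<beta>\<^sup>2)"
      using q[of "- \<beta>" \<alpha>] by (simp add: power2_eq_square algebra_simps)
    then show ?thesis
      using False \<open>0 \<le> \<alpha>\<close> by (simp add: zero_le_mult_iff)
  next
    case True
    have "0 \<le> 2 * s * \<beta> + \<gamma>" for s
      using q[of s 1] True by simp
    \<comment> \<open>With \<open>\<alpha> = 0\<close> the quadratic form is affine in
      \<open>s\<close>; at this \<open>s\<close> it would equal -1 unless
      \<open>\<beta> = 0\<close>.\<close>
    from this[of "- (\<gamma> + 1) / (2 * \<beta>)"] have "\<beta> = 0"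
      by (cases "\<beta> = 0") (auto simp: field_simps)
    then show ?thesis
      using True by simp
  qed
  then show ?thesis
    by (simp add: \<alpha>_def \<beta>_def \<gamma>_def)
qed

lemma avg_Jensen:
  assumes "finite S"
  shows "(avg p S u \<eta>)\<^sup>2 \<le> avg p S (\<lambda>\<eta>. (u \<eta>)\<^sup>2) \<eta>"
  using avg_Cauchy_Schwarz[OF assms, of "\<lambda>_. 1" u \<eta>] assms by (simp add: avg_const)

text \<open>Pythagoras: because \<open>R \<subseteq> T\<close>, \<open>avg p T u\<close> is the
  conditional expectation of \<open>avg p R u\<close>, hence orthogonal to the difference of the
  two.\<close>

lemma avg_square_increment:
  assumes S: "finite S" and T: "T \<subseteq> S" and R: "R \<subseteq> T"
  shows "avg p S (\<lambda>\<eta>. (avg p R u \<eta> - avg p T u \<eta>)\<^sup>2) \<eta>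
    = avg p S (\<lambda>\<eta>. (avg p R u \<eta>)\<^sup>2) \<eta> - avg p S (\<lambda>\<eta>. (avg p T u \<eta>)\<^sup>2) \<eta>"
proof -
  have fT: "finite T" and fR: "finite R"
    using S T R by (auto intro: finite_subset)
  have "avg p S (\<lambda>\<eta>. avg p T u \<eta> * avg p R u \<eta>) \<eta>
      = avg p S (avg p T (\<lambda>\<eta>. avg p T u \<eta> * avg p R u \<eta>)) \<eta>"
    using avg_absorb[OF S T] by simp
  also have "avg p T (\<lambda>\<eta>. avg p T u \<eta> * avg p R u \<eta>) = (\<lambda>\<eta>. avg p T u \<eta> * avg p T u \<eta>)"
    by (rule ext) (simp add: avg_pull[OF fT avg_determined_Compl[OF fT]] avg_absorb[OF fT R])
  finally have *: "avg p S (\<lambda>\<eta>. avg p T u \<eta> * avg p R u \<eta>) \<eta> = avg p S (\<lambda>\<eta>. (avg p T u \<eta>)\<^sup>2) \<eta>"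
    by (simp add: power2_eq_square)
  have "avg p S (\<lambda>\<eta>. (avg p R u \<eta> - avg p T u \<eta>)\<^sup>2) \<eta>
      = avg p S (\<lambda>\<eta>. ((avg p R u \<eta>)\<^sup>2 + (avg p T u \<eta>)\<^sup>2) - 2 * (avg p T u \<eta> * avg p R u \<eta>)) \<eta>"
    by (rule avg_cong[OF S]) (simp add: power2_eq_square algebra_simps)
  then show ?thesis
    by (simp add: avg_add[OF S] avg_cmult[OF S] avg_diff[OF S] *)
qed

lemma avg_site_variance:
  assumes S: "finite S" and x: "x \<in> S"
  shows "avg p S (\<lambda>\<eta>. (u \<eta> - site_average p x u \<eta>)\<^sup>2) \<eta>
    = avg p S (\<lambda>\<eta>. (u \<eta>)\<^sup>2) \<eta> - avg p S (\<lambda>\<eta>. (site_average p x u \<eta>)\<^sup>2) \<eta>"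
  using avg_square_increment[OF S, of "{x}" "{}"] x by (simp add: avg_singleton)

lemma avg_site_variance_le:
  assumes S: "finite S" and x: "x \<in> S"
  shows "avg p S (\<lambda>\<eta>. (u \<eta> - site_average p x u \<eta>)\<^sup>2) \<eta>
    \<le> avg p S (\<lambda>\<eta>. (u \<eta>)\<^sup>2) \<eta> - (avg p S u \<eta>)\<^sup>2"
  using avg_Jensen[OF S, of "site_average p x u" \<eta>] avg_site_variance[OF S x]
  by (simp add: avg_absorb_site[OF S x])

lemma avg_all_True:
  assumes "finite S"
  shows "avg p S (\<lambda>\<eta>. of_bool (\<forall>y\<in>S. \<eta> y)) \<eta> = p ^ card S"
  using assms
proof (induction S arbitrary: \<eta> rule: finite_induct)
  case (insert x S)
  have "avg p S (\<lambda>\<eta>. of_bool (\<forall>y\<in>insert x S. \<eta> y)) \<eta> = of_bool (\<eta> x) * p ^ card S" for \<eta>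
  proof -
    have "avg p S (\<lambda>\<eta>. of_bool (\<forall>y\<in>insert x S. \<eta> y)) \<eta>
        = avg p S (\<lambda>\<eta>. of_bool (\<eta> x) * of_bool (\<forall>y\<in>S. \<eta> y)) \<eta>"
      by (rule avg_cong) (use insert in auto)
    also have "\<dots> = of_bool (\<eta> x) * p ^ card S"
      using insert by (subst avg_pull) (auto simp: determined_on_def)
    finally show ?thesis .
  qed
  then show ?case
    using insert by (simp add: avg_insert site_avg)
qed simp

subsection \<open>The spectral gap\<close>

text \<open>The increment at \<open>x\<close> is the average over the sites to its right of
  \<open>u\<close> minus its average at \<open>x\<close>. It is split according to whether the
  window of \<open>l\<close> sites to the right of \<open>x\<close> is fully occupied. The occupied
  part reproduces the increment itself with weight \<open>p ^ l\<close>, which moves to the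
  left-hand side, plus a remainder controlled by the increments inside the window.\<close>

lemma avg_increment_bound:
  fixes a :: int and i l n :: nat and u :: "config \<Rightarrow> real" and \<eta> :: config
  defines "x \<equiv> a + int i" and "S \<equiv> {a..<a + int n}"
    and "b \<equiv> \<lambda>j. avg p {a..<a + int n} (\<lambda>\<eta>. (avg p {a + int j..<a + int n} u \<eta>)\<^sup>2) \<eta>"
  assumes il: "Suc i + l \<le> n"
  shows "(1 - p ^ l)\<^sup>2 * (b (Suc i) - b i)
    \<le> 2 * avg p S (\<lambda>\<eta>. (1 - of_bool (\<forall>y\<in>{x + 1..x + int l}. \<eta> y))
          * (u \<eta> - site_average p x u \<eta>)\<^sup>2) \<eta>
      + 2 * p ^ l * (b (Suc i + l) - b (Suc i))"
proof -
  define f where "f j = avg p {a + int j..<a + int n} u" for j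
  define W where "W = {x + 1..x + int l}"
  define R where "R = {x + 1..<a + int n}"
  define R' where "R' = {x + int l + 1..<a + int n}"
  define B :: "config \<Rightarrow> real" where "B \<eta> = of_bool (\<forall>y\<in>W. \<eta> y)" for \<eta>
  define d where "d \<eta> = u \<eta> - site_average p x u \<eta>" for \<eta>
  define g where "g \<eta> = f (Suc i + l) \<eta> - f (Suc i) \<eta>" for \<eta>
  define h where "h = avg p W (\<lambda>\<eta>. B \<eta> * g \<eta>)"
  have fin: "finite S" "finite W" "finite R" "finite R'"
    by (simp_all add: S_def W_def R_def R'_def)
  have xR: "x \<notin> R" "x \<notin> W" and WR: "R = W \<union> R'" "W \<inter> R' = {}" and xS: "x \<in> S" "R \<subseteq> S" "W \<subseteq> S"
    using il by (auto simp: S_def W_def R_def R'_def x_def)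
  have fS: "f (Suc i) = avg p R u" and fl: "f (Suc i + l) = avg p R' u"
    by (simp_all add: f_def R_def R'_def x_def algebra_simps)
  have ivl: "{a + int i..<a + int n} = insert x R"
    using il by (auto simp: R_def x_def)
  have fi: "f i = site_average p x (f (Suc i))"
    unfolding f_def[of i] ivl fS by (rule avg_insert[OF fin(3)])
  have comm: "avg p R (site_average p x v) = site_average p x (avg p R v)" for v
    using avg_Un[of "{x}" R v] avg_Un[of R "{x}" v] fin(3) by (simp add: avg_singleton Un_commute)
  have detB: "determined_on W B"
    by (auto simp: B_def determined_on_def)
  \<comment> \<open>Averaging to the right of the window leaves \<open>B\<close> untouched.
    Subtracting \<open>f (Suc i)\<close>, which does not depend on the window, isolates the term
    \<open>p ^ l * f (Suc i)\<close>.\<close>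
  have g1: "avg p R (\<lambda>\<eta>. B \<eta> * u \<eta>) \<eta> = h \<eta> + p ^ l * f (Suc i) \<eta>" for \<eta>
  proof -
    have "avg p R' (\<lambda>\<eta>. B \<eta> * u \<eta>) = (\<lambda>\<eta>. B \<eta> * f (Suc i + l) \<eta>)"
      unfolding fl by (rule ext, rule avg_pull[OF fin(4)], rule determined_on_mono[OF detB]) (use WR in auto)
    then have "avg p R (\<lambda>\<eta>. B \<eta> * u \<eta>) \<eta> = avg p W (\<lambda>\<eta>. B \<eta> * f (Suc i + l) \<eta>) \<eta>"
      using avg_Un[OF fin(2) fin(4)] WR by simp
    also have "\<dots> = avg p W (\<lambda>\<eta>. B \<eta> * g \<eta> + f (Suc i) \<eta> * B \<eta>) \<eta>"
      by (simp add: g_def algebra_simps)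
    also have "\<dots> = h \<eta> + f (Suc i) \<eta> * avg p W B \<eta>"
    proof -
      have "determined_on (- W) (f (Suc i))"
        unfolding fS by (rule determined_on_mono[OF avg_determined_Compl[OF fin(3)]]) (use WR in auto)
      from avg_pull[OF fin(2) this] show ?thesis
        by (simp add: avg_add[OF fin(2)] h_def)
    qed
    also have "avg p W B \<eta> = p ^ l"
      using avg_all_True[OF fin(2)] by (simp add: B_def[abs_def] W_def)
    finally show ?thesis
      by simp
  qed
  have Bd: "avg p R (\<lambda>\<eta>. B \<eta> * d \<eta>) \<eta>
      = (h \<eta> - site_average p x h \<eta>) + p ^ l * (f (Suc i) \<eta> - f i \<eta>)" for \<eta>
  proof -
    have "site_average p x (\<lambda>\<eta>. B \<eta> * u \<eta>) = (\<lambda>\<eta>. B \<eta> * site_average p x u \<eta>)"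
      by (rule ext, rule site_average_pull, rule determined_on_mono[OF detB]) (use xR in auto)
    then have "avg p R (\<lambda>\<eta>. B \<eta> * d \<eta>) \<eta>
        = avg p R (\<lambda>\<eta>. B \<eta> * u \<eta>) \<eta> - site_average p x (avg p R (\<lambda>\<eta>. B \<eta> * u \<eta>)) \<eta>"
      unfolding comm[symmetric] by (simp add: d_def right_diff_distrib avg_diff[OF fin(3)])
    then show ?thesis
      by (simp add: g1 fi site_avg algebra_simps)
  qed
  have inc: "(1 - p ^ l) * (f (Suc i) \<eta> - f i \<eta>)
      = avg p R (\<lambda>\<eta>. (1 - B \<eta>) * d \<eta>) \<eta> + (h \<eta> - site_average p x h \<eta>)" for \<eta>
  proof -
    have "f (Suc i) \<eta> - f i \<eta> = avg p R d \<eta>"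
      unfolding d_def avg_diff[OF fin(3)] comm fi fS ..
    also have "\<dots> = avg p R (\<lambda>\<eta>. (1 - B \<eta>) * d \<eta>) \<eta> + avg p R (\<lambda>\<eta>. B \<eta> * d \<eta>) \<eta>"
      unfolding avg_add[OF fin(3), symmetric] by (simp add: algebra_simps)
    finally show ?thesis
      unfolding Bd by (simp add: algebra_simps)
  qed
  have "(1 - p ^ l)\<^sup>2 * (b (Suc i) - b i)
      = avg p S (\<lambda>\<eta>. (1 - p ^ l)\<^sup>2 * (f (Suc i) \<eta> - f i \<eta>)\<^sup>2) \<eta>"
    unfolding b_def f_def avg_cmult[OF fin(1)] S_def[symmetric]
    by (subst avg_square_increment[OF fin(1)]) (auto simp: S_def)
  also have "\<dots> = avg p S (\<lambda>\<eta>. (avg p R (\<lambda>\<eta>. (1 - B \<eta>) * d \<eta>) \<eta> + (h \<eta> - site_average p x h \<eta>))\<^sup>2) \<eta>"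
    by (simp add: inc[symmetric] power_mult_distrib)
  also have "\<dots> \<le> avg p S (\<lambda>\<eta>. 2 * avg p R (\<lambda>\<eta>. (1 - B \<eta>) * (d \<eta>)\<^sup>2) \<eta> + 2 * (h \<eta> - site_average p x h \<eta>)\<^sup>2) \<eta>"
  proof (rule avg_mono[OF fin(1)])
    fix \<eta>
    have "(avg p R (\<lambda>\<eta>. (1 - B \<eta>) * d \<eta>) \<eta>)\<^sup>2 \<le> avg p R (\<lambda>\<eta>. ((1 - B \<eta>) * d \<eta>)\<^sup>2) \<eta>"
      by (rule avg_Jensen[OF fin(3)])
    also have "(\<lambda>\<eta>. ((1 - B \<eta>) * d \<eta>)\<^sup>2) = (\<lambda>\<eta>. (1 - B \<eta>) * (d \<eta>)\<^sup>2)"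
      by (auto simp: B_def power_mult_distrib)
    finally show "(avg p R (\<lambda>\<eta>. (1 - B \<eta>) * d \<eta>) \<eta> + (h \<eta> - site_average p x h \<eta>))\<^sup>2
        \<le> 2 * avg p R (\<lambda>\<eta>. (1 - B \<eta>) * (d \<eta>)\<^sup>2) \<eta> + 2 * (h \<eta> - site_average p x h \<eta>)\<^sup>2"
      using sum_squares_bound[of "avg p R (\<lambda>\<eta>. (1 - B \<eta>) * d \<eta>) \<eta>" "h \<eta> - site_average p x h \<eta>"]
      by (simp add: power2_sum)
  qed
  also have "\<dots> = 2 * avg p S (\<lambda>\<eta>. (1 - B \<eta>) * (d \<eta>)\<^sup>2) \<eta>
      + 2 * avg p S (\<lambda>\<eta>. (h \<eta> - site_average p x h \<eta>)\<^sup>2) \<eta>"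
    by (simp add: avg_add[OF fin(1)] avg_cmult[OF fin(1)] avg_absorb[OF fin(1) xS(2)])
  also have "avg p S (\<lambda>\<eta>. (h \<eta> - site_average p x h \<eta>)\<^sup>2) \<eta> \<le> avg p S (\<lambda>\<eta>. (h \<eta>)\<^sup>2) \<eta>"
    unfolding avg_site_variance[OF fin(1) xS(1)] using avg_nonneg[OF fin(1)] by simp
  \<comment> \<open>Cauchy-Schwarz against the indicator \<open>B\<close>, whose second moment is
    \<open>p ^ l\<close>, produces the small factor that is absorbed later.\<close>
  also have "\<dots> \<le> avg p S (\<lambda>\<eta>. p ^ l * avg p W (\<lambda>\<eta>. (g \<eta>)\<^sup>2) \<eta>) \<eta>"
  proof (rule avg_mono[OF fin(1)])
    fix \<eta>
    have "(\<lambda>\<eta>. (B \<eta>)\<^sup>2) = (\<lambda>\<eta>. of_bool (\<forall>y\<in>W. \<eta> y))"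
      by (auto simp: B_def)
    then have "avg p W (\<lambda>\<eta>. (B \<eta>)\<^sup>2) \<eta> = p ^ l"
      using avg_all_True[OF fin(2), of \<eta>] by (simp add: W_def)
    then show "(h \<eta>)\<^sup>2 \<le> p ^ l * avg p W (\<lambda>\<eta>. (g \<eta>)\<^sup>2) \<eta>"
      using avg_Cauchy_Schwarz[OF fin(2), of B g \<eta>] by (simp add: h_def)
  qed
  also have "\<dots> = p ^ l * (b (Suc i + l) - b (Suc i))"
    unfolding avg_cmult[OF fin(1)] avg_absorb[OF fin(1) xS(3)] g_def f_def b_def S_def[symmetric]
    by (subst avg_square_increment[OF fin(1)]) (auto simp: S_def)
  finally show ?thesis
    by (simp add: B_def d_def W_def)
qed

text \<open>Plain Jensen, without any constraint. It serves the sites so close to the right end that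
  a window of length \<open>l\<close> does not fit into the interval.\<close>

lemma avg_increment_le:
  fixes a :: int and i n :: nat and u :: "config \<Rightarrow> real" and \<eta> :: config
  defines "x \<equiv> a + int i" and "S \<equiv> {a..<a + int n}"
    and "b \<equiv> \<lambda>j. avg p {a..<a + int n} (\<lambda>\<eta>. (avg p {a + int j..<a + int n} u \<eta>)\<^sup>2) \<eta>"
  assumes i: "i < n"
  shows "b (Suc i) - b i \<le> avg p S (\<lambda>\<eta>. (u \<eta> - site_average p x u \<eta>)\<^sup>2) \<eta>"
proof -
  define R where "R = {x + 1..<a + int n}"
  have fin: "finite S" "finite R" and sub: "R \<subseteq> S"
    using i by (auto simp: S_def R_def x_def)
  have ivl: "{a + int i..<a + int n} = R \<union> {x}" "{a + int (Suc i)..<a + int n} = R"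
    using i by (auto simp: R_def x_def)
  have "b (Suc i) - b i = avg p S (\<lambda>\<eta>. (avg p R u \<eta> - avg p (R \<union> {x}) u \<eta>)\<^sup>2) \<eta>"
    unfolding b_def ivl S_def[symmetric]
    by (subst avg_square_increment[OF fin(1)]) (use i in \<open>auto simp: S_def R_def x_def\<close>)
  also have "\<dots> = avg p S (\<lambda>\<eta>. (avg p R (\<lambda>\<eta>. u \<eta> - site_average p x u \<eta>) \<eta>)\<^sup>2) \<eta>"
  proof -
    have "avg p (R \<union> {x}) u = avg p R (site_average p x u)"
      using avg_Un[OF fin(2), of "{x}" u] by (simp add: avg_singleton)
    then show ?thesis
      by (simp only: avg_diff[OF fin(2)])
  qed
  also have "\<dots> \<le> avg p S (\<lambda>\<eta>. avg p R (\<lambda>\<eta>. (u \<eta> - site_average p x u \<eta>)\<^sup>2) \<eta>) \<eta>"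
    by (intro avg_mono fin avg_Jensen)
  finally show ?thesis
    by (simp add: avg_absorb[OF fin(1) sub])
qed

text \<open>These are the summands of the Dirichlet form of the East dynamics on
  \<open>{a..<a + int n}\<close> with frozen exterior. The last one reads its constraint at
  \<open>a + int n\<close>, so a zero there acts as boundary condition and removes the
  constraint.\<close>

definition dirichlet_term :: "int \<Rightarrow> nat \<Rightarrow> (config \<Rightarrow> real) \<Rightarrow> config \<Rightarrow> nat \<Rightarrow> real" where
  "dirichlet_term a n u \<eta> i = avg p {a..<a + int n}
     (\<lambda>\<eta>. (1 - of_bool (\<eta> (a + int i + 1))) * (u \<eta> - site_average p (a + int i) u \<eta>)\<^sup>2) \<eta>"

lemma dirichlet_term_nonneg: "0 \<le> dirichlet_term a n u \<eta> i"
  unfolding dirichlet_term_def by (rule avg_nonneg) auto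

lemma avg_increment_boundary:
  fixes a :: int and n :: nat and u :: "config \<Rightarrow> real" and \<eta> :: config
  defines "b \<equiv> \<lambda>j. avg p {a..<a + int n} (\<lambda>\<eta>. (avg p {a + int j..<a + int n} u \<eta>)\<^sup>2) \<eta>"
  assumes i: "Suc i = n" and z: "\<not> \<eta> (a + int n)"
  shows "b (Suc i) - b i \<le> dirichlet_term a n u \<eta> i"
proof -
  have "b (Suc i) - b i \<le> avg p {a..<a + int n} (\<lambda>\<eta>. (u \<eta> - site_average p (a + int i) u \<eta>)\<^sup>2) \<eta>"
    unfolding b_def by (rule avg_increment_le) (use i in auto)
  also have "\<dots> = dirichlet_term a n u \<eta> i"
    unfolding dirichlet_term_def
  proof (rule avg_cong)
    fix \<eta>' assume "\<And>x. x \<notin> {a..<a + int n} \<Longrightarrow> \<eta>' x = \<eta> x"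
    from this[of "a + int n"] have "\<not> \<eta>' (a + int i + 1)"
      using z i by (auto simp: algebra_simps)
    then show "(u \<eta>' - site_average p (a + int i) u \<eta>')\<^sup>2
        = (1 - of_bool (\<eta>' (a + int i + 1))) * (u \<eta>' - site_average p (a + int i) u \<eta>')\<^sup>2"
      by simp
  qed simp
  finally show ?thesis .
qed

text \<open>Using the constraint at the neighbouring site only gives a Poincare inequality whose constant
  grows exponentially with the length of the interval. It is needed only at one fixed scale.\<close>

lemma variance_bound_finite_scale:
  assumes z: "\<not> \<eta> (a + int n)"
  shows "avg p {a..<a + int n} (\<lambda>\<eta>. (u \<eta>)\<^sup>2) \<eta> - (avg p {a..<a + int n} u \<eta>)\<^sup>2
    \<le> real n * (4 / (1 - p)\<^sup>2) ^ n * (\<Sum>i<n. dirichlet_term a n u \<eta> i)"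
proof -
  define K where "K = 4 / (1 - p)\<^sup>2"
  define b where "b = (\<lambda>j. avg p {a..<a + int n} (\<lambda>\<eta>. (avg p {a + int j..<a + int n} u \<eta>)\<^sup>2) \<eta>)"
  define T where "T = (\<Sum>i<n. dirichlet_term a n u \<eta> i)"
  have q: "0 < (1 - p)\<^sup>2" "(1 - p)\<^sup>2 \<le> 1"
    using p0 p_less_1 by (auto simp: power_le_one)
  have K: "4 \<le> K"
    using q by (simp add: K_def field_simps)
  have T0: "0 \<le> T" and Dle: "i < n \<Longrightarrow> dirichlet_term a n u \<eta> i \<le> T" for i
    unfolding T_def by (auto intro: sum_nonneg dirichlet_term_nonneg member_le_sum)
  \<comment> \<open>Induction from the right end, \<open>j\<close> being the number of sites to the
    right of \<open>i\<close> in the block; the boundary zero starts it.\<close>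
  have claim: "b (Suc i) - b i \<le> K ^ Suc j * T" if "Suc i + j = n" for i j
    using that
  proof (induction j arbitrary: i)
    case 0
    have "b (Suc i) - b i \<le> dirichlet_term a n u \<eta> i"
      unfolding b_def by (rule avg_increment_boundary) (use 0 z in auto)
    also have "\<dots> \<le> T"
      using 0 by (intro Dle) simp
    also have "\<dots> \<le> K * T"
      using K T0 mult_right_mono[of 1 K T] by simp
    finally show ?case
      by simp
  next
    case (Suc j)
    have IH: "b (Suc (Suc i)) - b (Suc i) \<le> K ^ Suc j * T"
      using Suc.prems by (intro Suc.IH) simp
    \<comment> \<open>A window of length 1 gives the original constraint. The next increment enters
      with a factor that need not be small, whence the loss of \<open>K\<close> at every
      site.\<close>
    have "(1 - p ^ 1)\<^sup>2 * (b (Suc i) - b i)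
      \<le> 2 * avg p {a..<a + int n} (\<lambda>\<eta>. (1 - of_bool (\<forall>y\<in>{a + int i + 1..a + int i + int 1}. \<eta> y))
          * (u \<eta> - site_average p (a + int i) u \<eta>)\<^sup>2) \<eta>
        + 2 * p ^ 1 * (b (Suc i + 1) - b (Suc i))"
      unfolding b_def by (rule avg_increment_bound) (use Suc.prems in simp)
    also have "\<dots> = 2 * dirichlet_term a n u \<eta> i + 2 * p * (b (Suc (Suc i)) - b (Suc i))"
      by (simp add: dirichlet_term_def)
    also have "\<dots> \<le> 2 * T + 2 * (K ^ Suc j * T)"
    proof (intro add_mono)
      show "2 * dirichlet_term a n u \<eta> i \<le> 2 * T"
        using Dle[of i] Suc.prems by simp
      have "p * (b (Suc (Suc i)) - b (Suc i)) \<le> p * (K ^ Suc j * T)"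
        by (rule mult_left_mono[OF IH p0])
      also have "\<dots> \<le> 1 * (K ^ Suc j * T)"
        using p1 K T0 by (intro mult_right_mono) auto
      finally show "2 * p * (b (Suc (Suc i)) - b (Suc i)) \<le> 2 * (K ^ Suc j * T)"
        by simp
    qed
    also have "\<dots> \<le> 4 * (K ^ Suc j * T)"
      using mult_right_mono[OF one_le_power[of K "Suc j"] T0] K by (simp add: mult_ac)
    finally have "b (Suc i) - b i \<le> 4 * (K ^ Suc j * T) / (1 - p)\<^sup>2"
      using q by (simp add: pos_le_divide_eq mult.commute)
    then show ?case
      by (simp add: K_def)
  qed
  have "b n - b 0 = (\<Sum>i<n. b (Suc i) - b i)"
    by (simp add: sum_lessThan_telescope)
  also have "\<dots> \<le> (\<Sum>i<n. K ^ n * T)"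
  proof (rule sum_mono)
    fix i assume "i \<in> {..<n}"
    then have "b (Suc i) - b i \<le> K ^ Suc (n - Suc i) * T"
      by (intro claim) auto
    also have "\<dots> \<le> K ^ n * T"
      using K T0 \<open>i \<in> _\<close> by (intro mult_right_mono power_increasing) auto
    finally show "b (Suc i) - b i \<le> K ^ n * T" .
  qed
  finally show ?thesis
    \<comment> \<open>\<open>b n\<close> averages over no site and is the second moment;
      \<open>b 0\<close> averages over the whole block and is the squared mean.\<close>
    by (simp add: b_def T_def K_def avg_const avg_pull[OF _ avg_determined_Compl] power2_eq_square avg_absorb)
qed

text \<open>A zero at distance \<open>k\<close> is a boundary condition for the block of length
  \<open>k\<close> starting at the site, so the variance at the site is at most the block variance,
  to which the finite-scale inequality applies. The indicator of that zero ignores the block and can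
  be pulled out.\<close>

lemma avg_unconstrained_bound:
  assumes ik: "i + k \<le> n" and k: "0 < k"
  shows "avg p {a..<a + int n} (\<lambda>\<eta>. (1 - of_bool (\<eta> (a + int (i + k))))
      * (u \<eta> - site_average p (a + int i) u \<eta>)\<^sup>2) \<eta>
    \<le> real k * (4 / (1 - p)\<^sup>2) ^ k * (\<Sum>j<k. dirichlet_term a n u \<eta> (i + j))"
proof -
  define S where "S = {a..<a + int n}"
  define x where "x = a + int i"
  define W where "W = {x..<x + int k}"
  define C where "C = real k * (4 / (1 - p)\<^sup>2) ^ k"
  define c :: "config \<Rightarrow> real" where "c \<eta> = 1 - of_bool (\<eta> (x + int k))" for \<eta>
  have C0: "0 \<le> C"
    unfolding C_def by simp
  have fin: "finite S" "finite W" and WS: "W \<subseteq> S" and xW: "x \<in> W"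
    using ik k by (auto simp: S_def W_def x_def)
  have detc: "determined_on (- W) c"
    by (auto simp: c_def W_def determined_on_def)
  have "avg p S (\<lambda>\<eta>. c \<eta> * (u \<eta> - site_average p x u \<eta>)\<^sup>2) \<eta>
      = avg p S (\<lambda>\<eta>. c \<eta> * avg p W (\<lambda>\<eta>. (u \<eta> - site_average p x u \<eta>)\<^sup>2) \<eta>) \<eta>"
    by (subst avg_absorb[OF fin(1) WS, symmetric])
       (intro avg_cong[OF fin(1)] avg_pull[OF fin(2) detc])
  also have "\<dots> \<le> avg p S (\<lambda>\<eta>. C * (\<Sum>j<k. dirichlet_term x k u \<eta> j)) \<eta>"
  proof (rule avg_mono[OF fin(1)])
    fix \<eta>
    have sn: "0 \<le> C * (\<Sum>j<k. dirichlet_term x k u \<eta> j)"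
      by (intro mult_nonneg_nonneg C0 sum_nonneg dirichlet_term_nonneg)
    show "c \<eta> * avg p W (\<lambda>\<eta>. (u \<eta> - site_average p x u \<eta>)\<^sup>2) \<eta>
        \<le> C * (\<Sum>j<k. dirichlet_term x k u \<eta> j)"
    proof (cases "\<eta> (x + int k)")
      case True
      then show ?thesis
        using sn by (simp add: c_def)
    next
      case False
      have "avg p W (\<lambda>\<eta>. (u \<eta> - site_average p x u \<eta>)\<^sup>2) \<eta>
          \<le> avg p W (\<lambda>\<eta>. (u \<eta>)\<^sup>2) \<eta> - (avg p W u \<eta>)\<^sup>2"
        by (rule avg_site_variance_le[OF fin(2) xW])
      also have "\<dots> \<le> C * (\<Sum>j<k. dirichlet_term x k u \<eta> j)"
        unfolding W_def C_def by (rule variance_bound_finite_scale) (rule False)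
      finally show ?thesis
        using False by (simp add: c_def)
    qed
  qed
  also have "\<dots> = C * (\<Sum>j<k. dirichlet_term a n u \<eta> (i + j))"
  proof -
    have "avg p S (\<lambda>\<eta>. dirichlet_term x k u \<eta> j) \<eta> = dirichlet_term a n u \<eta> (i + j)" for j
      unfolding dirichlet_term_def S_def[symmetric] W_def[symmetric] avg_absorb[OF fin(1) WS]
      by (simp add: x_def add.assoc)
    then show ?thesis
      by (simp add: avg_cmult[OF fin(1)] avg_sum[OF fin(1)])
  qed
  finally show ?thesis
    by (simp add: C_def S_def c_def x_def algebra_simps)
qed

text \<open>If the window fits, the indicator of a zero in it is at most the sum of the indicators
  over its \<open>l\<close> positions, which accounts for the second factor \<open>real l\<close>.
  If it does not fit, the boundary zero itself lies within distance \<open>l\<close>.\<close>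

lemma avg_increment_bound_window:
  fixes a :: int and i l n :: nat and u :: "config \<Rightarrow> real" and \<eta> :: config
  defines "b \<equiv> \<lambda>j. avg p {a..<a + int n} (\<lambda>\<eta>. (avg p {a + int j..<a + int n} u \<eta>)\<^sup>2) \<eta>"
  assumes i: "i < n" and z: "\<not> \<eta> (a + int n)" and l: "0 < l"
  shows "(1 - p ^ l)\<^sup>2 * (b (Suc i) - b i)
    \<le> 2 * (real l ^ 2 * (4 / (1 - p)\<^sup>2) ^ l * (\<Sum>j<l. if i + j < n then dirichlet_term a n u \<eta> (i + j) else 0))
      + (if Suc i + l \<le> n then 2 * p ^ l * (b (Suc i + l) - b (Suc i)) else 0)"
proof -
  define K where "K = 4 / (1 - p)\<^sup>2"
  define V where "V = (\<Sum>j<l. if i + j < n then dirichlet_term a n u \<eta> (i + j) else 0)"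
  define d where "d \<eta> = (u \<eta> - site_average p (a + int i) u \<eta>)\<^sup>2" for \<eta>
  define G where "G k = avg p {a..<a + int n} (\<lambda>\<eta>. (1 - of_bool (\<eta> (a + int (i + k)))) * d \<eta>) \<eta>" for k
  have q: "0 < (1 - p)\<^sup>2" "(1 - p)\<^sup>2 \<le> 1"
    using p0 p_less_1 by (auto simp: power_le_one)
  have K: "1 \<le> K"
    using q by (simp add: K_def field_simps)
  have V0: "0 \<le> V"
    unfolding V_def by (intro sum_nonneg) (simp add: dirichlet_term_nonneg)
  have d0: "0 \<le> d \<eta>" for \<eta>
    by (simp add: d_def)
  have G: "G k \<le> real l * K ^ l * V" if k: "0 < k" "k \<le> l" "i + k \<le> n" for k
  proof -
    have "G k \<le> real k * K ^ k * (\<Sum>j<k. dirichlet_term a n u \<eta> (i + j))"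
      unfolding G_def d_def K_def by (rule avg_unconstrained_bound) (use k in auto)
    also have "(\<Sum>j<k. dirichlet_term a n u \<eta> (i + j)) = (\<Sum>j<k. if i + j < n then dirichlet_term a n u \<eta> (i + j) else 0)"
      using k by (intro sum.cong) auto
    also have "real k * K ^ k * \<dots> \<le> real l * K ^ l * V"
      unfolding V_def using k K
      by (intro mult_mono power_increasing sum_mono2 sum_nonneg mult_nonneg_nonneg)
         (auto simp: dirichlet_term_nonneg)
    finally show ?thesis .
  qed
  show ?thesis
  proof (cases "Suc i + l \<le> n")
    case True
    have "avg p {a..<a + int n} (\<lambda>\<eta>. (1 - of_bool (\<forall>y\<in>{a + int i + 1..a + int i + int l}. \<eta> y)) * d \<eta>) \<eta>
        \<le> avg p {a..<a + int n} (\<lambda>\<eta>. \<Sum>k\<in>{1..l}. (1 - of_bool (\<eta> (a + int (i + k)))) * d \<eta>) \<eta>"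
    proof (rule avg_mono)
      fix \<eta>
      show "(1 - of_bool (\<forall>y\<in>{a + int i + 1..a + int i + int l}. \<eta> y)) * d \<eta>
        \<le> (\<Sum>k\<in>{1..l}. (1 - of_bool (\<eta> (a + int (i + k)))) * d \<eta>)"
      proof (cases "\<forall>y\<in>{a + int i + 1..a + int i + int l}. \<eta> y")
        case False
        then obtain y where y: "y \<in> {a + int i + 1..a + int i + int l}" "\<not> \<eta> y"
          by blast
        define k where "k = nat (y - (a + int i))"
        have k: "k \<in> {1..l}" "\<not> \<eta> (a + int (i + k))"
          using y by (auto simp: k_def)
        have "d \<eta> = (1 - of_bool (\<eta> (a + int (i + k)))) * d \<eta>"
          using k by simp
        also have "\<dots> \<le> (\<Sum>k\<in>{1..l}. (1 - of_bool (\<eta> (a + int (i + k)))) * d \<eta>)"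
          by (rule member_le_sum[where f = "\<lambda>k. (1 - of_bool (\<eta> (a + int (i + k)))) * d \<eta>"])
             (use k d0 in auto)
        finally show ?thesis
          using False by simp
      qed (auto intro!: sum_nonneg mult_nonneg_nonneg d0)
    qed simp
    also have "\<dots> = (\<Sum>k\<in>{1..l}. G k)"
      by (simp add: avg_sum G_def)
    also have "\<dots> \<le> (\<Sum>k\<in>{1..l}. real l * K ^ l * V)"
      by (rule sum_mono) (use True in \<open>auto intro!: G\<close>)
    also have "\<dots> = real l ^ 2 * K ^ l * V"
      by (simp add: power2_eq_square)
    finally have "avg p {a..<a + int n} (\<lambda>\<eta>. (1 - of_bool (\<forall>y\<in>{a + int i + 1..a + int i + int l}. \<eta> y)) * d \<eta>) \<eta>
        \<le> real l ^ 2 * K ^ l * V" .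
    moreover have "(1 - p ^ l)\<^sup>2 * (b (Suc i) - b i)
      \<le> 2 * avg p {a..<a + int n} (\<lambda>\<eta>. (1 - of_bool (\<forall>y\<in>{a + int i + 1..a + int i + int l}. \<eta> y)) * d \<eta>) \<eta>
        + 2 * p ^ l * (b (Suc i + l) - b (Suc i))"
      unfolding b_def d_def by (rule avg_increment_bound[OF True])
    ultimately show ?thesis
      using True unfolding V_def[symmetric] K_def[symmetric] by simp
  next
    case False
    have "(1 - p ^ l)\<^sup>2 \<le> 1"
      using p0 p1 power_le_one[OF p0 p1, of l] by (intro power_le_one) auto
    moreover have le: "b (Suc i) - b i \<le> avg p {a..<a + int n} d \<eta>"
      unfolding b_def d_def by (rule avg_increment_le[OF i])
    moreover have "0 \<le> avg p {a..<a + int n} d \<eta>"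
      by (rule avg_nonneg) (simp_all add: d0)
    ultimately have "(1 - p ^ l)\<^sup>2 * (b (Suc i) - b i) \<le> avg p {a..<a + int n} d \<eta>"
    proof (cases "0 \<le> b (Suc i) - b i")
      case True
      then have "(1 - p ^ l)\<^sup>2 * (b (Suc i) - b i) \<le> b (Suc i) - b i"
        by (intro mult_left_le_one_le \<open>(1 - p ^ l)\<^sup>2 \<le> 1\<close>) auto
      with le show ?thesis
        by linarith
    next
      case False
      then have "(1 - p ^ l)\<^sup>2 * (b (Suc i) - b i) \<le> 0"
        by (intro mult_nonneg_nonpos) auto
      with \<open>0 \<le> avg p _ _ _\<close> show ?thesis
        by linarith
    qed
    \<comment> \<open>The zero at \<open>a + int n\<close> is at distance
      \<open>n - i \<le> l\<close>, so inserting its indicator changes nothing.\<close>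
    also have "avg p {a..<a + int n} d \<eta> = G (n - i)"
      unfolding G_def
    proof (rule avg_cong)
      fix \<eta>' assume "\<And>x. x \<notin> {a..<a + int n} \<Longrightarrow> \<eta>' x = \<eta> x"
      from this[of "a + int n"] have "\<not> \<eta>' (a + int (i + (n - i)))"
        using z i by auto
      then show "d \<eta>' = (1 - of_bool (\<eta>' (a + int (i + (n - i))))) * d \<eta>'"
        by simp
    qed simp
    also have "\<dots> \<le> real l * K ^ l * V"
      by (rule G) (use False i in auto)
    also have "\<dots> \<le> 2 * (real l ^ 2 * K ^ l * V)"
      using K V0 l mult_right_mono[of "real l" "2 * real l ^ 2" "K ^ l * V"]
      by (simp add: power2_eq_square mult.assoc)
    finally show ?thesis
      using False unfolding V_def[symmetric] K_def[symmetric] by simp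
  qed
qed

text \<open>\<open>1 / C\<close> is a lower bound for the spectral gap of every finite interval with
  a zero on its right; the independence of \<open>C\<close> from the length \<open>n\<close> is what
  matters.\<close>

definition poincare_constant :: "real \<Rightarrow> bool" where
  "poincare_constant C \<longleftrightarrow> 0 < C \<and> (\<forall>a n u \<eta>. \<not> \<eta> (a + int n) \<longrightarrow>
     avg p {a..<a + int n} (\<lambda>\<eta>. (u \<eta>)\<^sup>2) \<eta> - (avg p {a..<a + int n} u \<eta>)\<^sup>2
       \<le> C * (\<Sum>i<n. dirichlet_term a n u \<eta> i))"

lemma poincare_constantD:
  assumes "poincare_constant C" "\<not> \<eta> (a + int n)"
  shows "avg p {a..<a + int n} (\<lambda>\<eta>. (u \<eta>)\<^sup>2) \<eta> - (avg p {a..<a + int n} u \<eta>)\<^sup>2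
       \<le> C * (\<Sum>i<n. dirichlet_term a n u \<eta> i)"
  using assms unfolding poincare_constant_def by blast

text \<open>Weakening the constraint to the presence of a zero in a long window makes the error term
  absorbable, because a window of length \<open>l\<close> is fully occupied only with probability \<open>p ^ l\<close>;
  the weakened constraint is then traded for the original one at the fixed scale \<open>l\<close>.\<close>

lemma poincare_inequality: "\<exists>C. poincare_constant C"
proof -
  have "(\<lambda>l. real l * p ^ l) \<longlonglongrightarrow> 0"
    using powser_times_n_limit_0[of p] p0 p_less_1 by simp
  then have "\<forall>\<^sub>F l in sequentially. real l * p ^ l < 1 / 16"
    by (rule order_tendstoD) simp
  then have "\<forall>\<^sub>F l in sequentially. 2 \<le> l \<and> real l * p ^ l < 1 / 16"
    using eventually_ge_at_top[of 2] by eventually_elim auto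
  then obtain l where l: "2 \<le> l" "real l * p ^ l < 1 / 16"
    using eventually_happens by fastforce
  have "2 * p ^ l \<le> real l * p ^ l"
    using l p0 by (intro mult_right_mono) auto
  with l have small: "p ^ l \<le> 1 / 8"
    by simp
  have "(7 / 8)\<^sup>2 \<le> (1 - p ^ l)\<^sup>2"
    using small by (intro power_mono) auto
  \<comment> \<open>The overlap count turns the error into \<open>2 * p ^ l * real l\<close> times
    the variance. This inequality leaves at least half of the variance on the left after
    absorption.\<close>
  then have coef: "1 / 2 + 2 * p ^ l * real l \<le> (1 - p ^ l)\<^sup>2"
    using l by (simp add: power2_eq_square mult.commute)
  define M where "M = real l ^ 2 * (4 / (1 - p)\<^sup>2) ^ l"
  have M: "0 < M"
    using l p_less_1 by (simp add: M_def)
  show ?thesis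
    unfolding poincare_constant_def
  proof (intro exI[of _ "4 * M * real l"] conjI allI impI)
    show "0 < 4 * M * real l"
      using M l by simp
    fix a n u \<eta>
    assume z: "\<not> \<eta> (a + int n)"
    define b where "b = (\<lambda>j. avg p {a..<a + int n} (\<lambda>\<eta>. (avg p {a + int j..<a + int n} u \<eta>)\<^sup>2) \<eta>)"
    define D where "D = dirichlet_term a n u \<eta>"
    define T where "T = (\<Sum>i<n. D i)"
    have \<beta>0: "0 \<le> b (Suc m) - b m" for m
    proof -
      have "0 \<le> avg p {a..<a + int n} (\<lambda>\<eta>. (avg p {a + int (Suc m)..<a + int n} u \<eta> - avg p {a + int m..<a + int n} u \<eta>)\<^sup>2) \<eta>"
        by (rule avg_nonneg) simp_all
      also have "\<dots> = b (Suc m) - b m"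
        unfolding b_def by (rule avg_square_increment) auto
      finally show ?thesis .
    qed
    have tele: "(\<Sum>i<n. b (Suc i) - b i) = b n - b 0"
      by (rule sum_lessThan_telescope)
    \<comment> \<open>The error at \<open>i\<close> is itself a telescoping sum of the increments in
      the window. Both sums over windows, with shifts 0 and 1, are then counted by
      \<open>sum_shifted_le\<close>.\<close>
    have "(1 - p ^ l)\<^sup>2 * (b n - b 0) = (\<Sum>i<n. (1 - p ^ l)\<^sup>2 * (b (Suc i) - b i))"
      unfolding tele[symmetric] by (simp add: sum_distrib_left)
    also have "\<dots> \<le> (\<Sum>i<n. 2 * M * (\<Sum>j<l. if i + 0 + j < n then D (i + 0 + j) else 0)
        + 2 * p ^ l * (\<Sum>j<l. if i + 1 + j < n then b (Suc (i + 1 + j)) - b (i + 1 + j) else 0))"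
    proof (rule sum_mono)
      fix i assume "i \<in> {..<n}"
      then have "(1 - p ^ l)\<^sup>2 * (b (Suc i) - b i)
        \<le> 2 * (M * (\<Sum>j<l. if i + j < n then D (i + j) else 0))
          + (if Suc i + l \<le> n then 2 * p ^ l * (b (Suc i + l) - b (Suc i)) else 0)"
        unfolding b_def M_def D_def by (intro avg_increment_bound_window z) (use l in auto)
      also have "(if Suc i + l \<le> n then 2 * p ^ l * (b (Suc i + l) - b (Suc i)) else 0)
        \<le> 2 * p ^ l * (\<Sum>j<l. if i + 1 + j < n then b (Suc (i + 1 + j)) - b (i + 1 + j) else 0)"
      proof (cases "Suc i + l \<le> n")
        case True
        have "b (Suc i + l) - b (Suc i) = (\<Sum>j<l. b (Suc (i + 1 + j)) - b (i + 1 + j))"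
          using sum_lessThan_telescope[of "\<lambda>j. b (Suc i + j)" l] by simp
        also have "\<dots> = (\<Sum>j<l. if i + 1 + j < n then b (Suc (i + 1 + j)) - b (i + 1 + j) else 0)"
          using True by (intro sum.cong) auto
        finally show ?thesis
          using True by simp
      next
        case False
        have "0 \<le> 2 * p ^ l * (\<Sum>j<l. if i + 1 + j < n then b (Suc (i + 1 + j)) - b (i + 1 + j) else 0)"
          using p0 \<beta>0 by (intro mult_nonneg_nonneg sum_nonneg) auto
        then show ?thesis
          using False by simp
      qed
      finally show "(1 - p ^ l)\<^sup>2 * (b (Suc i) - b i)
        \<le> 2 * M * (\<Sum>j<l. if i + 0 + j < n then D (i + 0 + j) else 0)
        + 2 * p ^ l * (\<Sum>j<l. if i + 1 + j < n then b (Suc (i + 1 + j)) - b (i + 1 + j) else 0)"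
        by (simp only: add_0_right mult.assoc)
    qed
    also have "\<dots> = 2 * M * (\<Sum>i<n. \<Sum>j<l. if i + 0 + j < n then D (i + 0 + j) else 0)
      + 2 * p ^ l * (\<Sum>i<n. \<Sum>j<l. if i + 1 + j < n then b (Suc (i + 1 + j)) - b (i + 1 + j) else 0)"
      by (simp only: sum.distrib sum_distrib_left)
    also have "\<dots> \<le> 2 * M * (real l * T) + 2 * p ^ l * (real l * (b n - b 0))"
      unfolding T_def tele[symmetric]
      by (intro add_mono mult_left_mono sum_shifted_le)
         (use M p0 \<beta>0 in \<open>auto simp: D_def dirichlet_term_nonneg\<close>)
    finally have 1: "(1 - p ^ l)\<^sup>2 * (b n - b 0) \<le> 2 * M * real l * T + 2 * p ^ l * real l * (b n - b 0)"
      by (simp add: mult.assoc)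
    have "0 \<le> b n - b 0"
      unfolding tele[symmetric] by (rule sum_nonneg) (rule \<beta>0)
    from mult_right_mono[OF coef this] 1 have "1 / 2 * (b n - b 0) \<le> 2 * M * real l * T"
      by (simp only: distrib_right)
    then have "b n - b 0 \<le> 4 * M * real l * T"
      by simp
    then show "avg p {a..<a + int n} (\<lambda>\<eta>. (u \<eta>)\<^sup>2) \<eta> - (avg p {a..<a + int n} u \<eta>)\<^sup>2
        \<le> 4 * M * real l * (\<Sum>i<n. dirichlet_term a n u \<eta> i)"
      by (simp add: b_def T_def D_def avg_const avg_pull[OF _ avg_determined_Compl] power2_eq_square avg_absorb)
  qed
qed

section \<open>The generator on functions of finitely many spins\<close>

definition east_term :: "int \<Rightarrow> (config \<Rightarrow> real) \<Rightarrow> config \<Rightarrow> real" where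
  "east_term x u \<eta> = (1 - of_bool (\<eta> (x + 1))) * (site_average p x u \<eta> - u \<eta>)"

lemma east_generator_sum:
  assumes "finite A" "determined_on A u"
  shows "east_generator p u = (\<lambda>\<eta>. \<Sum>x\<in>A. east_term x u \<eta>)"
  using assms(2) unfolding east_term_def determined_on_def
  by (intro ext east_generator_eq_sum[OF assms(1)]) blast

lemma determined_on_site_average:
  assumes "determined_on A u"
  shows "determined_on A (site_average p x u)"
  using avg_determined[of "{x}" A u] assms
  by (auto simp: avg_singleton intro: determined_on_mono)

text \<open>Constraints look one site to the right, so the support grows only there. The left
  endpoint stays fixed, which allows one and the same \<open>a\<close> throughout the
  evolution.\<close>

lemma determined_on_east_generator:
  assumes "determined_on {a..<a + int w} u"
  shows "determined_on {a..<a + int (Suc w)} (east_generator p u)"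
proof -
  have "determined_on {a..<a + int (Suc w)} u"
    by (rule determined_on_mono[OF assms]) auto
  moreover have "determined_on {a..<a + int (Suc w)} (\<lambda>\<eta>. 1 - of_bool (\<eta> (x + 1)))"
    if "x \<in> {a..<a + int w}" for x
    using that by (auto simp: determined_on_def)
  ultimately show ?thesis
    unfolding east_generator_sum[OF finite_atLeastLessThan_int assms] east_term_def
    by (intro determined_on_sum determined_on_map2[where F = "\<lambda>x y. x * y" and u = "\<lambda>\<eta>. 1 - of_bool (\<eta> (_ + 1))"]
        determined_on_map2[where F = "(-)" and v = u] determined_on_site_average)
qed

lemma site_average_bound:
  assumes "\<And>\<eta>. \<bar>u \<eta>\<bar> \<le> B"
  shows "\<bar>site_average p x u \<eta>\<bar> \<le> B"
proof -
  have "\<bar>site_average p x u \<eta>\<bar> \<le> p * \<bar>u (\<eta>(x := True))\<bar> + (1 - p) * \<bar>u (\<eta>(x := False))\<bar>"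
    unfolding site_avg using p0 p1 by (intro order_trans[OF abs_triangle_ineq]) (simp add: abs_mult)
  also have "\<dots> \<le> p * B + (1 - p) * B"
    using p0 p1 assms by (intro add_mono mult_left_mono) auto
  finally show ?thesis
    by (simp add: algebra_simps)
qed

lemma east_generator_bound:
  assumes "determined_on {a..<a + int w} u" "\<And>\<eta>. \<bar>u \<eta>\<bar> \<le> B"
  shows "\<bar>east_generator p u \<eta>\<bar> \<le> 2 * real w * B"
proof -
  have "\<bar>east_term x u \<eta>\<bar> \<le> 2 * B" for x
  proof -
    have "\<bar>site_average p x u \<eta> - u \<eta>\<bar> \<le> 2 * B"
      using site_average_bound[of u B x \<eta>, OF assms(2)] assms(2)[of \<eta>] by linarith
    then show ?thesis
      by (auto simp: east_term_def)
  qed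
  then have "\<bar>\<Sum>x\<in>{a..<a + int w}. east_term x u \<eta>\<bar> \<le> (\<Sum>x\<in>{a..<a + int w}. 2 * B)"
    by (intro order_trans[OF sum_abs] sum_mono)
  then show ?thesis
    unfolding east_generator_sum[OF finite_atLeastLessThan_int assms(1)] by simp
qed

lemma east_term_linear:
  "east_term x (\<lambda>\<eta>. \<Sum>i\<in>I. c i * u i \<eta>) \<eta> = (\<Sum>i\<in>I. c i * east_term x (u i) \<eta>)"
  by (simp add: east_term_def site_avg sum_distrib_left sum.distrib[symmetric] sum_subtractf[symmetric]
      algebra_simps)

lemma east_generator_linear:
  assumes "finite A" "\<And>i. i \<in> I \<Longrightarrow> determined_on A (u i)"
  shows "east_generator p (\<lambda>\<eta>. \<Sum>i\<in>I. c i * u i \<eta>) \<eta> = (\<Sum>i\<in>I. c i * east_generator p (u i) \<eta>)"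
proof -
  have "determined_on A (\<lambda>\<eta>. \<Sum>i\<in>I. c i * u i \<eta>)"
    using assms(2) by (intro determined_on_sum determined_on_map2[where F = "\<lambda>x y. x * y"] determined_on_const)
  then have "east_generator p (\<lambda>\<eta>. \<Sum>i\<in>I. c i * u i \<eta>) \<eta>
      = (\<Sum>x\<in>A. \<Sum>i\<in>I. c i * east_term x (u i) \<eta>)"
    by (simp add: east_generator_sum[OF assms(1)] east_term_linear)
  also have "\<dots> = (\<Sum>i\<in>I. c i * (\<Sum>x\<in>A. east_term x (u i) \<eta>))"
    by (subst sum.swap) (simp add: sum_distrib_left)
  also have "\<dots> = (\<Sum>i\<in>I. c i * east_generator p (u i) \<eta>)"
    by (rule sum.cong) (simp_all add: east_generator_sum[OF assms(1) assms(2)])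
  finally show ?thesis .
qed

subsection \<open>The distinguished zero\<close>

text \<open>The quantification over all \<open>n \<ge> w\<close> and all exteriors makes the
  property stable under the generator, since the distinguished zero may move to the right.
  \<open>w\<close> is the initial width and does not follow the growing support.\<close>

definition zero_mean :: "int \<Rightarrow> nat \<Rightarrow> (config \<Rightarrow> real) \<Rightarrow> bool" where
  "zero_mean a w u \<longleftrightarrow> (\<forall>n\<ge>w. \<forall>\<eta>. \<not> \<eta> (a + int n) \<longrightarrow> avg p {a..<a + int n} u \<eta> = 0)"

definition second_moment_le :: "int \<Rightarrow> nat \<Rightarrow> (config \<Rightarrow> real) \<Rightarrow> real \<Rightarrow> bool" where
  "second_moment_le a w u A \<longleftrightarrow>
     (\<forall>n\<ge>w. \<forall>\<eta>. \<not> \<eta> (a + int n) \<longrightarrow> avg p {a..<a + int n} (\<lambda>\<eta>. (u \<eta>)\<^sup>2) \<eta> \<le> A)"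

lemma avg_east_term_interior:
  assumes "finite S" "x \<in> S"
  shows "avg p S (east_term x u) \<eta> = 0"
proof -
  have "site_average p x (east_term x u) = (\<lambda>\<eta>. 0)"
    by (rule ext) (simp add: site_avg east_term_def algebra_simps)
  then show ?thesis
    using avg_absorb_site[OF assms, of "east_term x u"] avg_const[OF assms(1), of 0] by metis
qed

text \<open>Reversibility at \<open>x\<close>: the constraint does not depend on the spin at
  \<open>x\<close>, and both integrands have the same average over that spin.\<close>

lemma avg_mult_east_term_interior:
  assumes "finite S" "x \<in> S"
  shows "avg p S (\<lambda>\<eta>. u \<eta> * east_term x u \<eta>) \<eta>
    = - avg p S (\<lambda>\<eta>. (1 - of_bool (\<eta> (x + 1))) * (u \<eta> - site_average p x u \<eta>)\<^sup>2) \<eta>"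
proof -
  let ?v = "\<lambda>\<eta>. (-1) * ((1 - of_bool (\<eta> (x + 1))) * (u \<eta> - site_average p x u \<eta>)\<^sup>2)"
  have "avg p S (\<lambda>\<eta>. u \<eta> * east_term x u \<eta>) = avg p S (site_average p x (\<lambda>\<eta>. u \<eta> * east_term x u \<eta>))"
    by (rule avg_absorb_site[OF assms, symmetric])
  also have "site_average p x (\<lambda>\<eta>. u \<eta> * east_term x u \<eta>) = site_average p x ?v"
    by (rule ext) (simp add: site_avg east_term_def power2_eq_square algebra_simps)
  also have "avg p S (site_average p x ?v) = avg p S ?v"
    by (rule avg_absorb_site[OF assms])
  finally have "avg p S (\<lambda>\<eta>. u \<eta> * east_term x u \<eta>) = avg p S ?v" .
  then show ?thesis
    by (simp only: avg_cmult[OF assms(1)])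
qed

text \<open>A legal update at a site to the right of the zero at \<open>a + n\<close> leaves that zero in place, and a
  legal update at \<open>a + n\<close> itself hands its role over to \<open>a + n + 1\<close>, leaving an equilibrated spin
  behind.\<close>

lemma avg_site_average_exterior:
  assumes n: "w \<le> n" and z: "\<not> \<eta> (a + int n)" and x: "a + int n \<le> x" and c: "\<not> \<eta> (x + 1)"
  obtains n' \<eta>1 \<eta>2 where "w \<le> n'" "\<not> \<eta>1 (a + int n')" "\<not> \<eta>2 (a + int n')"
    "\<And>v. avg p {a..<a + int n} (site_average p x v) \<eta>
      = p * avg p {a..<a + int n'} v \<eta>1 + (1 - p) * avg p {a..<a + int n'} v \<eta>2"
proof (cases "x = a + int n")
  case True
  have "{a..<a + int (Suc n)} = {a..<a + int n} \<union> {x}"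
    using True by auto
  then have "avg p {a..<a + int n} (site_average p x v) = avg p {a..<a + int (Suc n)} v" for v
    using avg_Un[of "{a..<a + int n}" "{x}" v] by (simp add: avg_singleton)
  then show ?thesis
    using n c True by (intro that[of "Suc n" \<eta> \<eta>]) (auto simp: algebra_simps)
next
  case False
  have "avg p {a..<a + int n} (site_average p x v) = site_average p x (avg p {a..<a + int n} v)" for v
    using avg_Un[of "{a..<a + int n}" "{x}" v] avg_Un[of "{x}" "{a..<a + int n}" v]
    by (simp add: avg_singleton Un_commute)
  then show ?thesis
    using n z False by (intro that[of n "\<eta>(x := True)" "\<eta>(x := False)"]) (auto simp: site_avg)
qed

lemma avg_exterior_cong:
  assumes c: "\<eta> (x + 1) = b" and x: "a + int n \<le> x"
    and uv: "\<And>\<eta>. \<eta> (x + 1) = b \<Longrightarrow> u \<eta> = v \<eta>"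
  shows "avg p {a..<a + int n} u \<eta> = avg p {a..<a + int n} v \<eta>"
  using assms by (intro avg_cong) auto

lemma east_generator_interior_exterior:
  assumes "determined_on {a..<a + int W} u"
  shows "east_generator p u = (\<lambda>\<eta>. (\<Sum>x\<in>{a..<a + int n}. east_term x u \<eta>)
    + (\<Sum>x\<in>{a + int n..<a + int W}. east_term x u \<eta>))"
proof -
  have "determined_on ({a..<a + int n} \<union> {a + int n..<a + int W}) u"
    by (rule determined_on_mono[OF assms]) auto
  then show ?thesis
    by (subst east_generator_sum[of "{a..<a + int n} \<union> {a + int n..<a + int W}"])
       (auto intro!: ext sum.union_disjoint)
qed

text \<open>Interior updates preserve the equilibrium average. A legal exterior update turns the
  average into a mixture of averages that again end at a zero, and these vanish by
  assumption.\<close>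

lemma zero_mean_east_generator:
  assumes det: "determined_on {a..<a + int W} u" and u: "zero_mean a w u"
  shows "zero_mean a w (east_generator p u)"
  unfolding zero_mean_def
proof (intro allI impI)
  fix n \<eta> assume n: "w \<le> n" and z: "\<not> \<eta> (a + int n)"
  have "avg p {a..<a + int n} (east_term x u) \<eta> = 0" if x: "a + int n \<le> x" for x
  proof (cases "\<eta> (x + 1)")
    case True
    then have "avg p {a..<a + int n} (east_term x u) \<eta> = avg p {a..<a + int n} (\<lambda>_. 0) \<eta>"
      by (intro avg_exterior_cong[OF _ x]) (auto simp: east_term_def)
    then show ?thesis
      by (simp add: avg_const)
  next
    case False
    from avg_site_average_exterior[OF n z x False] obtain n' \<eta>1 \<eta>2 where *:
      "w \<le> n'" "\<not> \<eta>1 (a + int n')" "\<not> \<eta>2 (a + int n')"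
      "\<And>v. avg p {a..<a + int n} (site_average p x v) \<eta>
        = p * avg p {a..<a + int n'} v \<eta>1 + (1 - p) * avg p {a..<a + int n'} v \<eta>2"
      by blast
    have "avg p {a..<a + int n} (east_term x u) \<eta>
        = avg p {a..<a + int n} (\<lambda>\<eta>. site_average p x u \<eta> - u \<eta>) \<eta>"
      by (rule avg_exterior_cong[OF _ x, of _ False]) (use False in \<open>auto simp: east_term_def\<close>)
    also have "\<dots> = 0"
      using u n z * by (simp add: avg_diff zero_mean_def)
    finally show ?thesis .
  qed
  then show "avg p {a..<a + int n} (east_generator p u) \<eta> = 0"
    unfolding east_generator_interior_exterior[OF det, of n]
    by (simp add: avg_add avg_sum avg_east_term_interior)
qed

text \<open>For the updated value \<open>r\<close> and the old value \<open>s\<close> one has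
  \<open>2 * s * (r - s) \<le> r\<^sup>2 - s\<^sup>2\<close>. After Jensen, the updated second
  moment is a mixture of second moments to which the common bound \<open>A\<close> applies.\<close>

lemma avg_mult_east_term_exterior:
  assumes A: "second_moment_le a w u A" and n: "w \<le> n" and z: "\<not> \<eta> (a + int n)" and x: "a + int n \<le> x"
  shows "2 * avg p {a..<a + int n} (\<lambda>\<eta>. u \<eta> * east_term x u \<eta>) \<eta>
    \<le> A - avg p {a..<a + int n} (\<lambda>\<eta>. (u \<eta>)\<^sup>2) \<eta>"
proof (cases "\<eta> (x + 1)")
  case True
  then have "avg p {a..<a + int n} (\<lambda>\<eta>. u \<eta> * east_term x u \<eta>) \<eta> = avg p {a..<a + int n} (\<lambda>_. 0) \<eta>"
    by (intro avg_exterior_cong[OF _ x]) (auto simp: east_term_def)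
  then show ?thesis
    using A n z by (simp add: avg_const second_moment_le_def)
next
  case False
  from avg_site_average_exterior[OF n z x False] obtain n' \<eta>1 \<eta>2 where *:
    "w \<le> n'" "\<not> \<eta>1 (a + int n')" "\<not> \<eta>2 (a + int n')"
    "\<And>v. avg p {a..<a + int n} (site_average p x v) \<eta>
      = p * avg p {a..<a + int n'} v \<eta>1 + (1 - p) * avg p {a..<a + int n'} v \<eta>2"
    by blast
  have "2 * avg p {a..<a + int n} (\<lambda>\<eta>. u \<eta> * east_term x u \<eta>) \<eta>
      = avg p {a..<a + int n} (\<lambda>\<eta>. 2 * (u \<eta> * east_term x u \<eta>)) \<eta>"
    by (simp add: avg_cmult)
  also have "\<dots> = avg p {a..<a + int n} (\<lambda>\<eta>. 2 * (u \<eta> * (site_average p x u \<eta> - u \<eta>))) \<eta>"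
    by (rule avg_exterior_cong[OF _ x, of _ False]) (use False in \<open>auto simp: east_term_def\<close>)
  also have "\<dots> \<le> avg p {a..<a + int n} (\<lambda>\<eta>. site_average p x (\<lambda>\<eta>. (u \<eta>)\<^sup>2) \<eta> - (u \<eta>)\<^sup>2) \<eta>"
  proof (rule avg_mono)
    fix \<eta>
    have "(site_average p x u \<eta>)\<^sup>2 \<le> site_average p x (\<lambda>\<eta>. (u \<eta>)\<^sup>2) \<eta>"
      using avg_Jensen[of "{x}" u \<eta>] by (simp add: avg_singleton)
    then show "2 * (u \<eta> * (site_average p x u \<eta> - u \<eta>)) \<le> site_average p x (\<lambda>\<eta>. (u \<eta>)\<^sup>2) \<eta> - (u \<eta>)\<^sup>2"
      using sum_squares_bound[of "u \<eta>" "site_average p x u \<eta>"]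
      by (simp add: power2_eq_square algebra_simps)
  qed simp
  also have "\<dots> = p * avg p {a..<a + int n'} (\<lambda>\<eta>. (u \<eta>)\<^sup>2) \<eta>1
      + (1 - p) * avg p {a..<a + int n'} (\<lambda>\<eta>. (u \<eta>)\<^sup>2) \<eta>2 - avg p {a..<a + int n} (\<lambda>\<eta>. (u \<eta>)\<^sup>2) \<eta>"
    by (simp add: avg_diff *)
  also have "\<dots> \<le> p * A + (1 - p) * A - avg p {a..<a + int n} (\<lambda>\<eta>. (u \<eta>)\<^sup>2) \<eta>"
    using A * p0 p1 by (intro diff_right_mono add_mono mult_left_mono) (auto simp: second_moment_le_def)
  finally show ?thesis
    by (simp add: algebra_simps)
qed

text \<open>For a given zero and exterior, interior updates contract the second moment
  \<open>m\<close> at rate \<open>2 / C\<close>, while at most \<open>W\<close> exterior sites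
  contribute up to \<open>A - m\<close> each. The generator bound \<open>2 * real W * B\<close>
  controls the term quadratic in \<open>h\<close>.\<close>

lemma second_moment_euler_step:
  assumes pc: "poincare_constant C"
    and det: "determined_on {a..<a + int W} u" and B: "\<And>\<eta>. \<bar>u \<eta>\<bar> \<le> B"
    and u: "zero_mean a w u" and A: "second_moment_le a w u A"
    and h: "0 \<le> h" "h * (2 / C + real W) \<le> 1"
  shows "second_moment_le a w (\<lambda>\<eta>. u \<eta> + h * east_generator p u \<eta>)
    ((1 - 2 / C * h) * A + h\<^sup>2 * (2 * real W * B)\<^sup>2)"
  unfolding second_moment_le_def
proof (intro allI impI)
  fix n \<eta> assume n: "w \<le> n" and z: "\<not> \<eta> (a + int n)"
  have C: "0 < C"
    using pc by (simp add: poincare_constant_def)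
  define S where "S = {a..<a + int n}"
  define T where "T = {a + int n..<a + int W}"
  define m where "m = avg p S (\<lambda>\<eta>. (u \<eta>)\<^sup>2) \<eta>"
  define E where "E x = avg p S (\<lambda>\<eta>. u \<eta> * east_term x u \<eta>) \<eta>" for x
  have fin: "finite S"
    by (simp add: S_def)
  have mA: "m \<le> A"
    using A n z by (simp add: m_def S_def second_moment_le_def)
  have "m \<le> C * (\<Sum>i<n. dirichlet_term a n u \<eta> i)"
    using poincare_constantD[of C \<eta> a n u, OF pc z] u n z by (simp add: m_def S_def zero_mean_def)
  also have "(\<Sum>i<n. dirichlet_term a n u \<eta> i) = (\<Sum>i<n. - E (a + int i))"
    unfolding E_def dirichlet_term_def S_def
    by (intro sum.cong refl) (simp add: avg_mult_east_term_interior)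
  also have "\<dots> = (\<Sum>x\<in>S. - E x)"
    by (rule sum.reindex_bij_witness[of _ "\<lambda>x. nat (x - a)" "\<lambda>i. a + int i"]) (auto simp: S_def)
  finally have int: "2 * (\<Sum>x\<in>S. E x) \<le> - (2 / C) * m"
    using C by (simp add: sum_negf field_simps)
  have "2 * (\<Sum>x\<in>T. E x) \<le> (\<Sum>x\<in>T. A - m)"
    unfolding sum_distrib_left E_def S_def m_def
    by (intro sum_mono avg_mult_east_term_exterior[of a w u A n \<eta>, OF A n z]) (simp add: T_def)
  also have "\<dots> \<le> real W * (A - m)"
    using mA by (auto simp: T_def intro!: mult_right_mono)
  finally have ext: "2 * (\<Sum>x\<in>T. E x) \<le> real W * (A - m)" .
  have "avg p S (\<lambda>\<eta>. (u \<eta> + h * east_generator p u \<eta>)\<^sup>2) \<eta>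
      = avg p S (\<lambda>\<eta>. (u \<eta>)\<^sup>2 + h * (2 * (u \<eta> * east_generator p u \<eta>)) + h\<^sup>2 * (east_generator p u \<eta>)\<^sup>2) \<eta>"
    by (simp add: power2_eq_square algebra_simps)
  also have "\<dots> = m + h * (2 * avg p S (\<lambda>\<eta>. u \<eta> * east_generator p u \<eta>) \<eta>)
      + h\<^sup>2 * avg p S (\<lambda>\<eta>. (east_generator p u \<eta>)\<^sup>2) \<eta>"
    by (simp only: avg_add[OF fin] avg_cmult[OF fin] m_def)
  also have "avg p S (\<lambda>\<eta>. u \<eta> * east_generator p u \<eta>) \<eta> = (\<Sum>x\<in>S. E x) + (\<Sum>x\<in>T. E x)"
    unfolding east_generator_interior_exterior[OF det, of n] E_def T_def S_def
    by (simp add: distrib_left sum_distrib_left avg_add avg_sum)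
  also have "m + h * (2 * ((\<Sum>x\<in>S. E x) + (\<Sum>x\<in>T. E x))) + h\<^sup>2 * avg p S (\<lambda>\<eta>. (east_generator p u \<eta>)\<^sup>2) \<eta>
      \<le> m + h * (- (2 / C) * m + real W * (A - m)) + h\<^sup>2 * (2 * real W * B)\<^sup>2"
  proof (intro add_mono mult_left_mono order_refl)
    show "2 * ((\<Sum>x\<in>S. E x) + (\<Sum>x\<in>T. E x)) \<le> - (2 / C) * m + real W * (A - m)"
      using int ext by simp
    show "avg p S (\<lambda>\<eta>. (east_generator p u \<eta>)\<^sup>2) \<eta> \<le> (2 * real W * B)\<^sup>2"
      by (intro avg_le_const fin) (metis abs_le_square_iff abs_ge_zero abs_of_nonneg east_generator_bound[OF det B] order_trans)
  qed (use h in auto)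
  \<comment> \<open>The condition on \<open>h\<close> makes the coefficient of \<open>m\<close>
    nonnegative, so \<open>m\<close> may be replaced by \<open>A\<close>; then the terms with
    \<open>W\<close> cancel and only the contraction remains.\<close>
  also have "m + h * (- (2 / C) * m + real W * (A - m)) = m * (1 - h * (2 / C + real W)) + h * real W * A"
    by (simp add: algebra_simps)
  also have "\<dots> \<le> A * (1 - h * (2 / C + real W)) + h * real W * A"
    using mA h by (intro add_right_mono mult_right_mono) auto
  also have "\<dots> = (1 - 2 / C * h) * A"
    by (simp add: algebra_simps)
  finally show "avg p {a..<a + int n} (\<lambda>\<eta>. (u \<eta> + h * east_generator p u \<eta>)\<^sup>2) \<eta>
      \<le> (1 - 2 / C * h) * A + h\<^sup>2 * (2 * real W * B)\<^sup>2"
    by (simp add: S_def)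
qed

end

section \<open>Discrete Gronwall inequality and Taylor remainders\<close>

text \<open>A Gronwall inequality for a family under a common bound, without differentiability.
  Splitting \<open>T\<close> into \<open>n\<close> equal steps accumulates
  \<open>T * \<epsilon>\<close> from the error linear in the step and
  \<open>T\<^sup>2 * C / n\<close> from the quadratic one; the latter vanishes as \<open>n\<close>
  grows.\<close>

lemma euler_bound:
  fixes \<phi> :: "real \<Rightarrow> 'i \<Rightarrow> real"
  assumes init: "\<And>i. i \<in> I \<Longrightarrow> \<phi> 0 i \<le> A"
    and step: "\<And>s h A. 0 \<le> s \<Longrightarrow> 0 < h \<Longrightarrow> h \<le> \<delta> \<Longrightarrow> s + h \<le> T \<Longrightarrow> (\<And>i. i \<in> I \<Longrightarrow> \<phi> s i \<le> A)
      \<Longrightarrow> (\<And>i. i \<in> I \<Longrightarrow> \<phi> (s + h) i \<le> (1 - \<kappa> * h) * A + h * \<epsilon> + h\<^sup>2 * C)"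
    and \<delta>: "0 < \<delta>" and \<kappa>: "0 \<le> \<kappa>" and A: "0 \<le> A" and \<epsilon>: "0 \<le> \<epsilon>" and C: "0 \<le> C" and T: "0 \<le> T"
    and i: "i \<in> I"
  shows "\<phi> T i \<le> exp (- \<kappa> * T) * A + T * \<epsilon>"
proof (cases "T = 0")
  case True
  then show ?thesis
    using init[OF i] by simp
next
  case False
  with T have T: "0 < T"
    by simp
  have ev: "\<phi> T i \<le> exp (- \<kappa> * T) * A + T * \<epsilon> + T\<^sup>2 * C / real n"
    if n: "T / \<delta> \<le> real n" "\<kappa> * T \<le> real n" "0 < n" for n
  proof -
    define h where "h = T / real n"
    have h: "0 < h" "h \<le> \<delta>" "real n * h = T" "\<kappa> * h \<le> 1"
      using n T \<delta> by (simp_all add: h_def field_simps)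
    have "(\<forall>i\<in>I. \<phi> (real k * h) i \<le> (1 - \<kappa> * h) ^ k * A + real k * (h * \<epsilon> + h\<^sup>2 * C))" if "k \<le> n" for k
      using that
    proof (induction k)
      case 0
      then show ?case
        using init by simp
    next
      case (Suc k)
      define A' where "A' = (1 - \<kappa> * h) ^ k * A + real k * (h * \<epsilon> + h\<^sup>2 * C)"
      have "real (Suc k) * h \<le> real n * h"
        using h Suc.prems by (intro mult_right_mono) auto
      then have sT: "real k * h + h \<le> T"
        using h by (simp add: algebra_simps)
      have IH: "\<phi> (real k * h) i \<le> A'" if "i \<in> I" for i
        using Suc that by (auto simp: A'_def)
      have "0 \<le> real k * (h * \<epsilon> + h\<^sup>2 * C)"
        using h \<epsilon> C by simp
      then have le: "(1 - \<kappa> * h) * (real k * (h * \<epsilon> + h\<^sup>2 * C)) \<le> 1 * (real k * (h * \<epsilon> + h\<^sup>2 * C))"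
        using \<kappa> h by (intro mult_right_mono) auto
      show ?case
      proof
        fix i assume i: "i \<in> I"
        have "\<phi> (real k * h + h) i \<le> (1 - \<kappa> * h) * A' + h * \<epsilon> + h\<^sup>2 * C"
          by (rule step[OF _ h(1,2) sT IH i]) (use h in auto)
        also have "\<dots> \<le> (1 - \<kappa> * h) ^ Suc k * A + real (Suc k) * (h * \<epsilon> + h\<^sup>2 * C)"
          using le by (simp add: A'_def algebra_simps)
        finally show "\<phi> (real (Suc k) * h) i \<le> (1 - \<kappa> * h) ^ Suc k * A + real (Suc k) * (h * \<epsilon> + h\<^sup>2 * C)"
          by (simp add: algebra_simps)
      qed
    qed
    from this[of n] i have "\<phi> T i \<le> (1 - \<kappa> * h) ^ n * A + real n * (h * \<epsilon> + h\<^sup>2 * C)"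
      using h by auto
    also have "real n * (h * \<epsilon> + h\<^sup>2 * C) = T * \<epsilon> + T\<^sup>2 * C / real n"
      using n by (simp add: h_def field_simps power2_eq_square)
    also have "(1 - \<kappa> * h) ^ n \<le> exp (- \<kappa> * T)"
    proof -
      have "(1 - \<kappa> * h) ^ n \<le> exp (- (\<kappa> * h)) ^ n"
        using h exp_ge_add_one_self[of "- (\<kappa> * h)"] by (intro power_mono) auto
      also have "\<dots> = exp (- \<kappa> * T)"
        using h(3) by (simp add: exp_of_nat_mult[symmetric] mult.left_commute)
      finally show ?thesis .
    qed
    finally show ?thesis
      using A by (simp add: mult_right_mono add_ac)
  qed
  have "(\<lambda>n. exp (- \<kappa> * T) * A + T * \<epsilon> + T\<^sup>2 * C / real n) \<longlonglongrightarrow> exp (- \<kappa> * T) * A + T * \<epsilon> + 0"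
    by (intro tendsto_add tendsto_const lim_const_over_n)
  moreover have "\<forall>\<^sub>F n in sequentially. \<phi> T i \<le> exp (- \<kappa> * T) * A + T * \<epsilon> + T\<^sup>2 * C / real n"
  proof -
    obtain N :: nat where N: "max (T / \<delta>) (\<kappa> * T) \<le> real N"
      using real_arch_simple by blast
    show ?thesis
      using eventually_ge_at_top[of "max N 1"]
    proof eventually_elim
      case (elim n)
      then have "real N \<le> real n"
        by simp
      with N elim show ?case
        by (intro ev) auto
    qed
  qed
  ultimately show ?thesis
    using tendsto_lowerbound[of _ _ sequentially "\<phi> T i"] by simp
qed

text \<open>The remainder for \<open>Suc n\<close> is \<open>s + h\<close> times that for
  \<open>n\<close> plus \<open>n * h\<^sup>2 * s ^ (n - 1)\<close>. At \<open>n = 0\<close> the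
  truncated exponent is harmless because its coefficient is 0.\<close>

lemma power_increment_bound:
  fixes s h :: real
  assumes "0 \<le> s" "0 \<le> h" "s + h \<le> 1"
  shows "\<bar>(s + h) ^ n - s ^ n - real n * h * s ^ (n - 1)\<bar> \<le> (real n)\<^sup>2 * h\<^sup>2"
proof (induction n)
  case (Suc n)
  let ?e = "(s + h) ^ n - s ^ n - real n * h * s ^ (n - 1)"
  have "(s + h) ^ Suc n - s ^ Suc n - real (Suc n) * h * s ^ (Suc n - 1)
      = (s + h) * ?e + real n * h\<^sup>2 * s ^ (n - 1)"
    by (cases n) (simp_all add: algebra_simps power2_eq_square)
  also have "\<bar>\<dots>\<bar> \<le> 1 * ((real n)\<^sup>2 * h\<^sup>2) + real n * h\<^sup>2 * 1"
  proof (rule order_trans[OF abs_triangle_ineq add_mono])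
    show "\<bar>(s + h) * ?e\<bar> \<le> 1 * ((real n)\<^sup>2 * h\<^sup>2)"
      unfolding abs_mult using assms by (intro mult_mono Suc.IH) auto
    show "\<bar>real n * h\<^sup>2 * s ^ (n - 1)\<bar> \<le> real n * h\<^sup>2 * 1"
      unfolding abs_mult using assms by (intro mult_mono) (auto intro: power_le_one)
  qed
  also have "\<dots> \<le> (real (Suc n))\<^sup>2 * h\<^sup>2"
    using assms by (simp add: power2_eq_square algebra_simps)
  finally show ?case .
qed simp

lemma pochhammer_real_nonneg: "0 \<le> pochhammer (real w) n"
  by (simp add: pochhammer_prod prod_nonneg)

text \<open>The ratio of consecutive terms is \<open>(w + n) / (4 * (n + 1))\<close>, so with the
  weight \<open>n\<close> it is at most 1/2 from \<open>n = w\<close> on. The series majorizes the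
  exponential series of the generator at time 1/8.\<close>

lemma pochhammer_ratio_summable:
  "summable (\<lambda>n. real n * ((1 / 4) ^ n * pochhammer (real w) n / fact n))"
  "summable (\<lambda>n. (1 / 4) ^ n * pochhammer (real w) n / fact n)"
proof -
  let ?t = "\<lambda>n. (1 / 4) ^ n * pochhammer (real w) n / fact n :: real"
  have p: "0 \<le> ?t n" for n
    by (simp add: pochhammer_real_nonneg)
  have eq: "?t (Suc n) = ?t n * ((real w + real n) / (4 * real (Suc n)))" for n
    by (simp add: pochhammer_Suc field_simps)
  have le: "real (Suc n) * ?t (Suc n) \<le> 1 / 2 * (real n * ?t n)" if "w \<le> n" for n
  proof -
    have "real (Suc n) * ?t (Suc n) = ?t n * ((real w + real n) / 4)"
      unfolding eq by (simp add: field_simps del: of_nat_Suc)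
    also have "\<dots> \<le> ?t n * (real n / 2)"
      using that by (intro mult_left_mono p) auto
    finally show ?thesis
      by (simp add: mult_ac)
  qed
  show *: "summable (\<lambda>n. real n * ?t n)"
  proof (rule summable_ratio_test[where c = "1 / 2" and N = w])
    fix n assume "w \<le> n"
    then show "norm (real (Suc n) * ?t (Suc n)) \<le> 1 / 2 * norm (real n * ?t n)"
      unfolding real_norm_def using le[of n] p[of n] p[of "Suc n"] by (simp only: abs_mult abs_of_nonneg of_nat_0_le_iff)
  qed simp
  show "summable ?t"
  proof (rule summable_comparison_test'[OF *, of 1])
    fix n :: nat assume "1 \<le> n"
    then show "norm (?t n) \<le> real n * ?t n"
      using p[of n] mult_right_mono[of 1 "real n" "?t n"] by simp
  qed
qed

text \<open>Bounds the top term \<open>s ^ k / fact k\<close> times the iterate of order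
  \<open>k + 1\<close>, by which the polynomial of degree \<open>k\<close> fails to solve the
  evolution equation for \<open>s \<le> 1 / 8\<close>. The factor 8 and the weight
  \<open>Suc k\<close> come from raising the index to \<open>Suc k\<close>.\<close>

definition taylor_error :: "nat \<Rightarrow> real \<Rightarrow> nat \<Rightarrow> real" where
  "taylor_error W B k = 8 * (real (Suc k) * ((1 / 4) ^ Suc k * pochhammer (real W) (Suc k) / fact (Suc k))) * B"

lemma taylor_error_tendsto: "taylor_error W B \<longlonglongrightarrow> 0"
proof -
  have "(\<lambda>n. real (Suc n) * ((1 / 4) ^ Suc n * pochhammer (real W) (Suc n) / fact (Suc n))) \<longlonglongrightarrow> 0"
    by (rule LIMSEQ_Suc[OF summable_LIMSEQ_zero[OF pochhammer_ratio_summable(1)]])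
  from tendsto_mult_left_zero[OF tendsto_mult_right_zero[OF this, of 8], of B] show ?thesis
    by (simp add: taylor_error_def[abs_def])
qed

lemma taylor_error_nonneg: "0 \<le> B \<Longrightarrow> 0 \<le> taylor_error W B k"
  by (simp add: taylor_error_def pochhammer_real_nonneg)

context spin_density
begin

subsection \<open>Taylor polynomials of the semigroup\<close>

abbreviation gen_iter :: "nat \<Rightarrow> (config \<Rightarrow> real) \<Rightarrow> config \<Rightarrow> real" where
  "gen_iter n v \<equiv> (east_generator p ^^ n) v"

definition taylor :: "(config \<Rightarrow> real) \<Rightarrow> nat \<Rightarrow> real \<Rightarrow> config \<Rightarrow> real" where
  "taylor v k s \<eta> = (\<Sum>n<k. s ^ n / fact n * gen_iter n v \<eta>)"

lemma taylor_0: "0 < k \<Longrightarrow> taylor v k 0 = v"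
  by (cases k) (auto simp: taylor_def fun_eq_iff sum.lessThan_Suc_shift simp del: sum.lessThan_Suc)

lemma determined_on_gen_iter:
  assumes "determined_on {a..<a + int W} v"
  shows "determined_on {a..<a + int (W + n)} (gen_iter n v)"
proof (induction n)
  case (Suc n)
  then show ?case
    using determined_on_east_generator[OF Suc.IH] by simp
qed (use assms in simp)

text \<open>The successive supports have widths \<open>W\<close>, \<open>W + 1\<close>, and so on,
  and each application costs twice the current width; the product is the rising factorial.\<close>

lemma gen_iter_bound:
  assumes det: "determined_on {a..<a + int W} v" and B: "\<And>\<eta>. \<bar>v \<eta>\<bar> \<le> B"
  shows "\<bar>gen_iter n v \<eta>\<bar> \<le> 2 ^ n * pochhammer (real W) n * B"
proof (induction n arbitrary: \<eta>)
  case (Suc n)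
  show ?case
    using east_generator_bound[OF determined_on_gen_iter[OF det, of n] Suc.IH, of \<eta>]
    by (simp add: pochhammer_Suc algebra_simps)
qed (use B in simp)

lemma determined_on_taylor:
  assumes det: "determined_on {a..<a + int W} v"
  shows "determined_on {a..<a + int (W + k)} (taylor v k s)"
proof -
  have "determined_on {a..<a + int (W + k)} (gen_iter n v)" if "n < k" for n
    by (rule determined_on_mono[OF determined_on_gen_iter[OF det, of n]]) (use that in auto)
  then show ?thesis
    unfolding taylor_def[abs_def]
    by (intro determined_on_sum determined_on_map2[where F = "\<lambda>x y. x * y"] determined_on_const) auto
qed

lemma taylor_term_bound:
  assumes det: "determined_on {a..<a + int W} v" and B: "\<And>\<eta>. \<bar>v \<eta>\<bar> \<le> B" and s: "0 \<le> s" "s \<le> 1 / 8"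
  shows "\<bar>s ^ n / fact n * gen_iter n v \<eta>\<bar> \<le> (1 / 4) ^ n * pochhammer (real W) n / fact n * B"
proof -
  have "\<bar>s ^ n / fact n * gen_iter n v \<eta>\<bar> \<le> (1 / 8) ^ n / fact n * (2 ^ n * pochhammer (real W) n * B)"
    unfolding abs_mult using s
    by (intro mult_mono gen_iter_bound[OF det B]) (auto intro!: divide_right_mono power_mono)
  also have "\<dots> = ((1 / 8) ^ n * 2 ^ n) * pochhammer (real W) n / fact n * B"
    by simp
  also have "(1 / 8) ^ n * 2 ^ n = (1 / 4 :: real) ^ n"
    by (simp flip: power_mult_distrib)
  finally show ?thesis .
qed

lemma taylor_bound:
  assumes det: "determined_on {a..<a + int W} v" and B: "\<And>\<eta>. \<bar>v \<eta>\<bar> \<le> B" and s: "0 \<le> s" "s \<le> 1 / 8"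
  shows "\<bar>taylor v k s \<eta>\<bar> \<le> (\<Sum>n. (1 / 4) ^ n * pochhammer (real W) n / fact n) * B"
proof -
  have "0 \<le> B"
    using B[of undefined] by linarith
  have "\<bar>taylor v k s \<eta>\<bar> \<le> (\<Sum>n<k. (1 / 4) ^ n * pochhammer (real W) n / fact n * B)"
    unfolding taylor_def by (intro order_trans[OF sum_abs] sum_mono taylor_term_bound[OF det B s])
  also have "\<dots> = (\<Sum>n<k. (1 / 4) ^ n * pochhammer (real W) n / fact n) * B"
    by (simp add: sum_distrib_right)
  also have "\<dots> \<le> (\<Sum>n. (1 / 4) ^ n * pochhammer (real W) n / fact n) * B"
    by (intro mult_right_mono sum_le_suminf pochhammer_ratio_summable \<open>0 \<le> B\<close>)
       (simp_all add: pochhammer_real_nonneg)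
  finally show ?thesis .
qed

lemma east_generator_taylor:
  assumes "determined_on {a..<a + int W} v"
  shows "east_generator p (taylor v k s) \<eta> = (\<Sum>n<k. s ^ n / fact n * gen_iter (Suc n) v \<eta>)"
proof -
  have "determined_on {a..<a + int (W + k)} (gen_iter n v)" if "n < k" for n
    by (rule determined_on_mono[OF determined_on_gen_iter[OF assms, of n]]) (use that in auto)
  then show ?thesis
    unfolding taylor_def[abs_def]
    by (subst east_generator_linear[of "{a..<a + int (W + k)}"]) auto
qed

text \<open>The derivative of the polynomial cancels against the generator except for the top term,
  which gives the error linear in \<open>h\<close>. The constant \<open>C\<close> may depend on
  \<open>k\<close>, since its factor \<open>h\<^sup>2\<close> disappears in the Euler limit.\<close>

lemma taylor_step:
  assumes det: "determined_on {a..<a + int W} v" and B: "\<And>\<eta>. \<bar>v \<eta>\<bar> \<le> B"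
  shows "\<exists>C\<ge>0. \<forall>s h \<eta>. 0 \<le> s \<longrightarrow> 0 \<le> h \<longrightarrow> s + h \<le> 1 / 8 \<longrightarrow>
    \<bar>taylor v (Suc k) (s + h) \<eta> - taylor v (Suc k) s \<eta> - h * east_generator p (taylor v (Suc k) s) \<eta>\<bar>
      \<le> h * (8 * (real (Suc k) * ((1 / 4) ^ Suc k * pochhammer (real W) (Suc k) / fact (Suc k))) * B)
        + h\<^sup>2 * C"
proof -
  define M where "M n = 2 ^ n * pochhammer (real W) n * B" for n
  define C where "C = (\<Sum>n<Suc k. (real n)\<^sup>2 / fact n * M n)"
  have B0: "0 \<le> B"
    using B[of undefined] by linarith
  have M0: "0 \<le> M n" for n
    by (simp add: M_def pochhammer_real_nonneg B0)
  have M: "\<bar>gen_iter n v \<eta>\<bar> \<le> M n" for n \<eta>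
    unfolding M_def by (rule gen_iter_bound[OF det B])
  have "\<bar>taylor v (Suc k) (s + h) \<eta> - taylor v (Suc k) s \<eta> - h * east_generator p (taylor v (Suc k) s) \<eta>\<bar>
      \<le> h * (8 * (real (Suc k) * ((1 / 4) ^ Suc k * pochhammer (real W) (Suc k) / fact (Suc k))) * B)
        + h\<^sup>2 * C" if s: "0 \<le> s" "0 \<le> h" "s + h \<le> 1 / 8" for s h \<eta>
  proof -
    define X where "X n = gen_iter n v \<eta>" for n
    define r where "r n = (s + h) ^ n - s ^ n - real n * h * s ^ (n - 1)" for n
    have shift: "(\<Sum>n<Suc k. real n * s ^ (n - 1) / fact n * X n) = (\<Sum>n<k. s ^ n / fact n * X (Suc n))"
      by (subst sum.lessThan_Suc_shift) (simp add: field_simps del: of_nat_Suc)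
    have "taylor v (Suc k) (s + h) \<eta> - taylor v (Suc k) s \<eta> - h * east_generator p (taylor v (Suc k) s) \<eta>
        = (\<Sum>n<Suc k. (s + h) ^ n / fact n * X n) - (\<Sum>n<Suc k. s ^ n / fact n * X n)
          - h * (\<Sum>n<Suc k. real n * s ^ (n - 1) / fact n * X n) - h * (s ^ k / fact k * X (Suc k))"
      unfolding east_generator_taylor[OF det] shift by (simp add: taylor_def X_def distrib_left)
    also have "\<dots> = (\<Sum>n<Suc k. r n / fact n * X n) - h * (s ^ k / fact k * X (Suc k))"
      unfolding r_def sum_distrib_left sum_subtractf[symmetric]
      by (intro arg_cong2[where f = minus] sum.cong refl) (simp add: field_simps)
    also have "\<bar>\<dots>\<bar> \<le> \<bar>\<Sum>n<Suc k. r n / fact n * X n\<bar> + \<bar>h * (s ^ k / fact k * X (Suc k))\<bar>"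
      by (rule abs_triangle_ineq4)
    also have "\<bar>\<Sum>n<Suc k. r n / fact n * X n\<bar> \<le> (\<Sum>n<Suc k. (real n)\<^sup>2 * h\<^sup>2 / fact n * M n)"
    proof (intro order_trans[OF sum_abs] sum_mono)
      fix n
      have "\<bar>r n\<bar> \<le> (real n)\<^sup>2 * h\<^sup>2"
        unfolding r_def by (rule power_increment_bound) (use s in auto)
      then show "\<bar>r n / fact n * X n\<bar> \<le> (real n)\<^sup>2 * h\<^sup>2 / fact n * M n"
        unfolding abs_mult abs_divide X_def by (intro mult_mono M M0) (auto intro!: divide_right_mono)
    qed
    also have "\<dots> = h\<^sup>2 * C"
      unfolding C_def sum_distrib_left by (intro sum.cong) (auto simp: field_simps)
    also have "\<bar>h * (s ^ k / fact k * X (Suc k))\<bar>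
        \<le> h * (8 * (real (Suc k) * ((1 / 4) ^ Suc k * pochhammer (real W) (Suc k) / fact (Suc k))) * B)"
    proof -
      have "\<bar>s ^ k / fact k * X (Suc k)\<bar> \<le> (1 / 8) ^ k / fact k * M (Suc k)"
        unfolding abs_mult X_def using s by (intro mult_mono M) (auto intro!: divide_right_mono power_mono)
      also have "\<dots> = 8 * (real (Suc k) * (((1 / 8) ^ Suc k * 2 ^ Suc k) * pochhammer (real W) (Suc k) / fact (Suc k))) * B"
        by (simp add: M_def field_simps del: of_nat_Suc)
      also have "(1 / 8) ^ Suc k * 2 ^ Suc k = (1 / 4 :: real) ^ Suc k"
        by (simp only: power_mult_distrib[symmetric]) simp
      finally show ?thesis
        using mult_left_mono[OF _ s(2)] s(2) by (simp only: abs_mult[of h] abs_of_nonneg)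
    qed
    finally show ?thesis
      by linarith
  qed
  moreover have "0 \<le> C"
    unfolding C_def by (intro sum_nonneg mult_nonneg_nonneg M0) simp
  ultimately show ?thesis
    by blast
qed

lemma zero_mean_sum:
  assumes "\<And>i. i \<in> I \<Longrightarrow> zero_mean a w (u i)"
  shows "zero_mean a w (\<lambda>\<eta>. \<Sum>i\<in>I. c i * u i \<eta>)"
  using assms by (auto simp: zero_mean_def avg_sum avg_cmult)

lemma zero_mean_taylor:
  assumes det: "determined_on {a..<a + int W} v" and v: "zero_mean a w v"
  shows "zero_mean a w (taylor v k s)"
proof -
  have "zero_mean a w (gen_iter n v)" for n
  proof (induction n)
    case (Suc n)
    then show ?case
      using zero_mean_east_generator[OF determined_on_gen_iter[OF det, of n]] by simp
  qed (use v in simp)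
  then show ?thesis
    unfolding taylor_def[abs_def] by (intro zero_mean_sum)
qed

lemma second_moment_perturb:
  assumes A: "second_moment_le a w u A" and r: "\<And>\<eta>. \<bar>v \<eta> - u \<eta>\<bar> \<le> \<delta>"
    and v: "\<And>\<eta>. \<bar>v \<eta>\<bar> \<le> B" and u: "\<And>\<eta>. \<bar>u \<eta>\<bar> \<le> B"
  shows "second_moment_le a w v (A + 2 * B * \<delta>)"
  unfolding second_moment_le_def
proof (intro allI impI)
  fix n \<eta> assume n: "w \<le> n" "\<not> \<eta> (a + int n)"
  have "avg p {a..<a + int n} (\<lambda>\<eta>. (v \<eta>)\<^sup>2) \<eta> \<le> avg p {a..<a + int n} (\<lambda>\<eta>. (u \<eta>)\<^sup>2 + 2 * B * \<delta>) \<eta>"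
  proof (rule avg_mono)
    fix \<eta>
    have "(v \<eta>)\<^sup>2 - (u \<eta>)\<^sup>2 = (v \<eta> + u \<eta>) * (v \<eta> - u \<eta>)"
      by (simp add: power2_eq_square algebra_simps)
    also have "\<dots> \<le> \<bar>v \<eta> + u \<eta>\<bar> * \<bar>v \<eta> - u \<eta>\<bar>"
      by (simp flip: abs_mult)
    also have "\<dots> \<le> (2 * B) * \<delta>"
      using r[of \<eta>] v[of \<eta>] u[of \<eta>] by (intro mult_mono) linarith+
    finally show "(v \<eta>)\<^sup>2 \<le> (u \<eta>)\<^sup>2 + 2 * B * \<delta>"
      by simp
  qed simp
  also have "\<dots> \<le> A + 2 * B * \<delta>"
    using A n by (simp add: avg_add avg_const second_moment_le_def)
  finally show "avg p {a..<a + int n} (\<lambda>\<eta>. (v \<eta>)\<^sup>2) \<eta> \<le> A + 2 * B * \<delta>" .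
qed

end

subsection \<open>The semigroup on functions approximable by local ones\<close>

lemma space_config_space [simp]: "space config_space = UNIV"
  by (simp add: config_space_def space_PiM)

text \<open>Integrability against every kernel follows, so that additivity and monotonicity of the
  Bochner integral are available.\<close>

definition bdd_measurable :: "(config \<Rightarrow> real) \<Rightarrow> bool" where
  "bdd_measurable u \<longleftrightarrow> u \<in> borel_measurable config_space \<and> (\<exists>B. \<forall>\<eta>. \<bar>u \<eta>\<bar> \<le> B)"

lemma bdd_measurable_determined:
  "finite A \<Longrightarrow> determined_on A u \<Longrightarrow> bdd_measurable u"
  unfolding bdd_measurable_def
  using determined_on_finite_measurable determined_on_finite_bounded by blast

lemma bdd_measurable_diff:
  assumes "bdd_measurable u" "bdd_measurable v"
  shows "bdd_measurable (\<lambda>\<eta>. u \<eta> - v \<eta>)"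
proof -
  obtain B B' where "\<And>\<eta>. \<bar>u \<eta>\<bar> \<le> B" "\<And>\<eta>. \<bar>v \<eta>\<bar> \<le> B'"
    using assms by (auto simp: bdd_measurable_def)
  then have "\<bar>u \<eta> - v \<eta>\<bar> \<le> B + B'" for \<eta>
    by (meson abs_triangle_ineq4 add_mono order_trans)
  then show ?thesis
    using assms by (auto simp: bdd_measurable_def)
qed

lemma bdd_measurable_const: "bdd_measurable (\<lambda>\<eta>. c)"
  by (auto simp: bdd_measurable_def)

lemma bdd_measurable_lincomb:
  assumes "bdd_measurable u" "bdd_measurable v"
  shows "bdd_measurable (\<lambda>\<eta>. b * u \<eta> + c * v \<eta> + d)"
proof -
  obtain B B' where B: "\<And>\<eta>. \<bar>u \<eta>\<bar> \<le> B" "\<And>\<eta>. \<bar>v \<eta>\<bar> \<le> B'"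
    using assms by (auto simp: bdd_measurable_def)
  have "\<bar>b * u \<eta> + c * v \<eta> + d\<bar> \<le> \<bar>b\<bar> * B + \<bar>c\<bar> * B' + \<bar>d\<bar>" for \<eta>
  proof -
    have "\<bar>b * u \<eta>\<bar> \<le> \<bar>b\<bar> * B" "\<bar>c * v \<eta>\<bar> \<le> \<bar>c\<bar> * B'"
      using B by (auto simp: abs_mult intro!: mult_left_mono)
    then show ?thesis
      by linarith
  qed
  then show ?thesis
    using assms unfolding bdd_measurable_def by (auto intro!: exI[of _ "\<bar>b\<bar> * B + \<bar>c\<bar> * B' + \<bar>d\<bar>"])
qed

locale east_semigroup = spin_density +
  fixes K :: "real \<Rightarrow> config \<Rightarrow> config measure"
  assumes tf: "transition_function config_space K"
    and gen: "local_fun f \<Longrightarrow> has_generator_value K f (east_generator p f)"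
begin

abbreviation P :: "real \<Rightarrow> (config \<Rightarrow> real) \<Rightarrow> config \<Rightarrow> real" where
  "P \<equiv> transition_op K"

lemma K_measurable: "0 \<le> t \<Longrightarrow> K t \<in> config_space \<rightarrow>\<^sub>M prob_algebra config_space"
  using tf by (auto simp: transition_function_def)

lemma prob_space_K: "0 \<le> t \<Longrightarrow> prob_space (K t \<eta>)"
  and sets_K: "0 \<le> t \<Longrightarrow> sets (K t \<eta>) = sets config_space"
  using measurable_space[OF K_measurable, of t \<eta>] by (auto simp: space_prob_algebra)

lemma integrable_K:
  assumes "0 \<le> t" "bdd_measurable u"
  shows "integrable (K t \<eta>) u"
proof -
  interpret prob_space "K t \<eta>"
    using assms by (intro prob_space_K)
  obtain B where "\<And>\<eta>. \<bar>u \<eta>\<bar> \<le> B"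
    using assms by (auto simp: bdd_measurable_def)
  moreover have "u \<in> borel_measurable (K t \<eta>)"
    using assms measurable_cong_sets[OF sets_K refl, of t \<eta>] by (auto simp: bdd_measurable_def)
  ultimately show ?thesis
    by (intro integrable_const_bound[where B = B]) auto
qed

lemma P_mono:
  assumes "0 \<le> t" "bdd_measurable u" "bdd_measurable v" "\<And>\<eta>. u \<eta> \<le> v \<eta>"
  shows "P t u \<eta> \<le> P t v \<eta>"
  unfolding transition_op_def using assms by (intro integral_mono integrable_K)

lemma P_const: "0 \<le> t \<Longrightarrow> P t (\<lambda>_. c) \<eta> = c"
  using prob_space.prob_space[OF prob_space_K, of t \<eta>] by (simp add: transition_op_def)

lemma P_diff:
  "0 \<le> t \<Longrightarrow> bdd_measurable u \<Longrightarrow> bdd_measurable v \<Longrightarrow> P t (\<lambda>\<eta>. u \<eta> - v \<eta>) \<eta> = P t u \<eta> - P t v \<eta>"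
  unfolding transition_op_def by (intro Bochner_Integration.integral_diff integrable_K)

lemma P_sum:
  "0 \<le> t \<Longrightarrow> (\<And>i. i \<in> I \<Longrightarrow> bdd_measurable (u i)) \<Longrightarrow>
    P t (\<lambda>\<eta>. \<Sum>i\<in>I. c i * u i \<eta>) \<eta> = (\<Sum>i\<in>I. c i * P t (u i) \<eta>)"
  unfolding transition_op_def
  by (subst Bochner_Integration.integral_sum) (auto intro: integrable_K integrable_mult_right)

lemma P_contraction:
  assumes t: "0 \<le> t" and u: "bdd_measurable u" and v: "bdd_measurable v" and d: "\<And>\<eta>. \<bar>u \<eta> - v \<eta>\<bar> \<le> \<delta>"
  shows "\<bar>P t u \<eta> - P t v \<eta>\<bar> \<le> \<delta>"
proof -
  have le: "- \<delta> \<le> u \<eta> - v \<eta>" "u \<eta> - v \<eta> \<le> \<delta>" for \<eta>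
    using d[of \<eta>] by linarith+
  have "P t (\<lambda>\<eta>. u \<eta> - v \<eta>) \<eta> \<le> P t (\<lambda>_. \<delta>) \<eta>" "P t (\<lambda>_. - \<delta>) \<eta> \<le> P t (\<lambda>\<eta>. u \<eta> - v \<eta>) \<eta>"
    by (intro P_mono t bdd_measurable_diff u v bdd_measurable_const le)+
  then show ?thesis
    by (simp add: P_diff P_const t u v)
qed

lemma bdd_measurable_P:
  assumes t: "0 \<le> t" and u: "bdd_measurable u"
  shows "bdd_measurable (P t u)"
proof -
  obtain B where B: "\<And>\<eta>. \<bar>u \<eta>\<bar> \<le> B"
    using u by (auto simp: bdd_measurable_def)
  have "\<bar>P t u \<eta>\<bar> \<le> B" for \<eta>
    using P_contraction[OF t u bdd_measurable_const[of 0], of B \<eta>] B by (simp add: P_const t)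
  moreover have "P t u \<in> borel_measurable config_space"
    unfolding transition_op_def[abs_def] using u
    by (intro measurable_compose[OF measurable_prob_algebraD[OF K_measurable[OF t]]
          integral_measurable_subprob_algebra]) (auto simp: bdd_measurable_def)
  ultimately show ?thesis
    by (auto simp: bdd_measurable_def)
qed

lemma P_0:
  assumes u: "bdd_measurable u"
  shows "P 0 u = u"
proof
  fix \<eta>
  have "K 0 \<eta> = return config_space \<eta>"
    using tf by (simp add: transition_function_def)
  then show "P 0 u \<eta> = u \<eta>"
    using u by (simp add: transition_op_def integral_return bdd_measurable_def)
qed

lemma P_add:
  assumes s: "0 \<le> s" and t: "0 \<le> t" and u: "bdd_measurable u"
  shows "P (s + t) u = P s (P t u)"
proof
  fix \<eta>
  obtain B where B: "\<And>\<eta>. \<bar>u \<eta>\<bar> \<le> B"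
    using u by (auto simp: bdd_measurable_def)
  have "K (s + t) \<eta> = K s \<eta> \<bind> K t"
    using tf s t by (simp add: transition_function_def)
  moreover have "(\<integral>x. u x \<partial>(K s \<eta> \<bind> K t)) = (\<integral>x. (\<integral>y. u y \<partial>K t x) \<partial>K s \<eta>)"
  proof (rule integral_bind[where K = config_space and B = B and B' = 1])
    show "K t \<in> K s \<eta> \<rightarrow>\<^sub>M subprob_algebra config_space"
      using measurable_prob_algebraD[OF K_measurable[OF t]] measurable_cong_sets[OF sets_K[OF s] refl] by blast
    show "finite_measure (K s \<eta>)"
      using prob_space_K[OF s] by (simp add: prob_space.finite_measure)
    show "AE x in K s \<eta>. emeasure (K t x) (space (K t x)) \<le> ennreal 1"
      using prob_space.emeasure_space_1[OF prob_space_K[OF t]] by simp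
  qed (use u B in \<open>auto simp: bdd_measurable_def\<close>)
  ultimately show "P (s + t) u \<eta> = P s (P t u) \<eta>"
    by (simp add: transition_op_def)
qed

lemma local_fun_determined: "finite A \<Longrightarrow> determined_on A v \<Longrightarrow> local_fun v"
  unfolding local_fun_def determined_on_def by blast

lemma P_euler:
  assumes v: "finite A" "determined_on A v" and \<delta>: "0 < \<delta>"
  shows "\<forall>\<^sub>F h in at_right 0. \<forall>\<eta>. \<bar>P h v \<eta> - v \<eta> - h * east_generator p v \<eta>\<bar> \<le> h * \<delta>"
proof -
  have "uniform_limit UNIV (\<lambda>t x. (P t v x - v x) / t) (east_generator p v) (at_right 0)"
    using gen[OF local_fun_determined[OF v]] by (simp add: has_generator_value_def)
  from uniform_limitD[OF this \<delta>] eventually_at_right_less[of 0] show ?thesis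
  proof eventually_elim
    case (elim h)
    show ?case
    proof
      fix \<eta>
      have "\<bar>(P h v \<eta> - v \<eta>) / h - east_generator p v \<eta>\<bar> \<le> \<delta>"
        using elim by (auto simp: dist_real_def intro: less_imp_le)
      then have "h * \<bar>(P h v \<eta> - v \<eta>) / h - east_generator p v \<eta>\<bar> \<le> h * \<delta>"
        using elim by (intro mult_left_mono) auto
      also have "h * \<bar>(P h v \<eta> - v \<eta>) / h - east_generator p v \<eta>\<bar>
          = \<bar>h * ((P h v \<eta> - v \<eta>) / h - east_generator p v \<eta>)\<bar>"
        using elim by (simp add: abs_mult)
      also have "h * ((P h v \<eta> - v \<eta>) / h - east_generator p v \<eta>) = P h v \<eta> - v \<eta> - h * east_generator p v \<eta>"
        using elim by (simp add: field_simps)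
      finally show "\<bar>P h v \<eta> - v \<eta> - h * east_generator p v \<eta>\<bar> \<le> h * \<delta>" .
    qed
  qed
qed

text \<open>All polynomials with \<open>s \<le> 1 / 8\<close> combine the same \<open>Suc k\<close>
  functions with coefficients in [0, 1], so one \<open>h0\<close> serves every \<open>s\<close> when
  each function is granted the error \<open>\<delta> / Suc k\<close>.\<close>

lemma P_euler_taylor:
  assumes det: "determined_on {a..<a + int W} v" and \<delta>: "0 < \<delta>"
  shows "\<exists>h0>0. \<forall>h s \<eta>. 0 < h \<longrightarrow> h \<le> h0 \<longrightarrow> 0 \<le> s \<longrightarrow> s \<le> 1 / 8 \<longrightarrow>
    \<bar>P h (taylor v (Suc k) s) \<eta> - taylor v (Suc k) s \<eta> - h * east_generator p (taylor v (Suc k) s) \<eta>\<bar> \<le> h * \<delta>"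
proof -
  have bm: "bdd_measurable (gen_iter n v)" for n
    by (rule bdd_measurable_determined[OF _ determined_on_gen_iter[OF det]]) simp
  have "\<forall>\<^sub>F h in at_right 0. \<forall>n\<in>{..<Suc k}. \<forall>\<eta>.
      \<bar>P h (gen_iter n v) \<eta> - gen_iter n v \<eta> - h * east_generator p (gen_iter n v) \<eta>\<bar> \<le> h * (\<delta> / real (Suc k))"
    by (intro eventually_ball_finite ballI P_euler[OF _ determined_on_gen_iter[OF det]]) (use \<delta> in simp_all)
  then obtain b where b: "0 < b" "\<And>h n \<eta>. 0 < h \<Longrightarrow> h < b \<Longrightarrow> n < Suc k \<Longrightarrow>
      \<bar>P h (gen_iter n v) \<eta> - gen_iter n v \<eta> - h * east_generator p (gen_iter n v) \<eta>\<bar> \<le> h * (\<delta> / real (Suc k))"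
    unfolding eventually_at_right_field by (metis lessThan_iff)
  show ?thesis
  proof (intro exI[of _ "b / 2"] conjI allI impI)
    show "0 < b / 2"
      using b by simp
    fix h s \<eta> assume h: "0 < h" "h \<le> b / 2" and s: "0 \<le> s" "s \<le> 1 / (8::real)"
    have eq: "P h (taylor v (Suc k) s) \<eta> - taylor v (Suc k) s \<eta> - h * east_generator p (taylor v (Suc k) s) \<eta>
        = (\<Sum>n<Suc k. s ^ n / fact n * (P h (gen_iter n v) \<eta> - gen_iter n v \<eta> - h * east_generator p (gen_iter n v) \<eta>))"
      unfolding east_generator_taylor[OF det] unfolding taylor_def[abs_def]
      by (subst P_sum) (use h bm in \<open>auto simp: sum_distrib_left sum_subtractf[symmetric] right_diff_distrib mult.left_commute simp del: sum.lessThan_Suc\<close>)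
    have "\<bar>P h (taylor v (Suc k) s) \<eta> - taylor v (Suc k) s \<eta> - h * east_generator p (taylor v (Suc k) s) \<eta>\<bar>
        \<le> (\<Sum>n<Suc k. 1 * (h * (\<delta> / real (Suc k))))"
      unfolding eq
    proof (intro order_trans[OF sum_abs] sum_mono)
      fix n assume "n \<in> {..<Suc k}"
      moreover have "s ^ n \<le> fact n"
        using s by (intro order_trans[OF power_le_one]) auto
      ultimately show "\<bar>s ^ n / fact n * (P h (gen_iter n v) \<eta> - gen_iter n v \<eta> - h * east_generator p (gen_iter n v) \<eta>)\<bar>
          \<le> 1 * (h * (\<delta> / real (Suc k)))"
        unfolding abs_mult using s h b by (intro mult_mono b(2)) auto
    qed
    also have "\<dots> = h * \<delta>"
      by (simp del: of_nat_Suc sum.lessThan_Suc)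
    finally show "\<bar>P h (taylor v (Suc k) s) \<eta> - taylor v (Suc k) s \<eta> - h * east_generator p (taylor v (Suc k) s) \<eta>\<bar> \<le> h * \<delta>" .
  qed
qed

text \<open>The uniform distance obeys the Euler bound with rate 0: the semigroup does not enlarge
  the old error, and one step adds the generator error \<open>h * \<delta>\<close> and the Taylor
  defect.\<close>

lemma P_taylor_approx:
  assumes det: "determined_on {a..<a + int W} v" and B: "\<And>\<eta>. \<bar>v \<eta>\<bar> \<le> B" and \<tau>: "0 \<le> \<tau>" "\<tau> \<le> 1 / 8"
  shows "\<bar>P \<tau> v \<eta> - taylor v (Suc k) \<tau> \<eta>\<bar> \<le> \<tau> * taylor_error W B k"
proof -
  let ?T = "taylor v (Suc k)" and ?e = "taylor_error W B k"
  have e0: "0 \<le> ?e"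
    using B[of undefined] by (intro taylor_error_nonneg) linarith
  have bmv: "bdd_measurable v"
    by (rule bdd_measurable_determined[OF _ det]) simp
  have bmT: "bdd_measurable (?T s)" for s
    by (rule bdd_measurable_determined[OF _ determined_on_taylor[OF det]]) simp
  obtain C where C: "0 \<le> C" "\<And>s h \<eta>. 0 \<le> s \<Longrightarrow> 0 \<le> h \<Longrightarrow> s + h \<le> 1 / 8 \<Longrightarrow>
      \<bar>?T (s + h) \<eta> - ?T s \<eta> - h * east_generator p (?T s) \<eta>\<bar> \<le> h * ?e + h\<^sup>2 * C"
    using taylor_step[OF det B, of k] unfolding taylor_error_def by blast
  have "\<bar>P \<tau> v \<eta> - ?T \<tau> \<eta>\<bar> \<le> exp (- 0 * \<tau>) * 0 + \<tau> * (?e + \<delta>)" if \<delta>: "0 < \<delta>" for \<delta>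
  proof -
    obtain h0 where h0: "0 < h0" "\<And>h s \<eta>. 0 < h \<Longrightarrow> h \<le> h0 \<Longrightarrow> 0 \<le> s \<Longrightarrow> s \<le> 1 / 8 \<Longrightarrow>
        \<bar>P h (?T s) \<eta> - ?T s \<eta> - h * east_generator p (?T s) \<eta>\<bar> \<le> h * \<delta>"
      using P_euler_taylor[OF det \<delta>, of k] by blast
    show ?thesis
    proof (rule euler_bound[where I = UNIV and \<phi> = "\<lambda>s \<eta>. \<bar>P s v \<eta> - ?T s \<eta>\<bar>" and C = C and \<kappa> = 0])
      show "\<bar>P 0 v \<eta> - ?T 0 \<eta>\<bar> \<le> 0" for \<eta>
        by (simp add: P_0[OF bmv] taylor_0)
      fix s h A \<eta>
      assume s: "0 \<le> s" and h: "0 < h" "h \<le> h0" and sh: "s + h \<le> \<tau>"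
        and IH: "\<And>\<eta>. \<eta> \<in> UNIV \<Longrightarrow> \<bar>P s v \<eta> - ?T s \<eta>\<bar> \<le> A"
      have "P (s + h) v \<eta> = P h (P s v) \<eta>"
        using P_add[of h s v] s h bmv by (simp add: add.commute)
      moreover have "\<bar>P h (P s v) \<eta> - P h (?T s) \<eta>\<bar> \<le> A"
        by (rule P_contraction) (use s h IH bmT bdd_measurable_P bmv in auto)
      moreover have "\<bar>P h (?T s) \<eta> - ?T s \<eta> - h * east_generator p (?T s) \<eta>\<bar> \<le> h * \<delta>"
        using s h sh \<tau> by (intro h0) auto
      moreover have "\<bar>?T (s + h) \<eta> - ?T s \<eta> - h * east_generator p (?T s) \<eta>\<bar> \<le> h * ?e + h\<^sup>2 * C"
        using s h sh \<tau> by (intro C) auto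
      ultimately show "\<bar>P (s + h) v \<eta> - ?T (s + h) \<eta>\<bar> \<le> (1 - 0 * h) * A + h * (?e + \<delta>) + h\<^sup>2 * C"
        by (simp only: distrib_left mult_zero_left diff_zero mult_1)
    qed (use h0 \<tau> C e0 \<delta> in auto)
  qed
  then have *: "\<bar>P \<tau> v \<eta> - ?T \<tau> \<eta>\<bar> \<le> \<tau> * ?e + \<tau> * \<delta>" if "0 < \<delta>" for \<delta>
    using that by (simp add: distrib_left)
  show ?thesis
  proof (rule field_le_epsilon)
    fix \<delta> :: real assume "0 < \<delta>"
    moreover have "\<tau> * \<delta> \<le> 1 * \<delta>"
      using \<tau> \<open>0 < \<delta>\<close> by (intro mult_right_mono) auto
    ultimately show "\<bar>P \<tau> v \<eta> - ?T \<tau> \<eta>\<bar> \<le> \<tau> * ?e + \<delta>"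
      using *[of \<delta>] by linarith
  qed
qed

section \<open>Contraction of the second moment along the semigroup\<close>

text \<open>\<open>W\<close> may depend on \<open>\<epsilon>\<close>, whereas \<open>a\<close> and
  \<open>w\<close> are fixed. The semigroup makes local functions nonlocal, but their approximants
  keep the same admissible positions of the zero.\<close>

definition approx_class :: "int \<Rightarrow> nat \<Rightarrow> real \<Rightarrow> (config \<Rightarrow> real) \<Rightarrow> bool" where
  "approx_class a w A u \<longleftrightarrow> bdd_measurable u \<and> 0 \<le> A \<and>
     (\<forall>\<epsilon>>0. \<exists>W v. determined_on {a..<a + int W} v \<and> zero_mean a w v \<and>
        second_moment_le a w v (A + \<epsilon>) \<and> (\<forall>\<eta>. \<bar>u \<eta> - v \<eta>\<bar> \<le> \<epsilon>))"

lemma second_moment_taylor: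
  assumes pc: "poincare_constant C"
    and det: "determined_on {a..<a + int W} v" and B: "\<And>\<eta>. \<bar>v \<eta>\<bar> \<le> B"
    and v: "zero_mean a w v" and A: "second_moment_le a w v A" "0 \<le> A" and \<tau>: "0 \<le> \<tau>" "\<tau> \<le> 1 / 8"
  defines "M \<equiv> (\<Sum>n. (1 / 4) ^ n * pochhammer (real W) n / fact n) * B"
  shows "second_moment_le a w (taylor v (Suc k) \<tau>)
    (exp (- (2 / C) * \<tau>) * A + \<tau> * (2 * (M + 1) * taylor_error W B k))"
proof -
  let ?T = "taylor v (Suc k)" and ?e = "taylor_error W B k"
  have C: "0 < C"
    using pc by (simp add: poincare_constant_def)
  define W' where "W' = W + Suc k"
  have e0: "0 \<le> ?e"
    using B[of undefined] by (intro taylor_error_nonneg) linarith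
  have M: "\<bar>?T s \<eta>\<bar> \<le> M" if "0 \<le> s" "s \<le> 1 / 8" for s \<eta>
    unfolding M_def by (rule taylor_bound[OF det B that])
  have M0: "0 \<le> M"
    using M[of 0 undefined] by simp
  obtain C1 where C1: "0 \<le> C1" "\<And>s h \<eta>. 0 \<le> s \<Longrightarrow> 0 \<le> h \<Longrightarrow> s + h \<le> 1 / 8 \<Longrightarrow>
      \<bar>?T (s + h) \<eta> - ?T s \<eta> - h * east_generator p (?T s) \<eta>\<bar> \<le> h * ?e + h\<^sup>2 * C1"
    using taylor_step[OF det B, of k] unfolding taylor_error_def by blast
  \<comment> \<open>The first bound keeps the Taylor defect \<open>r\<close> at most 1, so that
    \<open>M + 1\<close> also bounds the Euler step; the second is the step condition of
    \<open>second_moment_euler_step\<close>.\<close>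
  define h0 where "h0 = min (1 / (1 + ?e + C1)) (1 / (2 / C + real W' + 1))"
  define I where "I = {(n, \<eta>). w \<le> n \<and> \<not> \<eta> (a + int n)}"
  define \<phi> where "\<phi> s = (\<lambda>(n, \<eta>). avg p {a..<a + int n} (\<lambda>\<eta>. (?T s \<eta>)\<^sup>2) \<eta>)" for s
  have \<phi>: "second_moment_le a w (?T s) A' \<longleftrightarrow> (\<forall>i\<in>I. \<phi> s i \<le> A')" for s A'
    by (auto simp: second_moment_le_def \<phi>_def I_def)
  have pos: "0 < 1 + ?e + C1" "0 < 2 / C + real W' + 1"
    using e0 C1 C by (auto intro!: add_nonneg_pos)
  have "\<phi> \<tau> i \<le> exp (- (2 / C) * \<tau>) * A + \<tau> * (2 * (M + 1) * ?e)" if "i \<in> I" for i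
  proof (rule euler_bound[where I = I and \<phi> = \<phi> and \<delta> = h0
        and C = "(2 * real W' * M)\<^sup>2 + 2 * (M + 1) * C1"])
    show "\<phi> 0 i \<le> A" if "i \<in> I" for i
      using A that \<phi>[of 0] by (simp add: taylor_0)
    fix s h A' i
    assume s: "0 \<le> s" and h: "0 < h" "h \<le> h0" and sh: "s + h \<le> \<tau>"
      and IH: "\<And>i. i \<in> I \<Longrightarrow> \<phi> s i \<le> A'" and i: "i \<in> I"
    have h1: "h * (1 + ?e + C1) \<le> 1" "h * (2 / C + real W' + 1) \<le> 1"
      using h pos by (auto simp: h0_def pos_le_divide_eq)
    have "0 \<le> h * ?e" "0 \<le> h * C1" "0 \<le> h * (2 / C + real W')"
      using h e0 C1 C by (auto intro!: mult_nonneg_nonneg add_nonneg_nonneg)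
    with h1 have h2: "h \<le> 1" "h * (?e + C1) \<le> 1" "h * (2 / C + real W') \<le> 1"
      using h by (simp_all add: algebra_simps)
    define r where "r = h * ?e + h\<^sup>2 * C1"
    have "h\<^sup>2 * C1 \<le> h * C1"
      using h2 h C1 by (intro mult_right_mono) (auto simp: power2_eq_square)
    then have r: "0 \<le> r" "r \<le> 1"
      using h2 h e0 C1 by (auto simp: r_def distrib_left)
    have T: "\<bar>?T (s + h) \<eta> - (?T s \<eta> + h * east_generator p (?T s) \<eta>)\<bar> \<le> r" for \<eta>
      using C1(2)[of s h \<eta>] s h sh \<tau> by (simp add: r_def algebra_simps)
    have "second_moment_le a w (\<lambda>\<eta>. ?T s \<eta> + h * east_generator p (?T s) \<eta>)
        ((1 - 2 / C * h) * A' + h\<^sup>2 * (2 * real W' * M)\<^sup>2)"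
    proof (rule second_moment_euler_step[OF pc])
      show "determined_on {a..<a + int W'} (?T s)"
        unfolding W'_def by (rule determined_on_taylor[OF det])
      show "zero_mean a w (?T s)"
        by (rule zero_mean_taylor[OF det v])
      show "second_moment_le a w (?T s) A'"
        using IH \<phi> by blast
    qed (use M s h sh \<tau> h2 in auto)
    then have "second_moment_le a w (?T (s + h))
        ((1 - 2 / C * h) * A' + h\<^sup>2 * (2 * real W' * M)\<^sup>2 + 2 * (M + 1) * r)"
    proof (rule second_moment_perturb[OF _ T])
      fix \<eta>
      show 1: "\<bar>?T (s + h) \<eta>\<bar> \<le> M + 1"
        using M[of "s + h" \<eta>] s h sh \<tau> by auto
      have "\<bar>?T (s + h) \<eta>\<bar> \<le> M"
        using M[of "s + h" \<eta>] s h sh \<tau> by auto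
      then show "\<bar>?T s \<eta> + h * east_generator p (?T s) \<eta>\<bar> \<le> M + 1"
        using T[of \<eta>] r by linarith
    qed
    then have "\<phi> (s + h) i \<le> (1 - 2 / C * h) * A' + h\<^sup>2 * (2 * real W' * M)\<^sup>2 + 2 * (M + 1) * r"
      using \<phi> i by blast
    also have "\<dots> = (1 - 2 / C * h) * A' + h * (2 * (M + 1) * ?e) + h\<^sup>2 * ((2 * real W' * M)\<^sup>2 + 2 * (M + 1) * C1)"
      by (simp add: r_def algebra_simps)
    finally show "\<phi> (s + h) i \<le> \<dots>" .
  qed (use that A \<tau> C C1 M0 e0 pos in \<open>auto simp: h0_def\<close>)
  then show ?thesis
    using \<phi> by blast
qed

lemma approx_class_step:
  assumes pc: "poincare_constant C"
    and u: "approx_class a w A u" and \<tau>: "0 \<le> \<tau>" "\<tau> \<le> 1 / 8"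
  shows "approx_class a w (exp (- (2 / C) * \<tau>) * A) (P \<tau> u)"
  unfolding approx_class_def
proof (intro conjI allI impI)
  have C: "0 < C"
    using pc by (simp add: poincare_constant_def)
  have A: "0 \<le> A" and bu: "bdd_measurable u"
    using u by (auto simp: approx_class_def)
  show "bdd_measurable (P \<tau> u)"
    by (rule bdd_measurable_P[OF \<tau>(1) bu])
  show "0 \<le> exp (- (2 / C) * \<tau>) * A"
    using A by simp
  fix \<epsilon> :: real assume \<epsilon>: "0 < \<epsilon>"
  then have "0 < \<epsilon> / 2"
    by simp
  then obtain W v where det: "determined_on {a..<a + int W} v" and v: "zero_mean a w v"
    "second_moment_le a w v (A + \<epsilon> / 2)" "\<And>\<eta>. \<bar>u \<eta> - v \<eta>\<bar> \<le> \<epsilon> / 2"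
    using u unfolding approx_class_def by blast
  obtain B where B: "0 \<le> B" "\<And>\<eta>. \<bar>v \<eta>\<bar> \<le> B"
    using determined_on_finite_bounded[OF _ det] by auto
  have bv: "bdd_measurable v"
    by (rule bdd_measurable_determined[OF _ det]) simp
  define M where "M = (\<Sum>n. (1 / 4) ^ n * pochhammer (real W) n / fact n) * B"
  have M0: "0 \<le> M"
    unfolding M_def using B by (intro mult_nonneg_nonneg suminf_nonneg pochhammer_ratio_summable)
      (simp_all add: pochhammer_real_nonneg)
  \<comment> \<open>Since \<open>\<tau> \<le> 2 * (M + 1)\<close>, the same \<open>k\<close> makes
    both the loss in second moment and the uniform distance at most
    \<open>\<epsilon> / 2\<close>.\<close>
  have "0 < \<epsilon> / 2 / (2 * (M + 1))"
    using \<epsilon> M0 by simp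
  from order_tendstoD(2)[OF taylor_error_tendsto this] obtain k
    where "taylor_error W B k < \<epsilon> / 2 / (2 * (M + 1))"
    using eventually_happens'[OF sequentially_bot] by blast
  then have k: "2 * (M + 1) * taylor_error W B k \<le> \<epsilon> / 2"
    using M0 by (simp add: field_simps)
  have e0: "0 \<le> taylor_error W B k"
    by (rule taylor_error_nonneg[OF B(1)])
  have k': "\<tau> * taylor_error W B k \<le> \<epsilon> / 2"
  proof -
    have "\<tau> * taylor_error W B k \<le> (2 * (M + 1)) * taylor_error W B k"
      using \<tau> M0 by (intro mult_right_mono e0) auto
    with k show ?thesis
      by linarith
  qed
  show "\<exists>W v. determined_on {a..<a + int W} v \<and> zero_mean a w v \<and>
        second_moment_le a w v (exp (- (2 / C) * \<tau>) * A + \<epsilon>) \<and> (\<forall>\<eta>. \<bar>P \<tau> u \<eta> - v \<eta>\<bar> \<le> \<epsilon>)"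
  proof (intro exI conjI allI)
    show "determined_on {a..<a + int (W + Suc k)} (taylor v (Suc k) \<tau>)"
      by (rule determined_on_taylor[OF det])
    show "zero_mean a w (taylor v (Suc k) \<tau>)"
      by (rule zero_mean_taylor[OF det v(1)])
    have "second_moment_le a w (taylor v (Suc k) \<tau>)
        (exp (- (2 / C) * \<tau>) * (A + \<epsilon> / 2) + \<tau> * (2 * (M + 1) * taylor_error W B k))"
      unfolding M_def using A \<epsilon> by (intro second_moment_taylor[OF pc det B(2) v(1,2) _ \<tau>]) auto
    moreover have "exp (- (2 / C) * \<tau>) * (A + \<epsilon> / 2) + \<tau> * (2 * (M + 1) * taylor_error W B k)
        \<le> exp (- (2 / C) * \<tau>) * A + \<epsilon>"
    proof -
      have "exp (- (2 / C) * \<tau>) * (\<epsilon> / 2) \<le> 1 * (\<epsilon> / 2)"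
        using C \<tau> \<epsilon> by (intro mult_right_mono) auto
      moreover have "\<tau> * (2 * (M + 1) * taylor_error W B k) \<le> 1 * (\<epsilon> / 2)"
        using \<tau> M0 e0 k by (intro mult_mono) auto
      ultimately show ?thesis
        by (simp add: distrib_left)
    qed
    ultimately show "second_moment_le a w (taylor v (Suc k) \<tau>) (exp (- (2 / C) * \<tau>) * A + \<epsilon>)"
      unfolding second_moment_le_def by (meson order_trans)
    fix \<eta>
    have "\<bar>P \<tau> u \<eta> - P \<tau> v \<eta>\<bar> \<le> \<epsilon> / 2"
      by (rule P_contraction[OF \<tau>(1) bu bv v(3)])
    moreover have "\<bar>P \<tau> v \<eta> - taylor v (Suc k) \<tau> \<eta>\<bar> \<le> \<tau> * taylor_error W B k"
      by (rule P_taylor_approx[OF det B(2) \<tau>])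
    ultimately show "\<bar>P \<tau> u \<eta> - taylor v (Suc k) \<tau> \<eta>\<bar> \<le> \<epsilon>"
      using k' by linarith
  qed
qed

lemma approx_class_semigroup:
  assumes pc: "poincare_constant C"
    and u: "approx_class a w A u" and t: "0 \<le> t"
  shows "approx_class a w (exp (- (2 / C) * t) * A) (P t u)"
proof -
  \<comment> \<open>The summand 1 keeps \<open>j\<close> positive when \<open>t = 0\<close>.\<close>
  obtain j :: nat where j: "8 * t + 1 \<le> real j"
    using real_arch_simple by blast
  define \<tau> where "\<tau> = t / real j"
  have \<tau>: "0 \<le> \<tau>" "\<tau> \<le> 1 / 8" "real j * \<tau> = t"
    using j t by (auto simp: \<tau>_def field_simps)
  have bu: "bdd_measurable u"
    using u by (auto simp: approx_class_def)
  have "approx_class a w (exp (- (2 / C) * (real i * \<tau>)) * A) (P (real i * \<tau>) u)" for i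
  proof (induction i)
    case 0
    then show ?case
      using u P_0[OF bu] by simp
  next
    case (Suc i)
    have P: "P (real (Suc i) * \<tau>) u = P \<tau> (P (real i * \<tau>) u)"
      using P_add[OF \<tau>(1) _ bu, of "real i * \<tau>"] \<tau>(1) by (simp add: algebra_simps)
    have "- (2 / C) * (real (Suc i) * \<tau>) = - (2 / C) * \<tau> + - (2 / C) * (real i * \<tau>)"
      by (simp add: algebra_simps add_divide_distrib)
    then have e: "exp (- (2 / C) * (real (Suc i) * \<tau>)) = exp (- (2 / C) * \<tau>) * exp (- (2 / C) * (real i * \<tau>))"
      by (simp only: exp_add)
    show ?case
      using approx_class_step[OF pc Suc.IH \<tau>(1,2)] unfolding P e by (simp only: mult.assoc)
  qed
  from this[of j] show ?thesis
    by (simp add: \<tau>(3))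
qed

end

subsection \<open>Pointwise decay\<close>

lemma sets_bernoulli_product: "sets (bernoulli_product p) = sets config_space"
  unfolding bernoulli_product_def config_space_def by (rule sets_PiM_cong) auto

lemma space_bernoulli_product [simp]: "space (bernoulli_product p) = UNIV"
  using sets_eq_imp_space_eq[OF sets_bernoulli_product] by simp

lemma prob_space_bernoulli_product: "prob_space (bernoulli_product p)"
  unfolding bernoulli_product_def by (intro prob_space_PiM prob_space_measure_pmf)

lemma integrable_bernoulli_product:
  assumes "bdd_measurable u"
  shows "integrable (bernoulli_product p) u"
proof -
  interpret prob_space "bernoulli_product p"
    by (rule prob_space_bernoulli_product)
  obtain B where "\<And>\<eta>. \<bar>u \<eta>\<bar> \<le> B"
    using assms by (auto simp: bdd_measurable_def)
  moreover have "u \<in> borel_measurable (bernoulli_product p)"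
    using assms measurable_cong_sets[OF sets_bernoulli_product refl] by (auto simp: bdd_measurable_def)
  ultimately show ?thesis
    by (intro integrable_const_bound[where B = B]) auto
qed

lemma integral_site_average:
  assumes u: "bdd_measurable u"
  shows "(\<integral>\<eta>. site_average p x u \<eta> \<partial>bernoulli_product p) = (\<integral>\<eta>. u \<eta> \<partial>bernoulli_product p)"
proof -
  define N where "N = measure_pmf (bernoulli_pmf p)"
  define M where "M = bernoulli_product p"
  have M: "M = PiM UNIV (\<lambda>_. N)"
    by (simp add: M_def N_def bernoulli_product_def)
  interpret N: prob_space N
    unfolding N_def by (rule prob_space_measure_pmf)
  interpret M: prob_space M
    unfolding M_def by (rule prob_space_bernoulli_product)
  interpret NM: pair_prob_space N M ..
  have um: "u \<in> borel_measurable M"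
    unfolding M_def using u measurable_cong_sets[OF sets_bernoulli_product refl] by (auto simp: bdd_measurable_def)
  have upd: "(\<lambda>(v, \<eta>). fun_upd \<eta> x v) \<in> N \<Otimes>\<^sub>M M \<rightarrow>\<^sub>M M"
    unfolding M case_prod_beta by (rule measurable_fun_upd[where J = UNIV]) auto
  have dist: "distr (N \<Otimes>\<^sub>M M) M (\<lambda>(v, \<eta>). fun_upd \<eta> x v) = M"
    using distr_pair_PiM_eq_PiM[of UNIV "\<lambda>_. N" x] N.prob_space_axioms by (simp add: M)
  obtain B where B: "\<And>\<eta>. \<bar>u \<eta>\<bar> \<le> B"
    using u by (auto simp: bdd_measurable_def)
  have int: "integrable (N \<Otimes>\<^sub>M M) (\<lambda>(v, \<eta>). u (fun_upd \<eta> x v))"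
    using B measurable_compose[OF upd um]
    by (intro NM.integrable_const_bound[where B = B]) (auto simp: case_prod_beta)
  have "(\<integral>\<eta>. u \<eta> \<partial>M) = (\<integral>\<eta>. u \<eta> \<partial>distr (N \<Otimes>\<^sub>M M) M (\<lambda>(v, \<eta>). fun_upd \<eta> x v))"
    by (simp only: dist)
  also have "\<dots> = (\<integral>(v, \<eta>). u (fun_upd \<eta> x v) \<partial>(N \<Otimes>\<^sub>M M))"
    by (subst integral_distr[OF upd um]) (simp only: case_prod_unfold)
  also have "\<dots> = (\<integral>\<eta>. (\<integral>v. u (fun_upd \<eta> x v) \<partial>N) \<partial>M)"
    by (rule NM.integral_snd[OF int, symmetric])
  finally show ?thesis
    by (simp add: M_def N_def site_average_def)
qed

context spin_density
begin

text \<open>Resampling a spin preserves the product measure, and after averaging over all of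
  \<open>S\<close> the function is constant.\<close>

lemma integral_bernoulli_eq_avg:
  assumes S: "finite S" and u: "determined_on S u"
  shows "(\<integral>\<eta>. u \<eta> \<partial>bernoulli_product p) = avg p S u \<zeta>"
proof -
  have "(\<integral>\<eta>. avg p T u \<eta> \<partial>bernoulli_product p) = (\<integral>\<eta>. u \<eta> \<partial>bernoulli_product p)" if "finite T" for T
    using that
  proof (induction T rule: finite_induct)
    case (insert x T)
    have "bdd_measurable (avg p T u)"
      by (rule bdd_measurable_determined[OF _ avg_determined[OF insert.hyps(1) u]]) (use S in simp)
    then show ?case
      using insert by (simp add: avg_insert integral_site_average)
  qed simp
  from this[OF S] have "(\<integral>\<eta>. avg p S u \<eta> \<partial>bernoulli_product p) = (\<integral>\<eta>. u \<eta> \<partial>bernoulli_product p)" .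
  moreover have "avg p S u = (\<lambda>_. avg p S u \<zeta>)"
    using avg_determined[OF S u] by (auto intro: determined_onD)
  ultimately have "(\<integral>\<eta>. u \<eta> \<partial>bernoulli_product p) = (\<integral>\<eta>. avg p S u \<zeta> \<partial>bernoulli_product p)"
    by metis
  then show ?thesis
    using prob_space.prob_space[OF prob_space_bernoulli_product, of p] by simp
qed

text \<open>The configuration \<open>\<eta>\<close> itself carries weight at least
  \<open>min p (1 - p) ^ card S\<close> in the average. This is the price for passing to a single
  configuration.\<close>

lemma avg_ge_point:
  assumes "finite S" "\<And>\<eta>. 0 \<le> u \<eta>"
  shows "min p (1 - p) ^ card S * u \<eta> \<le> avg p S u \<eta>"
  using assms(1)
proof (induction S arbitrary: \<eta> rule: finite_induct)
  case (insert x S)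
  let ?r = "min p (1 - p)"
  have n: "0 \<le> avg p S u \<eta>" for \<eta>
    using insert assms by (intro avg_nonneg)
  have "?r ^ card (insert x S) * u \<eta> = ?r * (?r ^ card S * u \<eta>)"
    using insert by simp
  also have "\<dots> \<le> ?r * avg p S u \<eta>"
    using p0 p1 by (intro mult_left_mono insert.IH) auto
  also have "\<dots> \<le> p * avg p S u (\<eta>(x := True)) + (1 - p) * avg p S u (\<eta>(x := False))"
  proof (cases "\<eta> x")
    case True
    then have "?r * avg p S u \<eta> \<le> p * avg p S u (\<eta>(x := True))"
      by (simp add: fun_upd_idem mult_right_mono n)
    then show ?thesis
      using mult_nonneg_nonneg[OF _ n, of "1 - p" "\<eta>(x := False)"] p1 by simp
  next
    case False
    then have "?r * avg p S u \<eta> \<le> (1 - p) * avg p S u (\<eta>(x := False))"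
      by (simp add: fun_upd_idem mult_right_mono n)
    then show ?thesis
      using mult_nonneg_nonneg[OF p0 n, of "\<eta>(x := True)"] by simp
  qed
  finally show ?case
    using insert by (simp add: avg_insert site_avg)
qed simp

end

context east_semigroup
begin

lemma approx_class_pointwise:
  assumes u: "approx_class a w A u" and p: "0 < p" and n: "w \<le> n" and z: "\<not> \<eta> (a + int n)"
  shows "\<bar>u \<eta>\<bar> \<le> sqrt (A / min p (1 - p) ^ n)"
proof -
  define r where "r = min p (1 - p) ^ n"
  have r: "0 < r"
    using p p_less_1 by (simp add: r_def)
  have "\<bar>u \<eta>\<bar> \<le> sqrt ((A + \<epsilon>) / r) + \<epsilon>" if \<epsilon>: "0 < \<epsilon>" for \<epsilon>
  proof -
    obtain v where v: "second_moment_le a w v (A + \<epsilon>)" "\<bar>u \<eta> - v \<eta>\<bar> \<le> \<epsilon>"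
      using u \<epsilon> unfolding approx_class_def by blast
    have "r * (v \<eta>)\<^sup>2 \<le> avg p {a..<a + int n} (\<lambda>\<eta>. (v \<eta>)\<^sup>2) \<eta>"
      using avg_ge_point[of "{a..<a + int n}" "\<lambda>\<eta>. (v \<eta>)\<^sup>2" \<eta>] by (simp add: r_def)
    also have "\<dots> \<le> A + \<epsilon>"
      using v n z by (auto simp: second_moment_le_def)
    finally have "(v \<eta>)\<^sup>2 \<le> (A + \<epsilon>) / r"
      using r by (simp add: pos_le_divide_eq mult.commute)
    then have "\<bar>v \<eta>\<bar> \<le> sqrt ((A + \<epsilon>) / r)"
      using real_sqrt_le_mono by fastforce
    then show ?thesis
      using v(2) by linarith
  qed
  then have "\<forall>\<^sub>F \<epsilon> in at_right 0. \<bar>u \<eta>\<bar> \<le> sqrt ((A + \<epsilon>) / r) + \<epsilon>"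
    using eventually_at_right_less[of "0::real"] by (rule eventually_mono[rotated])
  moreover have "((\<lambda>\<epsilon>. sqrt ((A + \<epsilon>) / r) + \<epsilon>) \<longlongrightarrow> sqrt ((A + 0) / r) + 0) (at_right 0)"
    using r by (intro tendsto_intros) auto
  ultimately show ?thesis
    using tendsto_lowerbound[of _ _ "at_right 0" "\<bar>u \<eta>\<bar>"] unfolding r_def by fastforce
qed

lemma P_lincomb:
  assumes "0 \<le> t" "bdd_measurable u" "bdd_measurable v"
  shows "P t (\<lambda>\<eta>. b * u \<eta> + c * v \<eta> + d) \<eta> = b * P t u \<eta> + c * P t v \<eta> + d"
proof -
  interpret prob_space "K t \<eta>"
    by (rule prob_space_K[OF assms(1)])
  show ?thesis
    using assms integrable_K[of t u \<eta>] integrable_K[of t v \<eta>] prob_space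
    by (simp add: transition_op_def)
qed

text \<open>Gronwall for the expectation from one fixed \<open>\<eta>\<close>. The source term
  \<open>w\<close> has to be harmless only along this trajectory, hence the assumption on
  \<open>P s w \<eta>\<close> and the one-element index set for \<open>euler_bound\<close>.\<close>

lemma P_lyapunov:
  assumes v: "finite S" "determined_on S v" and w: "bdd_measurable w"
    and Lv: "\<And>\<zeta>. east_generator p v \<zeta> \<le> - \<kappa> * v \<zeta> + w \<zeta>"
    and Pw: "\<And>s. 0 \<le> s \<Longrightarrow> P s w \<eta> \<le> 0"
    and \<kappa>: "0 \<le> \<kappa>" and A: "v \<eta> \<le> A" "0 \<le> A" and t: "0 \<le> t"
  shows "P t v \<eta> \<le> exp (- \<kappa> * t) * A"
proof -
  have bv: "bdd_measurable v"
    by (rule bdd_measurable_determined[OF v])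
  have "P t v \<eta> \<le> exp (- \<kappa> * t) * A + t * \<delta>" if \<delta>: "0 < \<delta>" for \<delta>
  proof -
    obtain b where b: "0 < b" "\<And>h \<zeta>. 0 < h \<Longrightarrow> h < b \<Longrightarrow> \<bar>P h v \<zeta> - v \<zeta> - h * east_generator p v \<zeta>\<bar> \<le> h * \<delta>"
      using P_euler[OF v \<delta>] unfolding eventually_at_right_field by blast
    have "\<kappa> + 1 > 0"
      using \<kappa> by simp
    show ?thesis
    proof (rule euler_bound[where I = UNIV and \<phi> = "\<lambda>s (_::unit). P s v \<eta>" and C = 0
          and \<delta> = "min (b / 2) (1 / (\<kappa> + 1))"])
      show "P 0 v \<eta> \<le> A"
        using A by (simp add: P_0[OF bv])
      fix s h A'
      assume s: "0 \<le> s" and h: "0 < h" "h \<le> min (b / 2) (1 / (\<kappa> + 1))" and IH: "\<And>i::unit. i \<in> UNIV \<Longrightarrow> P s v \<eta> \<le> A'"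
      have "h * (\<kappa> + 1) \<le> 1"
        using h \<open>\<kappa> + 1 > 0\<close> by (simp add: pos_le_divide_eq)
      then have h\<kappa>: "\<kappa> * h \<le> 1"
        using h by (simp add: algebra_simps)
      have "P h v \<zeta> \<le> (1 - \<kappa> * h) * v \<zeta> + h * w \<zeta> + h * \<delta>" for \<zeta>
      proof -
        have "h * east_generator p v \<zeta> \<le> h * (- \<kappa> * v \<zeta> + w \<zeta>)"
          using h by (intro mult_left_mono Lv) auto
        moreover have "\<bar>P h v \<zeta> - v \<zeta> - h * east_generator p v \<zeta>\<bar> \<le> h * \<delta>"
          using h b by (intro b(2)) auto
        ultimately show ?thesis
          by (simp add: algebra_simps)
      qed
      then have "P s (P h v) \<eta> \<le> P s (\<lambda>\<zeta>. (1 - \<kappa> * h) * v \<zeta> + h * w \<zeta> + h * \<delta>) \<eta>"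
        using s h bv w by (intro P_mono bdd_measurable_P bdd_measurable_lincomb) auto
      also have "\<dots> = (1 - \<kappa> * h) * P s v \<eta> + h * P s w \<eta> + h * \<delta>"
        by (rule P_lincomb[OF s bv w])
      also have "\<dots> \<le> (1 - \<kappa> * h) * A' + h * 0 + h * \<delta>"
        using IH h h\<kappa> by (intro add_mono mult_left_mono Pw s) auto
      finally show "P (s + h) v \<eta> \<le> (1 - \<kappa> * h) * A' + h * \<delta> + h\<^sup>2 * 0"
        using P_add[of s h v] s h bv by simp
    qed (use b \<kappa> A t \<delta> in auto)
  qed
  note * = this
  show ?thesis
  proof (rule field_le_epsilon)
    fix \<epsilon> :: real assume \<epsilon>: "0 < \<epsilon>"
    have "t * (\<epsilon> / (t + 1)) \<le> \<epsilon>"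
      using t \<epsilon> by (simp add: field_simps)
    then show "P t v \<eta> \<le> exp (- \<kappa> * t) * A + \<epsilon>"
      using *[of "\<epsilon> / (t + 1)"] t \<epsilon> by (simp add: divide_pos_pos)
  qed
qed

text \<open>At \<open>p = 0\<close> the invariant measure is a point mass and has no density bound, so the decay is
  obtained from a Lyapunov function instead: zeros persist, and the geometric weights make the
  rightmost occupied site of each block dominate the sum over the block.\<close>

lemma P_decay_zero_density:
  assumes p: "p = 0" and f: "determined_on {a..<a + int w} f" and B: "\<And>\<eta>. \<bar>f \<eta>\<bar> \<le> B"
    and n: "w \<le> n" and z: "\<not> \<eta> (a + int n)" and t: "0 \<le> t"
  shows "\<bar>P t f \<eta> - (\<integral>\<omega>. f \<omega> \<partial>bernoulli_product p)\<bar> \<le> 2 * B * 4 ^ n * exp (- (1 / 2) * t)"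
proof -
  define z where "z = a + int n"
  define \<xi> :: "int \<Rightarrow> config \<Rightarrow> real" where "\<xi> x \<eta> = of_bool (\<eta> x)" for x \<eta>
  \<comment> \<open>With ratio 1/2, shifting the sum by one site costs a factor 1/2 and a boundary
    term at \<open>z\<close>, which yields the rate 1/2.\<close>
  define H where "H \<eta> = (\<Sum>j<n. (1 / 2) ^ j * \<xi> (z - 1 - int j) \<eta>)" for \<eta>
  define c where "c = (\<integral>\<omega>. f \<omega> \<partial>bernoulli_product p)"
  have B0: "0 \<le> B"
    using B[of undefined] by linarith
  have det\<xi>: "determined_on A (\<xi> x)" if "x \<in> A" for A x
    using that by (auto simp: \<xi>_def determined_on_def)
  have detH: "determined_on {a..<z} H"
    unfolding H_def[abs_def]
    by (intro determined_on_sum determined_on_map2[where F = "\<lambda>x y. x * y"] determined_on_const det\<xi>) (auto simp: z_def)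
  have b\<xi>: "bdd_measurable (\<xi> x)" for x
    by (rule bdd_measurable_determined[of "{x}"]) (auto intro: det\<xi>)
  have L\<xi>: "east_generator p (\<xi> x) \<eta> = - ((1 - \<xi> (x + 1) \<eta>) * \<xi> x \<eta>)" for x \<eta>
  proof -
    have "east_generator p (\<xi> x) \<eta> = east_term x (\<xi> x) \<eta>"
      by (subst east_generator_sum[of "{x}"]) (auto intro: det\<xi>)
    also have "\<dots> = - ((1 - \<xi> (x + 1) \<eta>) * \<xi> x \<eta>)"
      unfolding east_term_def site_avg by (auto simp: \<xi>_def p)
    finally show ?thesis .
  qed
  \<comment> \<open>At density 0 an update can only create zeros, so the indicator of an occupied
    spin is its own Lyapunov function, with rate 0 and initial value 0 at \<open>z\<close>.\<close>
  have "P s (\<xi> z) \<eta> \<le> exp (- 0 * s) * 0" if "0 \<le> s" for s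
    by (rule P_lyapunov[where S = "{z}" and w = "\<lambda>_. 0"])
       (use that assms(5) in \<open>auto simp: L\<xi> P_const bdd_measurable_const intro: det\<xi>, auto simp: \<xi>_def z_def\<close>)
  then have P\<xi>: "P s (\<xi> z) \<eta> \<le> 0" if "0 \<le> s" for s
    using that by simp
  have LH: "east_generator p H \<zeta> \<le> - (1 / 2) * H \<zeta> + \<xi> z \<zeta>" for \<zeta>
  proof -
    have "east_generator p H \<zeta> = (\<Sum>j<n. (1 / 2) ^ j * east_generator p (\<xi> (z - 1 - int j)) \<zeta>)"
      unfolding H_def[abs_def] by (rule east_generator_linear[of "{a..<z}"]) (auto intro: det\<xi> simp: z_def)
    also have "\<dots> \<le> (\<Sum>j<n. (1 / 2) ^ j * (\<xi> (z - int j) \<zeta> - \<xi> (z - 1 - int j) \<zeta>))"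
      by (intro sum_mono mult_left_mono) (auto simp: L\<xi> \<xi>_def)
    also have "\<dots> = (\<Sum>j<n. (1 / 2) ^ j * \<xi> (z - int j) \<zeta>) - H \<zeta>"
      by (simp add: H_def right_diff_distrib sum_subtractf)
    also have "(\<Sum>j<n. (1 / 2) ^ j * \<xi> (z - int j) \<zeta>) \<le> \<xi> z \<zeta> + 1 / 2 * H \<zeta>"
    proof (cases n)
      case (Suc m)
      have "(\<Sum>j<n. (1 / 2) ^ j * \<xi> (z - int j) \<zeta>) = \<xi> z \<zeta> + 1 / 2 * (\<Sum>j<m. (1 / 2) ^ j * \<xi> (z - 1 - int j) \<zeta>)"
        unfolding Suc by (subst sum.lessThan_Suc_shift) (simp add: sum_distrib_left algebra_simps)
      also have "\<dots> \<le> \<xi> z \<zeta> + 1 / 2 * H \<zeta>"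
        unfolding H_def Suc by (simp add: \<xi>_def)
      finally show ?thesis .
    qed (simp add: H_def \<xi>_def)
    finally show ?thesis
      by simp
  qed
  have "H \<eta> \<le> (\<Sum>j<n. 1)"
    unfolding H_def by (intro sum_mono mult_le_one power_le_one) (auto simp: \<xi>_def)
  also have "\<dots> \<le> 2 ^ n"
    using of_nat_less_two_power[of n, where 'a = real] by simp
  finally have PH: "P t H \<eta> \<le> exp (- (1 / 2) * t) * 2 ^ n"
    by (intro P_lyapunov[OF _ detH b\<xi> LH P\<xi>] t) auto
  have bH: "bdd_measurable H" and bf: "bdd_measurable f"
    by (rule bdd_measurable_determined[OF _ detH] bdd_measurable_determined[OF _ f]; simp)+
  have c: "c = f (\<lambda>_. False)"
  proof -
    have "avg p S f (\<lambda>_. False) = f (\<lambda>_. False)" if "finite S" for S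
      using that
    proof (induction rule: finite_induct)
      case (insert x S)
      have "p * b + (1 - p) * b' = b'" for b b'
        using p by simp
      then show ?case
        using insert by (simp add: avg_insert site_avg fun_upd_idem)
    qed simp
    then show ?thesis
      unfolding c_def by (subst integral_bernoulli_eq_avg[OF _ f, of "\<lambda>_. False"]) simp_all
  qed
  \<comment> \<open>One occupied site in the block forces \<open>H \<ge> (1 / 2) ^ n\<close>; with
    none, \<open>f\<close> takes its all-zero value \<open>c\<close>. Together with the bound on
    \<open>PH\<close> this gives \<open>4 ^ n\<close>.\<close>
  have fH: "\<bar>f \<zeta> - c\<bar> \<le> 2 * B * 2 ^ n * H \<zeta>" for \<zeta>
  proof (cases "\<exists>j<n. \<zeta> (z - 1 - int j)")
    case True
    then obtain j where j: "j < n" "\<zeta> (z - 1 - int j)"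
      by blast
    have "(1 / 2) ^ n \<le> (1 / 2 :: real) ^ j"
      using j by (intro power_decreasing) auto
    also have "\<dots> = (1 / 2) ^ j * \<xi> (z - 1 - int j) \<zeta>"
      using j by (simp add: \<xi>_def)
    also have "\<dots> \<le> H \<zeta>"
      unfolding H_def using j by (intro member_le_sum) (auto simp: \<xi>_def)
    finally have "1 \<le> 2 ^ n * H \<zeta>"
      by (simp add: power_one_over field_simps)
    from mult_left_mono[OF this, of "2 * B"] B0 have "2 * B \<le> 2 * B * 2 ^ n * H \<zeta>"
      by (simp add: mult.assoc)
    moreover have "\<bar>f \<zeta> - c\<bar> \<le> 2 * B"
      using B[of \<zeta>] B[of "\<lambda>_. False"] unfolding c by linarith
    ultimately show ?thesis
      by linarith
  next
    case False
    have "f \<zeta> = c"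
      unfolding c
    proof (rule determined_onD[OF f])
      fix x assume x: "x \<in> {a..<a + int w}"
      define j where "j = nat (z - 1 - x)"
      have "j < n" "x = z - 1 - int j"
        using x n by (auto simp: j_def z_def)
      with False show "\<zeta> x = False"
        by auto
    qed
    moreover have "0 \<le> H \<zeta>"
      unfolding H_def by (intro sum_nonneg) (simp add: \<xi>_def)
    ultimately show ?thesis
      using B0 by simp
  qed
  have "P t f \<eta> \<le> P t (\<lambda>\<zeta>. (2 * B * 2 ^ n) * H \<zeta> + 0 * H \<zeta> + c) \<eta>"
    using fH by (intro P_mono t bf bdd_measurable_lincomb bH) (smt (verit) mult_zero_left)
  moreover have "P t (\<lambda>\<zeta>. (- (2 * B * 2 ^ n)) * H \<zeta> + 0 * H \<zeta> + c) \<eta> \<le> P t f \<eta>"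
    using fH by (intro P_mono t bf bdd_measurable_lincomb bH) (smt (verit) mult_zero_left mult_minus_left)
  ultimately have "\<bar>P t f \<eta> - c\<bar> \<le> (2 * B * 2 ^ n) * P t H \<eta>"
    unfolding P_lincomb[OF t bH bH] by (simp add: abs_le_iff)
  also have "\<dots> \<le> (2 * B * 2 ^ n) * (exp (- (1 / 2) * t) * 2 ^ n)"
    using B0 by (intro mult_left_mono PH) auto
  also have "\<dots> = 2 * B * (2 ^ n * 2 ^ n) * exp (- (1 / 2) * t)"
    by simp
  also have "(2 ^ n * 2 ^ n :: real) = 4 ^ n"
    by (simp flip: power_mult_distrib)
  finally show ?thesis
    by (simp add: c_def)
qed

text \<open>The centred function is its own local approximant with second moment at most
  \<open>(2 * B)\<^sup>2\<close>. The square root in \<open>approx_class_pointwise\<close> halves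
  the rate \<open>2 / C\<close> and turns the density bound into
  \<open>1 / sqrt (min p (1 - p))\<close> per site.\<close>

lemma P_decay_positive_density:
  assumes p: "0 < p" and pc: "poincare_constant C"
    and f: "determined_on {a..<a + int w} f" and B: "\<And>\<eta>. \<bar>f \<eta>\<bar> \<le> B"
    and n: "w \<le> n" and z: "\<not> \<eta> (a + int n)" and t: "0 \<le> t"
  shows "\<bar>P t f \<eta> - (\<integral>\<omega>. f \<omega> \<partial>bernoulli_product p)\<bar>
    \<le> 2 * B * (1 / sqrt (min p (1 - p))) ^ n * exp (- (1 / C) * t)"
proof -
  define c where "c = (\<integral>\<omega>. f \<omega> \<partial>bernoulli_product p)"
  define u where "u \<eta> = f \<eta> - c" for \<eta>
  have B0: "0 \<le> B"
    using B[of undefined] by linarith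
  have bf: "bdd_measurable f"
    by (rule bdd_measurable_determined[OF _ f]) simp
  have c: "avg p {a..<a + int m} f \<zeta> = c" if "w \<le> m" for m \<zeta>
    unfolding c_def using that
    by (intro integral_bernoulli_eq_avg[symmetric] determined_on_mono[OF f]) auto
  have "\<bar>c\<bar> \<le> B"
  proof -
    have "avg p {a..<a + int w} f undefined \<le> B" "avg p {a..<a + int w} (\<lambda>\<eta>. (-1) * f \<eta>) undefined \<le> B"
      using B by (intro avg_le_const; auto simp: abs_le_iff)+
    then show ?thesis
      unfolding avg_cmult[OF finite_atLeastLessThan_int] c[OF order_refl] by (simp add: abs_le_iff)
  qed
  then have u2: "(u \<zeta>)\<^sup>2 \<le> (2 * B)\<^sup>2" for \<zeta>
    using B[of \<zeta>] B0 unfolding u_def by (intro abs_le_square_iff[THEN iffD1]) linarith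
  have "approx_class a w ((2 * B)\<^sup>2) u"
    unfolding approx_class_def
  proof (intro conjI allI impI exI)
    show "bdd_measurable u"
      unfolding u_def[abs_def] by (intro bdd_measurable_diff bf bdd_measurable_const)
    show "determined_on {a..<a + int w} u"
      unfolding u_def[abs_def] by (intro determined_on_map2[OF f determined_on_const])
    show "zero_mean a w u"
      unfolding u_def[abs_def] zero_mean_def by (simp add: avg_diff avg_const c)
    fix \<epsilon> :: real assume "0 < \<epsilon>"
    then show "second_moment_le a w u ((2 * B)\<^sup>2 + \<epsilon>)"
      unfolding second_moment_le_def
      by (intro allI impI avg_le_const) (auto intro: order_trans[OF u2])
    show "\<bar>u \<eta> - u \<eta>\<bar> \<le> \<epsilon>" for \<eta>
      using \<open>0 < \<epsilon>\<close> by simp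
  qed simp
  from approx_class_pointwise[of a w _ "P t u" n \<eta>, OF approx_class_semigroup[OF pc this t] p n z]
  have "\<bar>P t u \<eta>\<bar> \<le> sqrt (exp (- (2 / C) * t) * (2 * B)\<^sup>2 / min p (1 - p) ^ n)" .
  also have "exp (- (2 / C) * t) = (exp (- (1 / C) * t))\<^sup>2"
    by (simp flip: exp_double)
  also have "sqrt ((exp (- (1 / C) * t))\<^sup>2 * (2 * B)\<^sup>2 / min p (1 - p) ^ n)
      = exp (- (1 / C) * t) * (2 * B) / sqrt (min p (1 - p)) ^ n"
    using B0 by (simp add: real_sqrt_divide real_sqrt_mult real_sqrt_power)
  also have "\<dots> = 2 * B * (1 / sqrt (min p (1 - p))) ^ n * exp (- (1 / C) * t)"
    by (simp add: power_one_over field_simps)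
  also have "P t u \<eta> = P t f \<eta> - c"
    unfolding u_def[abs_def] by (simp add: P_diff t bf bdd_measurable_const P_const)
  finally show ?thesis
    by (simp add: c_def)
qed

text \<open>Both density regimes in one form. \<open>g\<close> and \<open>R\<close> are chosen
  before \<open>f\<close>, which lets the final rate be independent of the local function.\<close>

lemma P_decay:
  "\<exists>g>0. \<exists>R\<ge>1. \<forall>a w f B. determined_on {a..<a + int w} f \<longrightarrow> (\<forall>\<eta>. \<bar>f \<eta>\<bar> \<le> B) \<longrightarrow>
     (\<forall>n\<ge>w. \<forall>\<eta>. \<not> \<eta> (a + int n) \<longrightarrow> (\<forall>t\<ge>0.
        \<bar>P t f \<eta> - (\<integral>\<omega>. f \<omega> \<partial>bernoulli_product p)\<bar> \<le> 2 * B * R ^ n * exp (- g * t)))"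
proof (cases "p = 0")
  case True
  then show ?thesis
    by (intro exI[of _ "1 / 2"] exI[of _ 4] conjI allI impI P_decay_zero_density) auto
next
  case False
  then have p: "0 < p"
    using p0 by simp
  obtain C where C: "poincare_constant C"
    using poincare_inequality by blast
  then have "0 < 1 / C"
    by (simp add: poincare_constant_def)
  moreover have "1 \<le> 1 / sqrt (min p (1 - p))"
    using p p_less_1 by simp
  ultimately show ?thesis
    using P_decay_positive_density[OF p C] by blast
qed

end

section \<open>From the process to the semigroup, and zeros under the initial law\<close>

text \<open>The Markov property at time \<open>s = 0\<close> together with \<open>X 0 = x\<close>
  almost surely makes the conditional probability the constant \<open>measure (K t x) B\<close>;
  integrating it gives the law.\<close>

lemma markov_process_law:
  assumes mp: "markov_process S K Pr X" and x: "x \<in> space S" and t: "0 \<le> t"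
  shows "distr (Pr x) S (X t) = K t x"
proof -
  have tf: "transition_function S K" and ps: "prob_space (Pr x)"
    and X: "\<And>t. 0 \<le> t \<Longrightarrow> X t \<in> Pr x \<rightarrow>\<^sub>M S" and X0: "AE w in Pr x. X 0 w = x"
    and ce: "\<And>B. B \<in> sets S \<Longrightarrow> AE w in Pr x.
        real_cond_exp (Pr x) (natural_filtration (Pr x) S X 0) (\<lambda>w. indicator B (X (0 + t) w)) w
          = measure (K t (X 0 w)) B"
    using mp x t unfolding markov_process_def by blast+
  interpret prob_space "Pr x"
    by (rule ps)
  define F where "F = natural_filtration (Pr x) S X 0"
  have gen: "{X u -` B \<inter> space (Pr x) | u B. 0 \<le> u \<and> u \<le> 0 \<and> B \<in> sets S} \<subseteq> sets (Pr x)"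
    using measurable_sets[OF X] by auto
  have "subalgebra (Pr x) F"
    unfolding subalgebra_def
  proof
    show "space F = space (Pr x)"
      by (simp add: F_def natural_filtration_def space_measure_of_conv)
    have "{X u -` B \<inter> space (Pr x) | u B. 0 \<le> u \<and> u \<le> 0 \<and> B \<in> sets S} \<subseteq> Pow (space (Pr x))"
      by auto
    then show "sets F \<subseteq> sets (Pr x)"
      unfolding F_def natural_filtration_def using sets.sigma_sets_subset[OF gen] by simp
  qed
  then interpret finite_measure_subalgebra "Pr x" F
    by unfold_locales
  have K: "sets (K t x) = sets S" "prob_space (K t x)"
    using measurable_space[of "K t" S "prob_algebra S" x] tf t x
    by (auto simp: transition_function_def space_prob_algebra)
  interpret Kx: prob_space "K t x"
    by (rule K(2))
  interpret D: prob_space "distr (Pr x) S (X t)"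
    by (rule prob_space_distr[OF X[OF t]])
  show ?thesis
  proof (rule measure_eqI)
    fix B assume "B \<in> sets (distr (Pr x) S (X t))"
    then have B: "B \<in> sets S"
      by simp
    have int: "integrable (Pr x) (\<lambda>w. indicator B (X t w) :: real)"
      using X[OF t] B by (intro integrable_const_bound[where B = 1]) (auto simp: indicator_def)
    have "measure (distr (Pr x) S (X t)) B = (\<integral>w. indicator B (X t w) \<partial>Pr x)"
    proof -
      have "(\<integral>w. indicator B (X t w) \<partial>Pr x) = (\<integral>y. (indicator B y :: real) \<partial>distr (Pr x) S (X t))"
        using X[OF t] B by (subst integral_distr) auto
      then show ?thesis
        using B by simp
    qed
    also have "\<dots> = (\<integral>w. real_cond_exp (Pr x) F (\<lambda>w. indicator B (X t w)) w \<partial>Pr x)"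
      by (rule real_cond_exp_int(2)[OF int, symmetric])
    also have "\<dots> = (\<integral>w. measure (K t x) B \<partial>Pr x)"
    proof (rule integral_cong_AE)
      show "AE w in Pr x. real_cond_exp (Pr x) F (\<lambda>w. indicator B (X t w)) w = measure (K t x) B"
        using ce[OF B] X0 unfolding F_def by eventually_elim simp
    qed auto
    also have "\<dots> = measure (K t x) B"
      by (simp add: prob_space)
    finally show "emeasure (distr (Pr x) S (X t)) B = emeasure (K t x) B"
      by (simp add: D.emeasure_eq_measure Kx.emeasure_eq_measure)
  qed (simp add: K)
qed

lemma integral_of_bool_all_True:
  assumes "0 \<le> p" "p < 1" "finite S"
  shows "(\<integral>\<eta>. of_bool (\<forall>y\<in>S. \<eta> y) \<partial>bernoulli_product p) = p ^ card S"
proof -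
  interpret spin_density p
    using assms by unfold_locales
  have "determined_on S (\<lambda>\<eta>. of_bool (\<forall>y\<in>S. \<eta> y))"
    by (auto simp: determined_on_def)
  then show ?thesis
    using integral_bernoulli_eq_avg[OF assms(3)] avg_all_True[OF assms(3)] by metis
qed

lemma AE_bernoulli_exists_zero:
  fixes b :: int
  assumes p: "0 \<le> p" "p < 1"
  shows "AE \<eta> in bernoulli_product p. \<exists>j::nat. \<not> \<eta> (b + int j)"
proof -
  interpret prob_space "bernoulli_product p"
    by (rule prob_space_bernoulli_product)
  define N where "N = {\<eta> :: config. \<forall>j::nat. \<eta> (b + int j)}"
  have N: "N \<in> sets (bernoulli_product p)"
  proof -
    have "(\<lambda>\<eta>. \<eta> x) \<in> config_space \<rightarrow>\<^sub>M count_space UNIV" for x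
      unfolding config_space_def by (rule measurable_component_singleton) simp
    then have "{\<eta> \<in> space config_space. \<forall>j::nat. \<eta> (b + int j)} \<in> sets config_space"
      by measurable
    then show ?thesis
      by (simp add: N_def sets_bernoulli_product)
  qed
  have le: "prob N \<le> p ^ k" for k
  proof -
    let ?S = "{b..<b + int k}"
    have bm: "bdd_measurable (\<lambda>\<eta>. of_bool (\<forall>y\<in>?S. \<eta> y))"
      by (rule bdd_measurable_determined[of ?S]) (auto simp: determined_on_def)
    have "prob N = (\<integral>\<eta>. indicator N \<eta> \<partial>bernoulli_product p)"
      using N by simp
    also have "\<dots> \<le> (\<integral>\<eta>. of_bool (\<forall>y\<in>?S. \<eta> y) \<partial>bernoulli_product p)"
    proof (rule integral_mono'[OF integrable_bernoulli_product[OF bm]])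
      fix \<eta>
      show "indicator N \<eta> \<le> (of_bool (\<forall>y\<in>?S. \<eta> y) :: real)"
      proof (cases "\<eta> \<in> N")
        case True
        have "\<eta> y" if "y \<in> ?S" for y
        proof -
          have "\<eta> (b + int (nat (y - b)))"
            using True unfolding N_def by blast
          moreover have "b + int (nat (y - b)) = y"
            using that by simp
          ultimately show ?thesis
            by (simp only:)
        qed
        then show ?thesis
          by simp
      qed simp
    qed simp
    also have "\<dots> = p ^ k"
      using integral_of_bool_all_True[OF p, of ?S] by simp
    finally show ?thesis .
  qed
  have "(\<lambda>k. p ^ k) \<longlonglongrightarrow> 0"
    using p by (intro LIMSEQ_power_zero) simp
  then have "prob N \<le> 0"
    using le by (intro LIMSEQ_le_const) auto
  then have "emeasure (bernoulli_product p) N = 0"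
    by (simp add: emeasure_eq_measure measure_le_0_iff)
  then show ?thesis
    using N by (intro AE_I[where N = N]) (auto simp: N_def)
qed

lemma finite_subset_interval:
  fixes A :: "int set"
  assumes "finite A"
  obtains a w where "A \<subseteq> {a..<a + int w}"
proof
  show "A \<subseteq> {Min (insert 0 A)..<Min (insert 0 A) + int (nat (Max (insert 0 A) - Min (insert 0 A) + 1))}"
  proof
    fix x assume "x \<in> A"
    with assms have "Min (insert 0 A) \<le> x" "x \<le> Max (insert 0 A)"
      by auto
    then show "x \<in> {Min (insert 0 A)..<Min (insert 0 A) + int (nat (Max (insert 0 A) - Min (insert 0 A) + 1))}"
      by simp
  qed
qed

context east_semigroup
begin

text \<open>The crude estimate for initial configurations without a zero in the search
  window.\<close>

lemma P_deviation_bound: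
  assumes f: "finite A" "determined_on A f" and B: "\<And>\<eta>. \<bar>f \<eta>\<bar> \<le> B" and t: "0 \<le> t"
  shows "\<bar>P t f \<eta> - (\<integral>\<omega>. f \<omega> \<partial>bernoulli_product p)\<bar> \<le> 2 * B"
proof -
  have bf: "bdd_measurable f"
    by (rule bdd_measurable_determined[OF f])
  have "\<bar>P t f \<eta>\<bar> \<le> B"
    using P_contraction[OF t bf bdd_measurable_const[of 0], of B \<eta>] B by (simp add: P_const t)
  moreover have "\<bar>\<integral>\<omega>. f \<omega> \<partial>bernoulli_product p\<bar> \<le> B"
  proof -
    interpret M: prob_space "bernoulli_product p"
      by (rule prob_space_bernoulli_product)
    have "- B \<le> f \<eta>" "f \<eta> \<le> B" for \<eta>
      using B[of \<eta>] by linarith+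
    then show ?thesis
      using M.integral_le_const[OF integrable_bernoulli_product[OF bf], of B]
        M.integral_ge_const[OF integrable_bernoulli_product[OF bf], of "- B"] by (simp add: abs_le_iff)
  qed
  ultimately show ?thesis
    by linarith
qed

end

theorem theorem3p2:
  fixes p p' :: real
    and P :: "config \<Rightarrow> 's measure" and X :: "real \<Rightarrow> 's \<Rightarrow> config"
  assumes "0 \<le> p" and "p < 1" and "0 < p'" and "p' < 1"
    and "east_process p P X"
  shows "\<exists>m>0. \<forall>f. local_fun f \<longrightarrow> (\<exists>C::real.
           (\<forall>t>0. (\<integral>\<eta>. \<bar>(\<integral>w. f (X t w) \<partial>P \<eta>) - (\<integral>\<omega>. f \<omega> \<partial>bernoulli_product p)\<bar>
                       \<partial>bernoulli_product p') \<le> C * exp (- m * t)) \<and>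
           (AE \<eta> in bernoulli_product p'. \<exists>t0\<ge>0. \<forall>t>t0.
              \<bar>(\<integral>w. f (X t w) \<partial>P \<eta>) - (\<integral>\<omega>. f \<omega> \<partial>bernoulli_product p)\<bar> \<le> C * exp (- m * t)))"
proof -
  obtain K where feller: "feller config_space K"
    and gen: "\<forall>f. local_fun f \<longrightarrow> has_generator_value K f (east_generator p f)"
    and mp: "markov_process config_space K P X"
    using assms(5) unfolding east_process_def by (elim exE conjE)
  have tf: "transition_function config_space K"
    using feller unfolding feller_def by (rule conjunct1)
  interpret E: east_semigroup p K
    by unfold_locales (fact assms(1) assms(2) tf gen[rule_format])+
  obtain g R where g: "0 < g" and R: "1 \<le> R" and decay:
    "\<And>a w f B n \<eta> t. determined_on {a..<a + int w} f \<Longrightarrow> (\<And>\<eta>. \<bar>f \<eta>\<bar> \<le> B) \<Longrightarrow> w \<le> n \<Longrightarrow> \<not> \<eta> (a + int n) \<Longrightarrow> 0 \<le> t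
      \<Longrightarrow> \<bar>E.P t f \<eta> - (\<integral>\<omega>. f \<omega> \<partial>bernoulli_product p)\<bar> \<le> 2 * B * R ^ n * exp (- g * t)"
    using E.P_decay by metis
  \<comment> \<open>The search for a zero extends over \<open>d * t\<close> sites, with \<open>d\<close> small enough that the factor
    \<open>R\<close> per site costs at most half of the rate \<open>g\<close>.\<close>
  define d where "d = g / (2 * (ln R + 1))"
  have lnR: "0 \<le> ln R"
    using R by simp
  have d: "0 < d" "d * ln R \<le> g / 2"
    using g lnR by (auto simp: d_def field_simps)
  \<comment> \<open>\<open>g / 2\<close> is what remains of the rate after the cost of the search;
    \<open>d * ln (1 / p')\<close> is the exponential rate at which a window of \<open>d * t\<close>
    sites is fully occupied under the initial law.\<close>
  define m where "m = min (g / 2) (d * ln (1 / p'))"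
  have m: "0 < m" "m \<le> g / 2" "m \<le> d * ln (1 / p')"
    using g d assms(3,4) by (auto simp: m_def)
  show ?thesis
  proof (rule exI[of _ m], intro conjI allI impI)
    show "0 < m"
      by (rule m(1))
    fix f assume "local_fun f"
    then obtain A where "finite A" "determined_on A f"
      unfolding local_fun_def determined_on_def by blast
    then obtain a w where f: "determined_on {a..<a + int w} f"
      by (metis finite_subset_interval determined_on_mono)
    obtain B where B: "0 \<le> B" "\<And>\<eta>. \<bar>f \<eta>\<bar> \<le> B"
      using determined_on_finite_bounded[OF _ f] by auto
    \<comment> \<open>The factor \<open>1 / p'\<close> pays for rounding \<open>d * t\<close> down
      to an integer, and \<open>R ^ w\<close> for the sites of the support of
      \<open>f\<close>.\<close>
    define C where "C = 2 * B / p' + 2 * B * R ^ w"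
    define D where "D t \<eta> = \<bar>(\<integral>w. f (X t w) \<partial>P \<eta>) - (\<integral>\<omega>. f \<omega> \<partial>bernoulli_product p)\<bar>" for t \<eta>
    have DP: "D t \<eta> = \<bar>E.P t f \<eta> - (\<integral>\<omega>. f \<omega> \<partial>bernoulli_product p)\<bar>" if "0 \<le> t" for t \<eta>
    proof -
      have "X t \<in> P \<eta> \<rightarrow>\<^sub>M config_space"
        using mp that by (simp add: markov_process_def)
      moreover have "f \<in> borel_measurable config_space"
        by (rule determined_on_finite_measurable[OF _ f]) simp
      ultimately have "(\<integral>w. f (X t w) \<partial>P \<eta>) = (\<integral>\<omega>. f \<omega> \<partial>distr (P \<eta>) config_space (X t))"
        by (simp add: integral_distr)
      then show ?thesis
        using markov_process_law[OF mp _ that, of \<eta>] by (simp add: D_def transition_op_def)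
    qed
    have D1: "D t \<eta> \<le> 2 * B * R ^ n * exp (- g * t)" if "0 \<le> t" "w \<le> n" "\<not> \<eta> (a + int n)" for t \<eta> n
      unfolding DP[OF that(1)] by (rule decay[where a = a and w = w]) (fact f B(2) that)+
    have D2: "D t \<eta> \<le> 2 * B" if "0 \<le> t" for t \<eta>
      unfolding DP[OF that] by (rule E.P_deviation_bound[where A = "{a..<a + int w}"]) (fact f B(2) that finite_atLeastLessThan_int)+
    have part_a: "(\<integral>\<eta>. D t \<eta> \<partial>bernoulli_product p') \<le> C * exp (- m * t)" if t: "0 < t" for t
    proof -
      interpret N: prob_space "bernoulli_product p'"
        by (rule prob_space_bernoulli_product)
      define k where "k = nat \<lfloor>d * t\<rfloor>"
      have k: "real k \<le> d * t" "d * t - 1 \<le> real k"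
        using d t by (auto simp: k_def of_nat_nat)
      define S where "S = {a + int w..<a + int w + int k}"
      have bm: "bdd_measurable (\<lambda>\<eta>. of_bool (\<forall>y\<in>S. \<eta> y))"
        by (rule bdd_measurable_determined[of S]) (auto simp: determined_on_def S_def)
      note int = integrable_bernoulli_product[OF bm, of p']
      have le: "D t \<eta> \<le> 2 * B * of_bool (\<forall>y\<in>S. \<eta> y) + 2 * B * R ^ (w + k) * exp (- g * t)" for \<eta>
      proof (cases "\<forall>y\<in>S. \<eta> y")
        case True
        then show ?thesis
          using D2[of t \<eta>] t B(1) R by (simp add: add_increasing2)
      next
        case False
        then obtain y where y: "y \<in> S" "\<not> \<eta> y"
          by blast
        define n where "n = nat (y - a)"
        have n: "w \<le> n" "n \<le> w + k" "\<not> \<eta> (a + int n)"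
          using y by (auto simp: n_def S_def)
        have "D t \<eta> \<le> 2 * B * R ^ n * exp (- g * t)"
          using n t by (intro D1) auto
        also have "\<dots> \<le> 2 * B * R ^ (w + k) * exp (- g * t)"
          using n R B(1) by (intro mult_right_mono mult_left_mono power_increasing) auto
        finally show ?thesis
          using False by auto
      qed
      have "(\<integral>\<eta>. D t \<eta> \<partial>bernoulli_product p')
          \<le> (\<integral>\<eta>. 2 * B * of_bool (\<forall>y\<in>S. \<eta> y) + 2 * B * R ^ (w + k) * exp (- g * t) \<partial>bernoulli_product p')"
        using int B(1) R le
        \<comment> \<open>This form of monotonicity asks for integrability of the nonnegative
          majorant only.\<close>
        by (intro integral_mono') (auto intro!: Bochner_Integration.integrable_add)
      also have "\<dots> = 2 * B * p' ^ k + 2 * B * R ^ (w + k) * exp (- g * t)"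
        using int integral_of_bool_all_True[of p' S] assms(3,4) N.prob_space by (simp add: S_def)
      also have "\<dots> \<le> 2 * B * (exp (- m * t) / p') + 2 * B * (R ^ w * exp (- m * t))"
      proof -
        have "p' ^ k = exp (- (real k * ln (1 / p')))"
          using assms(3) by (simp add: ln_div exp_of_nat_mult)
        also have "\<dots> \<le> exp (- m * t + ln (1 / p'))"
        proof -
          have "(d * t - 1) * ln (1 / p') \<le> real k * ln (1 / p')"
            using k assms(3,4) by (intro mult_right_mono) auto
          moreover have "m * t \<le> (d * ln (1 / p')) * t"
            using m t by (intro mult_right_mono) auto
          ultimately show ?thesis
            by (simp add: algebra_simps)
        qed
        also have "\<dots> = exp (- m * t) / p'"
        proof -
          have "exp (ln (1 / p')) = 1 / p'"
            using assms(3) by (intro exp_ln) simp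
          then show ?thesis
            unfolding exp_add by (simp only: times_divide_eq_right mult_1_right)
        qed
        finally have 1: "p' ^ k \<le> exp (- m * t) / p'" .
        have "R ^ k * exp (- g * t) = exp (real k * ln R - g * t)"
          using R by (simp add: exp_diff exp_of_nat_mult exp_minus divide_inverse)
        also have "\<dots> \<le> exp (- m * t)"
        proof -
          have "real k * ln R \<le> (d * t) * ln R"
            using k lnR by (intro mult_right_mono) auto
          also have "\<dots> = (d * ln R) * t"
            by simp
          also have "\<dots> \<le> g / 2 * t"
            using d t by (intro mult_right_mono) auto
          finally have "real k * ln R \<le> g / 2 * t" .
          moreover have "m * t \<le> g / 2 * t"
            using m t by (intro mult_right_mono) auto
          ultimately show ?thesis
            by simp
        qed
        finally have 2: "R ^ w * (R ^ k * exp (- g * t)) \<le> R ^ w * exp (- m * t)"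
          using R by (intro mult_left_mono) auto
        show ?thesis
          using mult_left_mono[OF 1, of "2 * B"] mult_left_mono[OF 2, of "2 * B"] B(1)
          by (simp add: power_add mult.assoc)
      qed
      also have "\<dots> = C * exp (- m * t)"
        by (simp add: C_def algebra_simps)
      finally show ?thesis .
    qed
    have part_b: "AE \<eta> in bernoulli_product p'. \<exists>t0\<ge>0. \<forall>t>t0. D t \<eta> \<le> C * exp (- m * t)"
    proof -
      have "AE \<eta> in bernoulli_product p'. \<exists>j::nat. \<not> \<eta> (a + int w + int j)"
        using assms(3,4) by (intro AE_bernoulli_exists_zero) auto
      then show ?thesis
      proof eventually_elim
        case (elim \<eta>)
        then obtain j :: nat where "\<not> \<eta> (a + int w + int j)"
          by blast
        then have j: "\<not> \<eta> (a + int (w + j))"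
          by (simp add: add.assoc)
        have gm: "0 < g - m"
          using m g by simp
        show ?case
        \<comment> \<open>Beyond this time \<open>R ^ j * exp (- g * t) \<le> exp (- m * t)\<close>:
          the distance \<open>j\<close> to the first zero found enters the waiting time and not the
          constant \<open>C\<close>.\<close>
        proof (intro exI[of _ "real j * ln R / (g - m)"] conjI allI impI)
          show t0: "0 \<le> real j * ln R / (g - m)"
            using gm lnR by simp
          fix t assume t: "real j * ln R / (g - m) < t"
          have "D t \<eta> \<le> 2 * B * R ^ (w + j) * exp (- g * t)"
            using t t0 j by (intro D1) auto
          also have "\<dots> = 2 * B * R ^ w * (R ^ j * exp (- g * t))"
            by (simp add: power_add)
          also have "R ^ j * exp (- g * t) = exp (real j * ln R - g * t)"
            using R by (simp add: exp_diff exp_of_nat_mult exp_minus divide_inverse)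
          also have "\<dots> \<le> exp (- m * t)"
            using t gm by (simp add: pos_divide_less_eq algebra_simps)
          also have "2 * B * R ^ w * exp (- m * t) \<le> C * exp (- m * t)"
            using B(1) assms(3) by (intro mult_right_mono) (auto simp: C_def)
          finally show "D t \<eta> \<le> C * exp (- m * t)"
            using B(1) R by (simp add: mult_left_mono)
        qed
      qed
    qed
    show "\<exists>C. (\<forall>t>0. (\<integral>\<eta>. \<bar>(\<integral>w. f (X t w) \<partial>P \<eta>) - (\<integral>\<omega>. f \<omega> \<partial>bernoulli_product p)\<bar>
                       \<partial>bernoulli_product p') \<le> C * exp (- m * t)) \<and>
           (AE \<eta> in bernoulli_product p'. \<exists>t0\<ge>0. \<forall>t>t0.
              \<bar>(\<integral>w. f (X t w) \<partial>P \<eta>) - (\<integral>\<omega>. f \<omega> \<partial>bernoulli_product p)\<bar> \<le> C * exp (- m * t))"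
      using part_a part_b unfolding D_def by blast
  qed
qed

end
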